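(* For every nontrivial knot type $[K]$, $\mathrm{sps}[K]\le s[K]-2$.
   Context: The stick index $s[K]$ of a knot type $[K]$ is the smallest number of straight line segments in a closed polygonal curve in $\mathbb{R}^3$ representing $[K]$. A spherical stick diagram of $[K]$ is a closed curve on the 2-sphere formed by finitely many arcs of great circles (not entire great circles) joined end to end, whose self-intersections are transverse double points away from the arc endpoints, with crossing information at each self-intersection, representing $[K]$. For nontrivial $[K]$, $\mathrm{sps}[K]$ is the minimum number of great circle arcs in such a diagram (undefined for the unknot). *)

theory Defs
  imports "HOL-Analysis.Analysis" "HOL-Analysis.Cross3"
begin

definition ambient_isotopic :: "(real^3) set \<Rightarrow> (real^3) set \<Rightarrow> bool" where
  "ambient_isotopic K1 K2 \<longleftrightarrow>
     (\<exists>H :: (real, real^3) prod \<Rightarrow> real^3.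
        continuous_on (Sigma {0..1} (\<lambda>_. UNIV)) H \<and>
        (\<forall>x. H (0, x) = x) \<and>
        (\<forall>t\<in>{0..1}. \<exists>g. homeomorphism UNIV UNIV (\<lambda>x. H (t, x)) g) \<and>
        (\<lambda>x. H (1, x)) ` K1 = K2)"

definition unknot :: "(real^3) set" where
  "unknot = {x. x$3 = 0 \<and> (x$1)\<^sup>2 + (x$2)\<^sup>2 = 1}"

definition stick_set :: "nat \<Rightarrow> (nat \<Rightarrow> real^3) \<Rightarrow> (real^3) set" where
  "stick_set n v = (\<Union>i<n. closed_segment (v i) (v (Suc i mod n)))"

definition stick_knot :: "nat \<Rightarrow> (nat \<Rightarrow> real^3) \<Rightarrow> bool" where
  "stick_knot n v \<longleftrightarrow> 3 \<le> n \<and>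
     (\<forall>i<n. v i \<noteq> v (Suc i mod n)) \<and>
     (\<forall>i<n. closed_segment (v i) (v (Suc i mod n)) \<inter>
              closed_segment (v (Suc i mod n)) (v (Suc (Suc i) mod n)) = {v (Suc i mod n)}) \<and>
     (\<forall>i<n. \<forall>j<n. i \<noteq> j \<and> j \<noteq> Suc i mod n \<and> i \<noteq> Suc j mod n \<longrightarrow>
        closed_segment (v i) (v (Suc i mod n)) \<inter> closed_segment (v j) (v (Suc j mod n)) = {})"

definition stick_index :: "(real^3) set \<Rightarrow> nat" where
  "stick_index K = (LEAST n. \<exists>v. stick_knot n v \<and> ambient_isotopic (stick_set n v) K)"

text \<open>Arc i of a spherical stick diagram starts at the unit vector u i, has unit initial
  tangent w i (orthogonal to u i) and angle th i in (0, 2 pi) (so it is an arc of a great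
  circle, not an entire great circle).  The closed curve is parametrised over [0,1],
  arc i occupying [i/n, (i+1)/n].\<close>

definition sph_arc :: "real^3 \<Rightarrow> real^3 \<Rightarrow> real \<Rightarrow> real \<Rightarrow> real^3" where
  "sph_arc u w th t = cos (t * th) *\<^sub>R u + sin (t * th) *\<^sub>R w"

definition sph_curve :: "nat \<Rightarrow> (nat \<Rightarrow> real^3) \<Rightarrow> (nat \<Rightarrow> real^3) \<Rightarrow> (nat \<Rightarrow> real) \<Rightarrow> real \<Rightarrow> real^3" where
  "sph_curve n u w th s =
     (let k = \<lfloor>real n * s\<rfloor>; i = nat k mod n
      in sph_arc (u i) (w i) (th i) (real n * s - real_of_int k))"

definition sph_idx :: "nat \<Rightarrow> real \<Rightarrow> nat" where
  "sph_idx n s = nat \<lfloor>real n * s\<rfloor> mod n"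

text \<open>A spherical stick diagram (without crossing information) with n arcs:
  the arcs join end to end into a closed curve; every self-intersection is a double
  point, lies in the interior of both arcs (away from all arc endpoints), and is
  transverse (the two great circles are distinct).\<close>

definition sph_stick_curve :: "nat \<Rightarrow> (nat \<Rightarrow> real^3) \<Rightarrow> (nat \<Rightarrow> real^3) \<Rightarrow> (nat \<Rightarrow> real) \<Rightarrow> bool" where
  "sph_stick_curve n u w th \<longleftrightarrow> 0 < n \<and>
     (\<forall>i<n. norm (u i) = 1 \<and> norm (w i) = 1 \<and> u i \<bullet> w i = 0 \<and>
            0 < th i \<and> th i < 2 * pi \<and>
            sph_arc (u i) (w i) (th i) 1 = u (Suc i mod n)) \<and>
     (\<forall>s1\<in>{0..<1}. \<forall>s2\<in>{0..<1}. s1 \<noteq> s2 \<and>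
         sph_curve n u w th s1 = sph_curve n u w th s2 \<longrightarrow>
           real n * s1 \<notin> \<int> \<and> real n * s2 \<notin> \<int> \<and>
           (let i = sph_idx n s1; j = sph_idx n s2 in
              cross3 (u i) (w i) \<noteq> cross3 (u j) (w j) \<and> cross3 (u i) (w i) \<noteq> - cross3 (u j) (w j))) \<and>
     (\<forall>s1\<in>{0..<1}. \<forall>s2\<in>{0..<1}. \<forall>s3\<in>{0..<1}.
         s1 \<noteq> s2 \<and> s1 \<noteq> s3 \<and> s2 \<noteq> s3 \<longrightarrow>
         \<not> (sph_curve n u w th s1 = sph_curve n u w th s2 \<and>
              sph_curve n u w th s2 = sph_curve n u w th s3))"

text \<open>A spherical stick diagram with n arcs represents the knot type of K if, for some
  choice of crossing information, the knot it determines is of the type of K.  Crossing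
  information is realised by a radial lift: a positive continuous radius function r such
  that the lifted curve s \<mapsto> r s * gamma s is a simple closed curve in R^3 - {0}
  (at each double point the strand with the larger radius is the over-strand as seen
  from the origin).  Every choice of crossing information is realised this way and all
  lifts with the same crossing information are ambient isotopic.\<close>

definition sph_represents :: "nat \<Rightarrow> (real^3) set \<Rightarrow> bool" where
  "sph_represents n K \<longleftrightarrow>
     (\<exists>u w th. sph_stick_curve n u w th \<and>
        (\<exists>r :: real \<Rightarrow> real.
           continuous_on {0..1} r \<and> (\<forall>s\<in>{0..1}. 0 < r s) \<and> r 0 = r 1 \<and>
           inj_on (\<lambda>s. r s *\<^sub>R sph_curve n u w th s) {0..<1} \<and>
           ambient_isotopic ((\<lambda>s. r s *\<^sub>R sph_curve n u w th s) ` {0..1}) K))"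

definition sps :: "(real^3) set \<Rightarrow> nat" where
  "sps K = (LEAST n. sph_represents n K)"

end

theory Submission
  imports Defs
begin

text \<open>
  Take a stick knot with the minimal number \<open>m + 2\<close> of sticks and put the origin at a vertex
  farthest from some point, so that the other vertices \<open>x 0, \<dots>, x m\<close> lie in an open half space;
  perturb them into general position.  Radial projection turns the \<open>m\<close> sticks not
  meeting the origin into a chain of great circle arcs.  Let \<open>Q\<close> be the
  point in the closed opposite hemisphere where the great circles of the first and the last arc
  intersect.  Prolong the first arc backwards and the last arc forwards to \<open>Q\<close>; both
  stay shorter than \<open>2 \<pi>\<close>, because \<open>Q\<close> lies on neither of the two arcs.  This closes the chain
  without an additional arc.  Near the origin the knot consists only of the two strands through the
  vertex, and these can be isotoped onto the prolongations: twist each strand inside its plane by a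
  rotation whose angle grows as the distance to the origin decreases, and finally push the origin a
  little towards \<open>Q\<close>.  The resulting curve is a radial lift of the \<open>m\<close> arcs.  The construction needs
  \<open>m \<ge> 2\<close>, and this is where nontriviality enters: a triangle is an unknot.
\<close>

section \<open>Ambient isotopies as maps\<close>

text \<open>The obstacle is that a stick at the origin projects to a single point, so an explicit
  ambient isotopy has to spread each of the two strands there over an interval of angles. All
  isotopies are composed of kinds whose bijectivity at every time is visible: displacements with
  Lipschitz constant below 1, rotations by an angle that is itself invariant under the rotation,
  shears, and radial rescalings. The half space is what keeps \<open>Q\<close> off the arcs: a
  functional \<open>h\<close> is positive on all \<open>x i\<close>, hence over the projected
  sticks, but not on \<open>Q\<close>. General position makes the projection a diagram: no three of
  the points are coplanar with the origin, and no three of the great circles share a point. The two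
  twists could disturb each other because their planes share the axis through \<open>Q\<close>. Each
  twist therefore fades out away from its own plane, and the order and the radii are chosen so that
  the other strand is never where a twist acts.\<close>

definition isotopy_map :: "(real^3 \<Rightarrow> real^3) \<Rightarrow> bool" where
  "isotopy_map g \<longleftrightarrow> (\<exists>H :: real \<times> (real^3) \<Rightarrow> real^3.
     continuous_on ({0..1} \<times> UNIV) H \<and> (\<forall>x. H (0, x) = x) \<and>
     (\<forall>t\<in>{0..1}. bij (\<lambda>x. H (t, x))) \<and> (\<forall>x. H (1, x) = g x))"

lemma isotopy_mapI:
  fixes H :: "real \<times> (real^3) \<Rightarrow> real^3"
  assumes "continuous_on ({0..1} \<times> UNIV) H" "\<And>x. H (0, x) = x"
    "\<And>t. t \<in> {0..1} \<Longrightarrow> bij (\<lambda>x. H (t, x))" "\<And>x. H (1, x) = g x"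
  shows "isotopy_map g"
  unfolding isotopy_map_def using assms by (intro exI[of _ H] conjI allI ballI) 

lemma slice_continuous:
  assumes "continuous_on ({0..1::real} \<times> UNIV) H" "t \<in> {0..1}"
  shows "continuous_on UNIV (\<lambda>x. H (t, x))"
proof (rule continuous_on_compose2[OF assms(1)])
  show "continuous_on UNIV (\<lambda>x. (t, x))" by (intro continuous_intros)
  show "(\<lambda>x. (t, x)) ` UNIV \<subseteq> {0..1} \<times> UNIV" using assms(2) by auto
qed

text \<open>Invariance of domain makes the inverse continuous; this is why
  \<open>isotopy_map\<close> asks only for bijectivity at each time.\<close>

lemma continuous_bij_homeomorphism:
  fixes f :: "real^3 \<Rightarrow> real^3"
  assumes "continuous_on UNIV f" "bij f"
  obtains g where "homeomorphism UNIV UNIV f g"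
proof -
  have "inj_on f UNIV" "range f = UNIV" using assms(2) by (simp_all add: bij_def)
  then show thesis
    using invariance_of_domain_homeomorphism[OF open_UNIV assms(1) order_refl] that by metis
qed

lemma homeomorphism_imp_bij: "homeomorphism UNIV UNIV f g \<Longrightarrow> bij f"
  unfolding homeomorphism_def by (intro bij_betw_byWitness[of _ g]) simp_all

lemma ambient_isotopic_iff:
  "ambient_isotopic K1 K2 \<longleftrightarrow> (\<exists>g. isotopy_map g \<and> g ` K1 = K2)"
proof
  assume "ambient_isotopic K1 K2"
  then obtain H :: "real \<times> (real^3) \<Rightarrow> real^3" where
    H: "continuous_on ({0..1} \<times> UNIV) H" "\<And>x. H (0, x) = x"
      "\<And>t. t \<in> {0..1} \<Longrightarrow> \<exists>g. homeomorphism UNIV UNIV (\<lambda>x. H (t, x)) g"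
      "(\<lambda>x. H (1, x)) ` K1 = K2"
    unfolding ambient_isotopic_def by blast
  have "bij (\<lambda>x. H (t, x))" if "t \<in> {0..1}" for t
    using H(3)[OF that] homeomorphism_imp_bij by blast
  then have "isotopy_map (\<lambda>x. H (1, x))"
    using H(1,2) by (intro isotopy_mapI[of H]) auto
  with H(4) show "\<exists>g. isotopy_map g \<and> g ` K1 = K2" by blast
next
  assume "\<exists>g. isotopy_map g \<and> g ` K1 = K2"
  then obtain g H where g: "g ` K1 = K2" and
    H: "continuous_on ({0..1::real} \<times> UNIV) H" "\<And>x. H (0, x) = x"
      "\<And>t. t \<in> {0..1} \<Longrightarrow> bij (\<lambda>x. H (t, x))" "\<And>x. H (1, x) = g x"
    unfolding isotopy_map_def by blast
  have "\<exists>g. homeomorphism UNIV UNIV (\<lambda>x. H (t, x)) g" if "t \<in> {0..1}" for t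
    by (rule continuous_bij_homeomorphism[OF slice_continuous[OF H(1) that] H(3)[OF that]]) blast
  moreover have "(\<lambda>x. H (1, x)) ` K1 = K2" using g H(4) by simp
  ultimately show "ambient_isotopic K1 K2"
    unfolding ambient_isotopic_def using H(1,2) by (intro exI[of _ H] conjI allI ballI) simp_all
qed

lemma isotopy_map_bij:
  assumes "isotopy_map g"
  shows "bij g"
proof -
  obtain H :: "real \<times> (real^3) \<Rightarrow> real^3" where
    H: "\<And>t. t \<in> {0..1} \<Longrightarrow> bij (\<lambda>x. H (t, x))" "\<And>x. H (1, x) = g x"
    using assms unfolding isotopy_map_def by blast
  have "(\<lambda>x. H (1, x)) = g" using H(2) by (rule ext)
  then show ?thesis using H(1)[of 1] by simp
qed

lemma isotopy_map_inj: "isotopy_map g \<Longrightarrow> inj g"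
  using isotopy_map_bij bij_is_inj by blast

lemma isotopy_map_comp:
  assumes "isotopy_map f" "isotopy_map g"
  shows "isotopy_map (g \<circ> f)"
proof -
  obtain F G :: "real \<times> (real^3) \<Rightarrow> real^3" where
    F: "continuous_on ({0..1} \<times> UNIV) F" "\<And>x. F (0, x) = x"
      "\<And>t. t \<in> {0..1} \<Longrightarrow> bij (\<lambda>x. F (t, x))" "\<And>x. F (1, x) = f x" and
    G: "continuous_on ({0..1} \<times> UNIV) G" "\<And>x. G (0, x) = x"
      "\<And>t. t \<in> {0..1} \<Longrightarrow> bij (\<lambda>x. G (t, x))" "\<And>x. G (1, x) = g x"
    using assms unfolding isotopy_map_def by blast
  show ?thesis
  proof (rule isotopy_mapI[of "\<lambda>p. G (fst p, F p)"])
    show "continuous_on ({0..1} \<times> UNIV) (\<lambda>p. G (fst p, F p))"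
    proof (rule continuous_on_compose2[OF G(1)])
      show "continuous_on ({0..1} \<times> UNIV) (\<lambda>p. (fst p, F p))"
        by (intro continuous_intros F(1))
    qed auto
    show "bij (\<lambda>x. G (fst (t, x), F (t, x)))" if "t \<in> {0..1}" for t
      using bij_comp[OF F(3)[OF that] G(3)[OF that]] by (simp add: o_def)
  qed (simp_all add: F G)
qed

text \<open>The given isotopy is run backwards after \<open>inv g\<close>: at time 0 the two cancel,
  at time 1 only \<open>inv g\<close> is left.\<close>

lemma isotopy_map_inv:
  assumes "isotopy_map g"
  shows "isotopy_map (inv g)"
proof -
  obtain H :: "real \<times> (real^3) \<Rightarrow> real^3" where
    H: "continuous_on ({0..1} \<times> UNIV) H" "\<And>x. H (0, x) = x"
      "\<And>t. t \<in> {0..1} \<Longrightarrow> bij (\<lambda>x. H (t, x))" "\<And>x. H (1, x) = g x"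
    using assms unfolding isotopy_map_def by blast
  have bg: "bij g" by (rule isotopy_map_bij[OF assms])
  have "continuous_on UNIV g"
    using slice_continuous[OF H(1), of 1] by (simp add: H(4))
  then obtain g' where g': "homeomorphism UNIV UNIV g g'"
    using continuous_bij_homeomorphism bg by blast
  have eq: "inv g = g'"
    using g' by (intro inv_equality) (simp_all add: homeomorphism_def)
  then have cont: "continuous_on UNIV (inv g)"
    using g' by (simp add: homeomorphism_def)
  have bi: "bij (inv g)" by (rule bij_imp_bij_inv[OF bg])
  show ?thesis
  proof (rule isotopy_mapI[of "\<lambda>p. H (1 - fst p, inv g (snd p))"])
    show "continuous_on ({0..1} \<times> UNIV) (\<lambda>p. H (1 - fst p, inv g (snd p)))"
    proof (rule continuous_on_compose2[OF H(1)])
      show "continuous_on ({0..1} \<times> UNIV) (\<lambda>p::real \<times> (real^3). (1 - fst p, inv g (snd p)))"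
        by (intro continuous_intros continuous_on_compose2[OF cont]) simp
    qed auto
    show "H (1 - fst (0, x), inv g (snd (0, x))) = x" for x
      using bg by (simp add: H(4) bij_is_surj surj_f_inv_f)
    show "bij (\<lambda>x. H (1 - fst (t, x), inv g (snd (t, x))))" if "t \<in> {0..1}" for t
      using bij_comp[OF bi H(3)[of "1 - t"]] that by (simp add: o_def)
  qed (simp add: H)
qed

lemma ambient_isotopic_image: "isotopy_map g \<Longrightarrow> ambient_isotopic K (g ` K)"
  unfolding ambient_isotopic_iff by blast

lemma ambient_isotopic_sym:
  assumes "ambient_isotopic K1 K2"
  shows "ambient_isotopic K2 K1"
proof -
  obtain g where g: "isotopy_map g" and K2: "g ` K1 = K2"
    using assms ambient_isotopic_iff by blast
  have "inv g ` (g ` K1) = K1"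
    by (rule image_inv_f_f[OF isotopy_map_inj[OF g]])
  then show ?thesis
    using ambient_isotopic_image[OF isotopy_map_inv[OF g], of K2] K2 by simp
qed

lemma ambient_isotopic_trans:
  assumes "ambient_isotopic K1 K2" "ambient_isotopic K2 K3"
  shows "ambient_isotopic K1 K3"
proof -
  obtain f where f: "isotopy_map f" and K2: "f ` K1 = K2"
    using assms(1) unfolding ambient_isotopic_iff by (elim exE conjE)
  obtain g where g: "isotopy_map g" and K3: "g ` K2 = K3"
    using assms(2) unfolding ambient_isotopic_iff by (elim exE conjE)
  have "(g \<circ> f) ` K1 = K3" unfolding K3[symmetric] K2[symmetric] by (rule image_comp[symmetric])
  then show ?thesis
    using ambient_isotopic_image[OF isotopy_map_comp[OF f g], of K1] by simp
qed

text \<open>The preimages of \<open>y\<close> at time \<open>t\<close> are the fixed points of the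
  contraction sending \<open>x\<close> to \<open>y\<close> minus \<open>t\<close> times
  \<open>D x\<close>, so Banach's theorem gives bijectivity.\<close>

lemma isotopy_map_Lipschitz_displacement:
  fixes D :: "real^3 \<Rightarrow> real^3"
  assumes L: "L < 1" and D: "\<And>x y. norm (D x - D y) \<le> L * norm (x - y)"
  shows "isotopy_map (\<lambda>x. x + D x)"
proof -
  have L0: "0 \<le> L"
  proof -
    obtain x :: "real^3" where "norm x = 1" using vector_choose_size[of 1] by auto
    then show ?thesis using order_trans[OF norm_ge_zero D[of x 0]] by simp
  qed
  have Dc: "continuous_on UNIV D"
  proof (rule lipschitz_on_continuous_on)
    show "L-lipschitz_on UNIV D"
      using D L0 by (auto simp: lipschitz_on_def dist_norm)
  qed
  show ?thesis
  proof (rule isotopy_mapI[of "\<lambda>p. snd p + fst p *\<^sub>R D (snd p)"])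
    show "continuous_on ({0..1} \<times> UNIV) (\<lambda>p. snd p + fst p *\<^sub>R D (snd p))"
      by (intro continuous_intros continuous_on_compose2[OF Dc]) simp
    show "bij (\<lambda>x. snd (t, x) + fst (t, x) *\<^sub>R D (snd (t, x)))" if t: "t \<in> {0..1}" for t
    proof -
      have tD: "norm (t *\<^sub>R D x - t *\<^sub>R D y) \<le> L * norm (x - y)" for x y
      proof -
        have "norm (t *\<^sub>R D x - t *\<^sub>R D y) = t * norm (D x - D y)"
          using t by (simp flip: scaleR_diff_right)
        also have "\<dots> \<le> 1 * (L * norm (x - y))"
          using t D[of x y] by (intro mult_mono) auto
        finally show ?thesis by simp
      qed
      have "\<exists>!x. x + t *\<^sub>R D x = y" for y
      proof -
        have "\<exists>!x. y - t *\<^sub>R D x = x"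
        proof (rule banach_fix_type[OF L0 L], intro allI)
          show "dist (y - t *\<^sub>R D u) (y - t *\<^sub>R D v) \<le> L * dist u v" for u v
            using tD[of v u] by (simp add: dist_norm norm_minus_commute)
        qed
        moreover have "y - t *\<^sub>R D x = x \<longleftrightarrow> x + t *\<^sub>R D x = y" for x
          by (metis add_diff_cancel diff_add_cancel)
        ultimately show ?thesis by simp
      qed
      then show ?thesis by (simp add: bij_iff)
    qed
  qed simp_all
qed

lemma isotopy_map_translation: "isotopy_map (\<lambda>x. x + c)"
  using isotopy_map_Lipschitz_displacement[of 0 "\<lambda>_. c"] by simp

section \<open>Perturbing the vertices of an embedded graph\<close>

lemma closed_segmentE:
  fixes x a b :: "real^3"
  assumes "x \<in> closed_segment a b"
  obtains t where "0 \<le> t" "t \<le> 1" "x = (1 - t) *\<^sub>R a + t *\<^sub>R b"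
proof -
  from assms have "\<exists>t. (0 \<le> t \<and> t \<le> 1) \<and> x = (1 - t) *\<^sub>R a + t *\<^sub>R b"
    unfolding in_segment by (auto simp only: conj_assoc)
  then show thesis by (elim exE conjE) (rule that)
qed

lemma le_infdist_iff:
  assumes "A \<noteq> {}"
  shows "d \<le> infdist x A \<longleftrightarrow> (\<forall>z\<in>A. d \<le> dist x z)"
proof
  assume "d \<le> infdist x A"
  then show "\<forall>z\<in>A. d \<le> dist x z" using infdist_le order_trans by metis
next
  assume "\<forall>z\<in>A. d \<le> dist x z"
  then show "d \<le> infdist x A"
    unfolding infdist_notempty[OF assms] by (intro cINF_greatest assms) auto
qed

text \<open>Two segments that meet only in \<open>p\<close> leave it in different directions. With
  \<open>p\<close> moved to 0, the first lies on a ray \<open>R\<close>, and distances to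
  \<open>R\<close> scale linearly along the second; hence the distance of \<open>b' - p\<close> from
  \<open>R\<close>, divided by the length of \<open>b' - p\<close>, serves as
  \<open>k\<close>.\<close>

lemma closed_segment_angle:
  fixes p b b' :: "real^3"
  assumes "b \<noteq> p" "b' \<noteq> p" and disj: "closed_segment p b \<inter> closed_segment p b' \<subseteq> {p}"
  obtains k where "k > 0" "\<And>x. x \<in> closed_segment p b' \<Longrightarrow> k * norm (x - p) \<le> infdist x (closed_segment p b)"
proof -
  define R where "R = (\<lambda>t. t *\<^sub>R (b - p)) ` {0::real..}"
  have "linear (\<lambda>t. t *\<^sub>R (b - p))" by (simp add: linear_iff scaleR_add_left)
  moreover have "inj (\<lambda>t. t *\<^sub>R (b - p))" using assms(1) by (auto simp: inj_on_def)
  ultimately have "closed R"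
    unfolding R_def by (intro closed_injective_linear_image) auto
  \<comment> \<open>If \<open>b'\<close> were on the ray, the nearer of \<open>b\<close> and
    \<open>b'\<close> to \<open>p\<close> would lie on both segments.\<close>
  have "b' - p \<notin> R"
  proof
    assume "b' - p \<in> R"
    then obtain t where t: "t \<ge> 0" "b' - p = t *\<^sub>R (b - p)" by (auto simp: R_def)
    have t0: "t > 0" using t assms(2) by (cases "t = 0") auto
    show False
    proof (cases "t \<le> 1")
      case True
      have "b' = (1 - t) *\<^sub>R p + t *\<^sub>R b" using t(2) by (simp add: algebra_simps)
      then have "b' \<in> closed_segment p b" using True t(1) by (auto simp: in_segment)
      then show False using disj assms(2) by auto
    next
      case False
      have "b - p = (1 / t) *\<^sub>R (b' - p)" using t0 by (simp add: t(2))
      then have "b = (1 - 1 / t) *\<^sub>R p + (1 / t) *\<^sub>R b'" by (simp add: algebra_simps)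
      then have "b \<in> closed_segment p b'" using False t0
        unfolding in_segment by (intro exI[of _ "1 / t"]) auto
      then show False using disj assms(1) by auto
    qed
  qed
  then have pos: "infdist (b' - p) R > 0"
    using \<open>closed R\<close> infdist_pos_not_in_closed[of R "b' - p"] by (auto simp: R_def)
  define k where "k = infdist (b' - p) R / norm (b' - p)"
  have k: "k > 0" unfolding k_def using pos assms(2) by simp
  moreover have "k * norm (x - p) \<le> infdist x (closed_segment p b)" if xin: "x \<in> closed_segment p b'" for x
  proof -
    obtain s where s: "0 \<le> s" "s \<le> 1" "x = (1 - s) *\<^sub>R p + s *\<^sub>R b'"
      using xin by (rule closed_segmentE)
    have xp: "x - p = s *\<^sub>R (b' - p)" using s(3) by (simp add: algebra_simps)
    have le: "s * infdist (b' - p) R \<le> dist x z" if zin: "z \<in> closed_segment p b" for z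
    proof (cases "s = 0")
      case False
      obtain t where t: "0 \<le> t" "t \<le> 1" "z = (1 - t) *\<^sub>R p + t *\<^sub>R b"
        using zin by (rule closed_segmentE)
      have zp: "z - p = t *\<^sub>R (b - p)" using t(3) by (simp add: algebra_simps)
      have "(t / s) *\<^sub>R (b - p) \<in> R" unfolding R_def using s(1) t(1) by auto
      then have "infdist (b' - p) R \<le> norm ((b' - p) - (t / s) *\<^sub>R (b - p))"
        using infdist_le[of "(t / s) *\<^sub>R (b - p)" R "b' - p"] by (simp add: dist_norm)
      then have "s * infdist (b' - p) R \<le> s * norm ((b' - p) - (t / s) *\<^sub>R (b - p))"
        using s(1) by (intro mult_left_mono)
      also have "\<dots> = norm (s *\<^sub>R ((b' - p) - (t / s) *\<^sub>R (b - p)))" using s(1) by simp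
      also have "s *\<^sub>R ((b' - p) - (t / s) *\<^sub>R (b - p)) = (x - p) - (z - p)"
        unfolding xp zp using False by (simp add: scaleR_diff_right)
      finally show ?thesis by (simp add: dist_norm)
    qed simp
    have "k * norm (x - p) = s * infdist (b' - p) R"
      unfolding xp k_def using s(1) assms(2) by simp
    then show ?thesis using le by (subst le_infdist_iff) auto
  qed
  ultimately show thesis by (rule that)
qed

text \<open>For large \<open>M\<close>, the maximum of these functions over all edges at \<open>p\<close> (and \<open>0\<close>) extends the
  piecewise linear function on the graph that is \<open>1\<close> at \<open>p\<close> and \<open>0\<close> at the other vertices.\<close>

definition edge_hat :: "real^3 \<Rightarrow> real^3 \<Rightarrow> real \<Rightarrow> real^3 \<Rightarrow> real" where
  "edge_hat p b M x = 1 - norm (x - p) / norm (b - p) - M * infdist x (closed_segment p b)"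

lemma edge_hat_self:
  assumes "b \<noteq> p" "0 \<le> t" "t \<le> 1"
  shows "edge_hat p b M ((1 - t) *\<^sub>R p + t *\<^sub>R b) = 1 - t"
proof -
  have "(1 - t) *\<^sub>R p + t *\<^sub>R b - p = t *\<^sub>R (b - p)" by (simp add: algebra_simps)
  moreover have "(1 - t) *\<^sub>R p + t *\<^sub>R b \<in> closed_segment p b" using assms by (auto simp: in_segment)
  ultimately show ?thesis using assms by (simp add: edge_hat_def)
qed

text \<open>At distance at least \<open>d\<close> from the segment, a penalty factor of at least
  \<open>1 / d\<close> outweighs the constant 1.\<close>

lemma edge_hat_disjoint:
  assumes "compact S" "S \<inter> closed_segment p b = {}"
  shows "eventually (\<lambda>M. \<forall>x\<in>S. edge_hat p b M x \<le> 0) at_top"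
proof -
  obtain d where d: "d > 0" "\<And>x y. x \<in> S \<Longrightarrow> y \<in> closed_segment p b \<Longrightarrow> d \<le> dist x y"
    using separate_compact_closed[OF assms(1) closed_segment assms(2)] by blast
  show ?thesis
    unfolding eventually_at_top_linorder
  proof (intro exI[of _ "1 / d"] allI impI ballI)
    fix M x assume M: "1 / d \<le> M" and x: "x \<in> S"
    have "d \<le> infdist x (closed_segment p b)" using d(2)[OF x] by (subst le_infdist_iff) auto
    then have "1 / d * d \<le> M * infdist x (closed_segment p b)"
      using M d(1) by (intro mult_mono) (auto intro: order_trans[of 0 "1/d"])
    then have "1 \<le> M * infdist x (closed_segment p b)" using d(1) by simp
    then show "edge_hat p b M x \<le> 0"
      unfolding edge_hat_def using divide_nonneg_nonneg[OF norm_ge_zero norm_ge_zero, of "x - p" "b - p"]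
      by linarith
  qed
qed

text \<open>The penalty grows at least like \<open>M * k * norm (x - p)\<close>, which for large
  \<open>M\<close> covers the decrease of the target function along the other edge.\<close>

lemma edge_hat_common_base:
  assumes "b \<noteq> p" "b' \<noteq> p" "closed_segment p b \<inter> closed_segment p b' \<subseteq> {p}"
  shows "eventually (\<lambda>M. \<forall>x\<in>closed_segment p b'. edge_hat p b M x \<le> 1 - norm (x - p) / norm (b' - p)) at_top"
proof -
  obtain k where k: "k > 0"
    "\<And>x. x \<in> closed_segment p b' \<Longrightarrow> k * norm (x - p) \<le> infdist x (closed_segment p b)"
    using closed_segment_angle[OF assms] by blast
  define n where "n = norm (b' - p)"
  have n: "n > 0" using assms(2) by (simp add: n_def)
  show ?thesis
    unfolding eventually_at_top_linorder
  proof (intro exI[of _ "1 / (k * n)"] allI impI ballI)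
    fix M x assume M: "1 / (k * n) \<le> M" and x: "x \<in> closed_segment p b'"
    have "1 / (k * n) * (k * norm (x - p)) \<le> M * infdist x (closed_segment p b)"
      using M k(1) k(2)[OF x] n by (intro mult_mono) (auto intro: order_trans[of 0 "1/(k*n)"])
    then have "norm (x - p) / n \<le> M * infdist x (closed_segment p b)"
      using k(1) by simp
    then show "edge_hat p b M x \<le> 1 - norm (x - p) / norm (b' - p)"
      unfolding edge_hat_def n_def
      using divide_nonneg_nonneg[OF norm_ge_zero norm_ge_zero, of "x - p" "b - p"] by linarith
  qed
qed

text \<open>By the triangle inequality the hat without its penalty is at most
  \<open>norm (x - b) / n\<close>, and the penalty grows linearly in \<open>norm (x - b)\<close> as
  well.\<close>

lemma edge_hat_common_end:
  assumes "b \<noteq> p" "b' \<noteq> b" "closed_segment p b \<inter> closed_segment b b' \<subseteq> {b}"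
  shows "eventually (\<lambda>M. \<forall>x\<in>closed_segment b b'. edge_hat p b M x \<le> 0) at_top"
proof -
  have "closed_segment b p \<inter> closed_segment b b' \<subseteq> {b}"
    using assms(3) by (simp add: closed_segment_commute)
  then obtain k where k: "k > 0"
    "\<And>x. x \<in> closed_segment b b' \<Longrightarrow> k * norm (x - b) \<le> infdist x (closed_segment b p)"
    using closed_segment_angle[of p b b'] assms(1,2) by metis
  define n where "n = norm (b - p)"
  have n: "n > 0" using assms(1) by (simp add: n_def)
  show ?thesis
    unfolding eventually_at_top_linorder
  proof (intro exI[of _ "1 / (k * n)"] allI impI ballI)
    fix M x assume M: "1 / (k * n) \<le> M" and x: "x \<in> closed_segment b b'"
    have "1 / (k * n) * (k * norm (x - b)) \<le> M * infdist x (closed_segment b p)"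
      using M k(1) k(2)[OF x] n by (intro mult_mono) (auto intro: order_trans[of 0 "1/(k*n)"])
    then have A: "norm (x - b) / n \<le> M * infdist x (closed_segment p b)"
      using k(1) by (simp add: closed_segment_commute)
    have "n \<le> norm (x - p) + norm (x - b)"
      unfolding n_def using norm_triangle_ineq4[of "x - p" "x - b"] by simp
    then have "1 \<le> norm (x - p) / n + norm (x - b) / n"
      using n by (simp add: field_simps)
    then show "edge_hat p b M x \<le> 0"
      unfolding edge_hat_def using A by (simp add: n_def)
  qed
qed

section \<open>Straight line graphs embedded in space\<close>

definition edge_set :: "('i \<Rightarrow> real^3) \<Rightarrow> 'i \<times> 'i \<Rightarrow> (real^3) set" where
  "edge_set p e = closed_segment (p (fst e)) (p (snd e))"

text \<open>Vertices are named by indices, so that moving them means changing \<open>p\<close>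
  alone. There is an edge set instead of a cyclic numbering because sticks are later subdivided at
  vertices with fresh indices.\<close>

definition embedded_graph :: "('i \<times> 'i) set \<Rightarrow> ('i \<Rightarrow> real^3) \<Rightarrow> bool" where
  "embedded_graph E p \<longleftrightarrow> finite E \<and> (\<forall>e\<in>E. p (fst e) \<noteq> p (snd e)) \<and>
     (\<forall>e\<in>E. \<forall>e'\<in>E. e \<noteq> e' \<longrightarrow>
        edge_set p e \<inter> edge_set p e' \<subseteq> p ` ({fst e, snd e} \<inter> {fst e', snd e'}))"

abbreviation edge_point :: "('i \<Rightarrow> real^3) \<Rightarrow> 'i \<Rightarrow> 'i \<Rightarrow> real \<Rightarrow> real^3" where
  "edge_point p i j t \<equiv> (1 - t) *\<^sub>R p i + t *\<^sub>R p j"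

abbreviation vertex_weight :: "'i \<Rightarrow> 'i \<Rightarrow> 'i \<Rightarrow> real \<Rightarrow> real" where
  "vertex_weight c i j t \<equiv> (1 - t) * (if c = i then 1 else 0) + t * (if c = j then 1 else 0)"

text \<open>If \<open>{c, b} = {i, j}\<close>, the hat is the weight itself. Otherwise the two edges
  share \<open>c\<close>, share \<open>b\<close>, or are disjoint, and each case is one of the
  estimates above.\<close>

lemma edge_hat_le:
  fixes p :: "'i \<Rightarrow> real^3"
  assumes ne: "p c \<noteq> p b" "p i \<noteq> p j"
    and meet: "{c, b} \<noteq> {i, j} \<Longrightarrow>
      closed_segment (p c) (p b) \<inter> closed_segment (p i) (p j) \<subseteq> p ` ({c, b} \<inter> {i, j})"
  shows "eventually (\<lambda>M. \<forall>t\<in>{0..1}. edge_hat (p c) (p b) M (edge_point p i j t)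
    \<le> vertex_weight c i j t) at_top"
proof -
  define P where "P i j M \<longleftrightarrow> (\<forall>t\<in>{0..1}. edge_hat (p c) (p b) M (edge_point p i j t)
    \<le> vertex_weight c i j t)" for i j M
  \<comment> \<open>Reversing an edge exchanges \<open>t\<close> and \<open>1 - t\<close>, so a
    shared end may be assumed to come first.\<close>
  have swap: "P i j M \<longleftrightarrow> P j i M" for i j M
  proof -
    have "P j i M" if "P i j M" for i j
      unfolding P_def
    proof
      fix t :: real assume "t \<in> {0..1}"
      then have "1 - t \<in> {0..1}" by auto
      then have "edge_hat (p c) (p b) M ((1 - (1 - t)) *\<^sub>R p i + (1 - t) *\<^sub>R p j)
        \<le> (1 - (1 - t)) * (if c = i then 1 else 0) + (1 - t) * (if c = j then 1 else 0)"
        using that unfolding P_def by blast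
      then show "edge_hat (p c) (p b) M (edge_point p j i t)
        \<le> vertex_weight c j i t"
        by (simp add: add.commute)
    qed
    then show ?thesis by blast
  qed
  have onseg: "edge_point p i j t \<in> closed_segment (p i) (p j)" if "t \<in> {0..1}" for t i j
    using that by (auto simp: in_segment)
  have base: "eventually (P c j) at_top"
    if "p c \<noteq> p j" and m: "{c, b} \<noteq> {c, j} \<Longrightarrow>
      closed_segment (p c) (p b) \<inter> closed_segment (p c) (p j) \<subseteq> p ` ({c, b} \<inter> {c, j})" for j
  proof (cases "b = j")
    case True
    have "P c j M" for M
      using edge_hat_self[of "p b" "p c"] ne(1) True by (auto simp: P_def)
    then show ?thesis by (intro always_eventually allI)
  next
    case False
    have cj: "c \<noteq> j" "c \<noteq> b" using that(1) ne(1) by auto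
    then have "{c, b} \<inter> {c, j} = {c}" "{c, b} \<noteq> {c, j}" using False by auto
    then have "closed_segment (p c) (p b) \<inter> closed_segment (p c) (p j) \<subseteq> {p c}" using m by auto
    then have "eventually (\<lambda>M. \<forall>x\<in>closed_segment (p c) (p j).
        edge_hat (p c) (p b) M x \<le> 1 - norm (x - p c) / norm (p j - p c)) at_top"
      using ne(1) that(1) by (intro edge_hat_common_base) auto
    then show ?thesis
    proof eventually_elim
      case (elim M)
      show ?case unfolding P_def
      proof
        fix t :: real assume t: "t \<in> {0..1}"
        have "edge_point p c j t - p c = t *\<^sub>R (p j - p c)" by (simp add: algebra_simps)
        then have "norm (edge_point p c j t - p c) / norm (p j - p c) = t"
          using t that(1) by simp
        then show "edge_hat (p c) (p b) M (edge_point p c j t)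
          \<le> vertex_weight c c j t"
          using elim[rule_format, OF onseg[OF t]] cj by simp
      qed
    qed
  qed
  have ends: "eventually (P b j) at_top" if "p b \<noteq> p j" "c \<noteq> j"
    and m: "closed_segment (p c) (p b) \<inter> closed_segment (p b) (p j) \<subseteq> p ` ({c, b} \<inter> {b, j})" for j
  proof -
    have cb: "c \<noteq> b" using ne(1) by auto
    have "{c, b} \<inter> {b, j} = {b}" using that(2) cb by auto
    then have "closed_segment (p c) (p b) \<inter> closed_segment (p b) (p j) \<subseteq> {p b}" using m by auto
    then have "eventually (\<lambda>M. \<forall>x\<in>closed_segment (p b) (p j). edge_hat (p c) (p b) M x \<le> 0) at_top"
      using ne(1) that(1) by (intro edge_hat_common_end) auto
    then show ?thesis
    proof eventually_elim
      case (elim M)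
      then show ?case unfolding P_def using onseg cb that(2) by simp
    qed
  qed
  consider "c = i" | "c = j" | "c \<noteq> i" "c \<noteq> j" "b = i" | "c \<noteq> i" "c \<noteq> j" "b = j"
    | "{c, b} \<inter> {i, j} = {}" by blast
  then have "eventually (P i j) at_top"
  proof cases
    case 1
    then show ?thesis using base[of j] ne(2) meet by blast
  next
    case 2
    have "eventually (P j i) at_top"
      using base[of i] ne(2) meet 2 by (simp add: insert_commute closed_segment_commute)
    then show ?thesis by (rule eventually_mono) (simp add: swap[of i j])
  next
    case 3
    then show ?thesis using ends[of j] ne(2) meet by blast
  next
    case 4
    then have "{c, b} \<noteq> {i, j}" by auto
    then have "eventually (P j i) at_top"
      using ends[of i] ne(2) meet 4 by (simp add: insert_commute closed_segment_commute)
    then show ?thesis by (rule eventually_mono) (simp add: swap[of i j])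
  next
    case 5
    then have "{c, b} \<noteq> {i, j}" by auto
    then have "closed_segment (p i) (p j) \<inter> closed_segment (p c) (p b) = {}" using meet 5 by auto
    from edge_hat_disjoint[OF compact_segment this] show ?thesis
    proof eventually_elim
      case (elim M)
      then show ?case unfolding P_def using onseg 5 by auto
    qed
  qed
  then show ?thesis unfolding P_def .
qed

lemma edge_hat_Lipschitz:
  assumes "0 \<le> M"
  shows "\<bar>edge_hat p b M x - edge_hat p b M y\<bar> \<le> (1 / norm (b - p) + M) * norm (x - y)"
proof -
  have "\<bar>norm (x - p) - norm (y - p)\<bar> \<le> norm (x - y)"
    using norm_triangle_ineq3[of "x - p" "y - p"] by simp
  then have "\<bar>norm (x - p) - norm (y - p)\<bar> / norm (b - p) \<le> norm (x - y) / norm (b - p)"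
    by (intro divide_right_mono) auto
  then have 1: "\<bar>norm (x - p) / norm (b - p) - norm (y - p) / norm (b - p)\<bar> \<le> norm (x - y) / norm (b - p)"
    by (simp flip: diff_divide_distrib)
  have "\<bar>infdist x (closed_segment p b) - infdist y (closed_segment p b)\<bar> \<le> norm (x - y)"
    using infdist_triangle_abs[of x "closed_segment p b" y] by (simp add: dist_norm)
  then have "M * \<bar>infdist x (closed_segment p b) - infdist y (closed_segment p b)\<bar> \<le> M * norm (x - y)"
    using assms by (intro mult_left_mono)
  then have 2: "\<bar>M * infdist x (closed_segment p b) - M * infdist y (closed_segment p b)\<bar> \<le> M * norm (x - y)"
    using assms by (simp add: abs_mult flip: right_diff_distrib)
  show ?thesis
    using 1 2 unfolding edge_hat_def by (simp add: distrib_right)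
qed

lemma Max_Lipschitz:
  fixes f :: "'b \<Rightarrow> real^3 \<Rightarrow> real"
  assumes "finite B" "\<And>b. b \<in> B \<Longrightarrow> \<exists>L. \<forall>x y. \<bar>f b x - f b y\<bar> \<le> L * norm (x - y)"
  shows "\<exists>L\<ge>0. \<forall>x y. \<bar>Max (insert 0 ((\<lambda>b. f b x) ` B)) - Max (insert 0 ((\<lambda>b. f b y) ` B))\<bar> \<le> L * norm (x - y)"
  using assms
proof (induction B rule: finite_induct)
  case empty
  show ?case by (intro exI[of _ 0]) simp
next
  case (insert b B)
  obtain L1 where L1: "L1 \<ge> 0"
    "\<And>x y. \<bar>Max (insert 0 ((\<lambda>b. f b x) ` B)) - Max (insert 0 ((\<lambda>b. f b y) ` B))\<bar> \<le> L1 * norm (x - y)"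
    using insert.IH insert.prems by blast
  have "\<exists>L. \<forall>x y :: real^3. \<bar>f b x - f b y\<bar> \<le> L * norm (x - y)"
    by (rule insert.prems) simp
  then obtain L2 where L2: "\<And>x y :: real^3. \<bar>f b x - f b y\<bar> \<le> L2 * norm (x - y)" by blast
  have eq: "Max (insert 0 ((\<lambda>b. f b x) ` insert b B)) = max (f b x) (Max (insert 0 ((\<lambda>b. f b x) ` B)))" for x
    using insert.hyps(1) by (subst Max_insert[symmetric]) (auto simp: insert_commute)
  show ?case
  proof (intro exI[of _ "max L1 L2"] conjI allI)
    show "0 \<le> max L1 L2" using L1(1) by simp
    fix x y :: "real^3"
    have max_le: "\<bar>max a b - max c d\<bar> \<le> e" if "\<bar>a - c\<bar> \<le> e" "\<bar>b - d\<bar> \<le> e" for a b c d e :: real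
      using that by linarith
    have "L1 * norm (x - y) \<le> max L1 L2 * norm (x - y)" "L2 * norm (x - y) \<le> max L1 L2 * norm (x - y)"
      by (intro mult_right_mono; simp)+
    then show "\<bar>Max (insert 0 ((\<lambda>b. f b x) ` insert b B)) - Max (insert 0 ((\<lambda>b. f b y) ` insert b B))\<bar>
        \<le> max L1 L2 * norm (x - y)"
      unfolding eq by (intro max_le order_trans[OF L1(2)[of x y]] order_trans[OF L2[of x y]])
  qed
qed

text \<open>There are finitely many pairs of edges, so one \<open>M\<close> keeps all hats below the
  weight on all edges at once. The maximum attains the weight through the hat of the edge itself if
  \<open>c\<close> is an end of it, and through the additional 0 otherwise.\<close>

lemma embedded_graph_vertex_function:
  fixes p :: "'i \<Rightarrow> real^3"
  assumes "embedded_graph E p"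
  obtains f :: "real^3 \<Rightarrow> real" and L where "L \<ge> 0" "\<And>x y. \<bar>f x - f y\<bar> \<le> L * norm (x - y)"
    "\<And>i j t. (i, j) \<in> E \<Longrightarrow> t \<in> {0..1} \<Longrightarrow>
      f (edge_point p i j t) = vertex_weight c i j t"
proof -
  define B where "B = {b. (c, b) \<in> E \<or> (b, c) \<in> E}"
  have fE: "finite E" using assms by (simp add: embedded_graph_def)
  have fB: "finite B"
    by (rule finite_subset[of _ "fst ` E \<union> snd ` E"]) (force simp: B_def fE)+
  have ne: "p c \<noteq> p b" if "b \<in> B" for b
    using that assms unfolding B_def embedded_graph_def by fastforce
  have neE: "p i \<noteq> p j" if "(i, j) \<in> E" for i j
    using that assms unfolding embedded_graph_def by fastforce
  have meet: "closed_segment (p c) (p b) \<inter> closed_segment (p i) (p j) \<subseteq> p ` ({c, b} \<inter> {i, j})"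
    if b: "b \<in> B" and e: "(i, j) \<in> E" and d: "{c, b} \<noteq> {i, j}" for b i j
  proof -
    have M: "edge_set p e \<inter> edge_set p (i, j) \<subseteq> p ` ({fst e, snd e} \<inter> {i, j})" if "e \<in> E" "e \<noteq> (i, j)" for e
      using assms that e unfolding embedded_graph_def by (metis fst_conv snd_conv)
    consider "(c, b) \<in> E" | "(b, c) \<in> E" using b by (auto simp: B_def)
    then show ?thesis
    proof cases
      case 1
      then show ?thesis using M[of "(c, b)"] d by (auto simp: edge_set_def)
    next
      case 2
      then have "closed_segment (p b) (p c) \<inter> closed_segment (p i) (p j) \<subseteq> p ` ({b, c} \<inter> {i, j})"
        using M[of "(b, c)"] d by (auto simp: edge_set_def)
      then show ?thesis by (simp add: insert_commute closed_segment_commute)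
    qed
  qed
  have "eventually (\<lambda>M. \<forall>b\<in>B. \<forall>e\<in>E. \<forall>t\<in>{0..1}.
      edge_hat (p c) (p b) M (edge_point p (fst e) (snd e) t)
      \<le> vertex_weight c (fst e) (snd e) t) at_top"
    by (intro eventually_ball_finite fB fE ballI edge_hat_le ne)
      (use neE meet in auto)
  from eventually_happens'[OF trivial_limit_at_top_linorder eventually_conj[OF eventually_ge_at_top[of 0] this]]
  obtain M where M: "M \<ge> 0" "\<And>b e t. b \<in> B \<Longrightarrow> e \<in> E \<Longrightarrow> t \<in> {0..1} \<Longrightarrow>
      edge_hat (p c) (p b) M (edge_point p (fst e) (snd e) t) \<le> vertex_weight c (fst e) (snd e) t"
    by (elim exE conjE) simp
  define f where "f x = Max (insert 0 ((\<lambda>b. edge_hat (p c) (p b) M x) ` B))" for x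
  have "\<exists>L\<ge>0. \<forall>x y. \<bar>f x - f y\<bar> \<le> L * norm (x - y)"
    unfolding f_def
    by (rule Max_Lipschitz[OF fB]) (intro exI allI, rule edge_hat_Lipschitz[OF M(1)])
  then obtain L where L: "L \<ge> 0" "\<And>x y. \<bar>f x - f y\<bar> \<le> L * norm (x - y)" by blast
  have fval: "f (edge_point p i j t) = vertex_weight c i j t"
    if e: "(i, j) \<in> E" and t: "t \<in> {0..1}" for i j t
    unfolding f_def
  proof (rule Max_eqI)
    define x where "x = edge_point p i j t"
    show "finite (insert 0 ((\<lambda>b. edge_hat (p c) (p b) M x) ` B))" using fB by simp
    show "y \<le> vertex_weight c i j t"
      if "y \<in> insert 0 ((\<lambda>b. edge_hat (p c) (p b) M x) ` B)" for y
      using that M(2)[OF _ e t] t by (auto simp: x_def)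
    have ij: "i \<noteq> j" using neE[OF e] by auto
    consider "c = i" | "c = j" | "c \<noteq> i" "c \<noteq> j" by blast
    then show "vertex_weight c i j t
      \<in> insert 0 ((\<lambda>b. edge_hat (p c) (p b) M x) ` B)"
    proof cases
      case 1
      have "edge_hat (p c) (p j) M x = 1 - t"
        unfolding x_def using edge_hat_self[of "p j" "p c" t M] neE[OF e] t 1 by auto
      moreover have "j \<in> B" using e 1 by (simp add: B_def)
      ultimately show ?thesis using 1 ij by (auto intro!: image_eqI[of _ _ j])
    next
      case 2
      have "edge_hat (p c) (p i) M x = t"
        unfolding x_def using edge_hat_self[of "p i" "p c" "1 - t" M] neE[OF e] t 2 by (auto simp: add.commute)
      moreover have "i \<in> B" using e 2 by (simp add: B_def)
      ultimately show ?thesis using 2 ij by (auto intro!: image_eqI[of _ _ i])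
    next
      case 3
      then show ?thesis by simp
    qed
  qed
  show thesis by (rule that[OF L fval])
qed

text \<open>The displacement is the sum of the vertex functions times the desired moves of the
  vertices. On an edge the vertex functions are barycentric coordinates, so the edge is carried
  affinely onto its new position; small moves keep the Lipschitz constant below 1.\<close>

lemma embedded_graph_perturb:
  fixes p :: "'i \<Rightarrow> real^3"
  assumes "embedded_graph E p"
  obtains e where "e > 0" "\<And>p'. (\<And>i. i \<in> fst ` E \<union> snd ` E \<Longrightarrow> norm (p' i - p i) < e) \<Longrightarrow>
    \<exists>g. isotopy_map g \<and> (\<forall>i j. \<forall>t\<in>{0..1}. (i, j) \<in> E \<longrightarrow>
      g (edge_point p i j t) = edge_point p' i j t)"
proof -
  define V where "V = fst ` E \<union> snd ` E"
  have fV: "finite V" using assms by (simp add: V_def embedded_graph_def)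
  define P where "P c f L \<longleftrightarrow> L \<ge> (0::real) \<and> (\<forall>x y. \<bar>f x - f y\<bar> \<le> L * norm (x - y)) \<and>
    (\<forall>i j. \<forall>t\<in>{0..1}. (i, j) \<in> E \<longrightarrow>
      f (edge_point p i j t) = vertex_weight c i j t)"
    for c and f :: "real^3 \<Rightarrow> real" and L
  have "\<forall>c. \<exists>f L. P c f L"
  proof
    fix c
    obtain f L where "L \<ge> 0" "\<And>x y. \<bar>f x - f y\<bar> \<le> L * norm (x - y)"
      "\<And>i j t. (i, j) \<in> E \<Longrightarrow> t \<in> {0..1} \<Longrightarrow>
        f (edge_point p i j t) = vertex_weight c i j t"
      by (rule embedded_graph_vertex_function[OF assms, of c]) (rule that)
    then have "P c f L" unfolding P_def by simp
    then show "\<exists>f L. P c f L" by (intro exI)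
  qed
  from choice[OF this] obtain f where "\<forall>c. \<exists>L. P c (f c) L" ..
  from choice[OF this] obtain L where PL: "\<forall>c. P c (f c) (L c)" ..
  have L: "L c \<ge> 0" and f: "\<bar>f c x - f c y\<bar> \<le> L c * norm (x - y)" for c x y
    using PL unfolding P_def by simp_all
  have fv: "f c (edge_point p i j t) = vertex_weight c i j t"
    if "t \<in> {0..1}" "(i, j) \<in> E" for c i j t
    using PL that unfolding P_def by simp
  define S where "S = (\<Sum>c\<in>V. L c)"
  have S: "S \<ge> 0" unfolding S_def using L by (simp add: sum_nonneg)
  \<comment> \<open>Chosen to give \<open>S * e \<le> 1 / 2\<close>; the summand 1 covers
    \<open>S = 0\<close>.\<close>
  define e where "e = 1 / (2 * (S + 1))"
  have e: "e > 0" using S by (simp add: e_def)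
  moreover have "\<exists>g. isotopy_map g \<and> (\<forall>i j. \<forall>t\<in>{0..1}. (i, j) \<in> E \<longrightarrow>
      g (edge_point p i j t) = edge_point p' i j t)"
    if p': "\<And>i. i \<in> fst ` E \<union> snd ` E \<Longrightarrow> norm (p' i - p i) < e" for p'
  proof -
    define D where "D x = (\<Sum>c\<in>V. f c x *\<^sub>R (p' c - p c))" for x
    have "norm (D x - D y) \<le> 1 / 2 * norm (x - y)" for x y
    proof -
      have "D x - D y = (\<Sum>c\<in>V. (f c x - f c y) *\<^sub>R (p' c - p c))"
        by (simp add: D_def scaleR_diff_left sum_subtractf)
      then have "norm (D x - D y) \<le> (\<Sum>c\<in>V. norm ((f c x - f c y) *\<^sub>R (p' c - p c)))"
        by (simp only: norm_sum)
      also have "\<dots> \<le> (\<Sum>c\<in>V. (L c * norm (x - y)) * e)"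
      proof (rule sum_mono)
        fix c assume "c \<in> V"
        then have "norm (p' c - p c) \<le> e" using p'[of c] by (simp add: V_def)
        then show "norm ((f c x - f c y) *\<^sub>R (p' c - p c)) \<le> L c * norm (x - y) * e"
          unfolding norm_scaleR using f L by (intro mult_mono) simp_all
      qed
      also have "\<dots> = S * e * norm (x - y)"
        by (simp add: S_def sum_distrib_right sum_distrib_left mult_ac)
      also have "\<dots> \<le> 1 / 2 * norm (x - y)"
        using S by (intro mult_right_mono) (auto simp: e_def field_simps)
      finally show ?thesis .
    qed
    then have iso: "isotopy_map (\<lambda>x. x + D x)"
      by (intro isotopy_map_Lipschitz_displacement[of "1 / 2"]) auto
    have "x + D x = edge_point p' i j t"
      if E: "(i, j) \<in> E" and t: "t \<in> {0..1}" and x: "x = edge_point p i j t" for x i j t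
    proof -
      have ij: "i \<in> V" "j \<in> V" using E by (force simp: V_def)+
      have "D x = (\<Sum>c\<in>V. (if c = i then (1 - t) *\<^sub>R (p' c - p c) else 0) + (if c = j then t *\<^sub>R (p' c - p c) else 0))"
        unfolding D_def x by (intro sum.cong refl) (simp add: fv[OF t E] scaleR_add_left)
      also have "\<dots> = (1 - t) *\<^sub>R (p' i - p i) + t *\<^sub>R (p' j - p j)"
        using fV ij by (simp add: sum.distrib)
      finally show ?thesis unfolding x by (simp add: algebra_simps)
    qed
    then show ?thesis using iso by (intro exI[of _ "\<lambda>x. x + D x"] conjI allI ballI impI) simp_all
  qed
  ultimately show thesis by (rule that)
qed

section \<open>Twists and radial graphs\<close>

definition polar :: "real^3 \<Rightarrow> real^3 \<Rightarrow> real \<Rightarrow> real^3" where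
  "polar u w a = cos a *\<^sub>R u + sin a *\<^sub>R w"

definition orthonormal_pair :: "real^3 \<Rightarrow> real^3 \<Rightarrow> bool" where
  "orthonormal_pair u w \<longleftrightarrow> norm u = 1 \<and> norm w = 1 \<and> u \<bullet> w = 0"

lemma orthonormal_pair_inner:
  assumes "orthonormal_pair u w"
  shows "u \<bullet> u = 1" "w \<bullet> w = 1" "u \<bullet> w = 0" "w \<bullet> u = 0"
  using assms by (simp_all add: orthonormal_pair_def norm_eq_1 inner_commute)

lemma polar_inner:
  assumes "orthonormal_pair u w"
  shows "polar u w a \<bullet> u = cos a" "polar u w a \<bullet> w = sin a"
  using orthonormal_pair_inner[OF assms] by (simp_all add: polar_def inner_add_left)

lemma norm_polar:
  assumes "orthonormal_pair u w"
  shows "norm (polar u w a) = 1"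
  using orthonormal_pair_inner[OF assms]
  by (simp add: norm_eq_1 polar_def inner_add_left inner_add_right flip: power2_eq_square)

lemma polar_eq_iff:
  assumes "orthonormal_pair u w" "\<bar>a - b\<bar> < 2 * pi" "polar u w a = polar u w b"
  shows "a = b"
proof -
  have "cos a = cos b" "sin a = sin b" using polar_inner[OF assms(1)] assms(3) by metis+
  then have "cos (a - b) = 1" by (simp add: cos_diff flip: power2_eq_square)
  then obtain n :: int where n: "a - b = real_of_int n * 2 * pi" unfolding cos_one_2pi_int ..
  have "\<bar>real_of_int n\<bar> * (2 * pi) < 1 * (2 * pi)" using assms(2) n by (simp add: abs_mult)
  then have "\<bar>real_of_int n\<bar> < 1" by (rule mult_right_less_imp_less) simp
  then have "n = 0" by linarith
  then show ?thesis using n by simp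
qed

text \<open>For orthonormal \<open>u\<close> and \<open>w\<close> this is the rotation by
  \<open>a\<close> in their plane that fixes the orthogonal complement: Rodrigues' formula without
  the axis.\<close>

definition rotate_in :: "real^3 \<Rightarrow> real^3 \<Rightarrow> real \<Rightarrow> real^3 \<Rightarrow> real^3" where
  "rotate_in u w a x = x + (cos a - 1) *\<^sub>R ((x \<bullet> u) *\<^sub>R u + (x \<bullet> w) *\<^sub>R w)
     + sin a *\<^sub>R ((x \<bullet> u) *\<^sub>R w - (x \<bullet> w) *\<^sub>R u)"

lemma rotate_in_inner:
  assumes "orthonormal_pair u w"
  shows "rotate_in u w a x \<bullet> u = cos a * (x \<bullet> u) - sin a * (x \<bullet> w)"
    and "rotate_in u w a x \<bullet> w = sin a * (x \<bullet> u) + cos a * (x \<bullet> w)"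
  using orthonormal_pair_inner[OF assms]
  by (simp_all add: rotate_in_def inner_add_left inner_diff_left algebra_simps)

lemma rotate_in_planar_norm:
  assumes "orthonormal_pair u w"
  shows "(rotate_in u w a x \<bullet> u)\<^sup>2 + (rotate_in u w a x \<bullet> w)\<^sup>2 = (x \<bullet> u)\<^sup>2 + (x \<bullet> w)\<^sup>2"
proof -
  have "(cos a * p - sin a * q)\<^sup>2 + (sin a * p + cos a * q)\<^sup>2 = ((sin a)\<^sup>2 + (cos a)\<^sup>2) * (p\<^sup>2 + q\<^sup>2)" for p q
    by algebra
  then show ?thesis unfolding rotate_in_inner[OF assms] by simp
qed

lemma norm_rotate_in:
  assumes "orthonormal_pair u w"
  shows "norm (rotate_in u w a x) = norm x"
proof -
  define p where "p = x \<bullet> u"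
  define q where "q = x \<bullet> w"
  \<comment> \<open>\<open>y\<close> is the projection of \<open>x\<close> to the plane, and
    \<open>z\<close> below is \<open>y\<close> after a quarter turn.\<close>
  define y where "y = p *\<^sub>R u + q *\<^sub>R w"
  define z where "z = p *\<^sub>R w - q *\<^sub>R u"
  note uw = orthonormal_pair_inner[OF assms]
  have y: "x \<bullet> y = p\<^sup>2 + q\<^sup>2" "y \<bullet> y = p\<^sup>2 + q\<^sup>2" "x \<bullet> z = 0" "y \<bullet> z = 0" "z \<bullet> z = p\<^sup>2 + q\<^sup>2"
    using uw by (simp_all add: y_def z_def inner_add_right inner_add_left inner_diff_left inner_diff_right
        p_def q_def power2_eq_square)
  have r: "rotate_in u w a x = x + (cos a - 1) *\<^sub>R y + sin a *\<^sub>R z"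
    by (simp add: rotate_in_def y_def z_def p_def q_def)
  have "rotate_in u w a x \<bullet> rotate_in u w a x
    = x \<bullet> x + 2 * (cos a - 1) * (x \<bullet> y) + 2 * sin a * (x \<bullet> z) + (cos a - 1)\<^sup>2 * (y \<bullet> y)
      + 2 * (cos a - 1) * sin a * (y \<bullet> z) + (sin a)\<^sup>2 * (z \<bullet> z)"
    unfolding r by (simp add: inner_add_left inner_add_right inner_commute[of y x] inner_commute[of z x]
        inner_commute[of z y] power2_eq_square algebra_simps)
  also have "\<dots> = x \<bullet> x + (p\<^sup>2 + q\<^sup>2) * ((sin a)\<^sup>2 + (cos a)\<^sup>2 - 1)"
    unfolding y by algebra
  finally show ?thesis by (simp add: norm_eq)
qed

lemma rotate_in_neg:
  assumes "orthonormal_pair u w"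
  shows "rotate_in u w (- a) (rotate_in u w a x) = x"
proof -
  define p where "p = x \<bullet> u"
  define q where "q = x \<bullet> w"
  define c where "c = cos a"
  define s where "s = sin a"
  have cs: "s\<^sup>2 + c\<^sup>2 = 1" by (simp add: s_def c_def)
  have "rotate_in u w (- a) (rotate_in u w a x) = x + (c - 1) *\<^sub>R (p *\<^sub>R u + q *\<^sub>R w) + s *\<^sub>R (p *\<^sub>R w - q *\<^sub>R u)
     + (c - 1) *\<^sub>R ((c * p - s * q) *\<^sub>R u + (s * p + c * q) *\<^sub>R w)
     - s *\<^sub>R ((c * p - s * q) *\<^sub>R w - (s * p + c * q) *\<^sub>R u)"
    unfolding rotate_in_def[of u w "- a"] rotate_in_inner[OF assms]
    by (simp add: rotate_in_def p_def q_def c_def s_def)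
  also have "\<dots> = x + ((c - 1) * p - s * q + (c - 1) * (c * p - s * q) + s * (s * p + c * q)) *\<^sub>R u
     + ((c - 1) * q + s * p + (c - 1) * (s * p + c * q) - s * (c * p - s * q)) *\<^sub>R w"
    by (simp add: algebra_simps)
  also have "(c - 1) * p - s * q + (c - 1) * (c * p - s * q) + s * (s * p + c * q) = 0"
    using cs by algebra
  also have "(c - 1) * q + s * p + (c - 1) * (s * p + c * q) - s * (c * p - s * q) = 0"
    using cs by algebra
  finally show ?thesis by simp
qed

lemma rotate_in_polar:
  assumes "orthonormal_pair u w"
  shows "rotate_in u w a (r *\<^sub>R polar u w b) = r *\<^sub>R polar u w (b + a)"
proof -
  have "rotate_in u w a (r *\<^sub>R polar u w b) = r *\<^sub>R polar u w b + (cos a - 1) *\<^sub>R (r *\<^sub>R polar u w b)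
     + sin a *\<^sub>R ((r * cos b) *\<^sub>R w - (r * sin b) *\<^sub>R u)"
    unfolding rotate_in_def by (simp add: polar_inner[OF assms]) (simp add: polar_def algebra_simps)
  then show ?thesis
    by (simp add: polar_def cos_add sin_add algebra_simps)
qed

lemma rotate_in_0 [simp]: "rotate_in u w 0 x = x"
  by (simp add: rotate_in_def)

abbreviation clamp :: "real \<Rightarrow> real" where
  "clamp t \<equiv> max 0 (min 1 t)"

text \<open>The angle of rotation is \<open>b\<close> times two cutoffs. The radial one is 1 inside
  radius \<open>rho\<close> and 0 outside \<open>R\<close>. The other, \<open>chi\<close>, is 1 on
  the plane of \<open>u\<close> and \<open>w\<close> and 0 where the planar part makes up at most
  the share \<open>s\<close> of the squared norm, so that curves steep to the plane stay
  fixed.\<close>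

lemma twist_isotopy_map:
  fixes u w :: "real^3"
  assumes uw: "orthonormal_pair u w" and s: "s < 1" and R: "rho < R"
  obtains T where "isotopy_map T" "\<And>x. R \<le> norm x \<Longrightarrow> T x = x"
    "\<And>x. (x \<bullet> u)\<^sup>2 + (x \<bullet> w)\<^sup>2 \<le> s * (norm x)\<^sup>2 \<Longrightarrow> T x = x"
    "\<And>r a. 0 \<le> r \<Longrightarrow> T (r *\<^sub>R polar u w a) =
       r *\<^sub>R polar u w (a + b * clamp ((R - r) / (R - rho)))"
proof -
  define chi where "chi x = max 0 ((((x \<bullet> u)\<^sup>2 + (x \<bullet> w)\<^sup>2) / (norm x)\<^sup>2 - s) / (1 - s))" for x
  define f where "f x = b * clamp ((R - norm x) / (R - rho)) * chi x" for x
  define H where "H p = rotate_in u w (fst p * f (snd p)) (snd p)" for p :: "real \<times> (real^3)"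
  \<comment> \<open>The rotation preserves the norm and the planar part of it, hence its own angle;
    turning back by the same angle is therefore an inverse.\<close>
  have f_rot: "f (rotate_in u w a x) = f x" for a x
    unfolding f_def chi_def by (simp only: norm_rotate_in[OF uw] rotate_in_planar_norm[OF uw])
  have norm_H: "norm (H p) = norm (snd p)" for p
    unfolding H_def by (rule norm_rotate_in[OF uw])
  have bij: "bij (\<lambda>x. H (t, x))" for t
  proof (rule bij_betw_byWitness[of _ "\<lambda>x. H (- t, x)"])
    show "\<forall>x\<in>UNIV. H (- t, H (t, x)) = x"
      using rotate_in_neg[OF uw] by (simp add: H_def f_rot)
    have "H (t, H (- t, x)) = x" for x
      using rotate_in_neg[OF uw, of "- (t * f x)" x] by (simp add: H_def f_rot)
    then show "\<forall>x\<in>UNIV. H (t, H (- t, x)) = x" by blast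
  qed auto
  have contH: "continuous_on (UNIV \<times> - {0}) H"
    unfolding H_def f_def chi_def rotate_in_def by (intro continuous_intros) (use s R in auto)
  have "continuous (at p within {0..1} \<times> UNIV) H" for p
  proof (cases "snd p = 0")
    \<comment> \<open>The angle need not be continuous at 0, but rotations preserve the norm, so the
      images tend to 0 anyway.\<close>
    case True
    have "((\<lambda>p::real \<times> (real^3). norm (snd p)) \<longlongrightarrow> norm (snd p)) (at p within {0..1} \<times> UNIV)"
      by (intro tendsto_intros)
    then have "((\<lambda>p. norm (H p)) \<longlongrightarrow> 0) (at p within {0..1} \<times> UNIV)"
      by (simp add: norm_H True)
    then have "(H \<longlongrightarrow> 0) (at p within {0..1} \<times> UNIV)" by (rule tendsto_norm_zero_cancel)
    moreover have "H p = 0" using norm_H[of p] True by simp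
    ultimately show ?thesis by (simp add: continuous_within)
  next
    case False
    have "open (UNIV \<times> - {0} :: (real \<times> (real^3)) set)" by (intro open_Times) auto
    moreover have "p \<in> UNIV \<times> - {0}" using False by (cases p) auto
    ultimately have "continuous (at p) H"
      using contH continuous_on_eq_continuous_at by blast
    then show ?thesis by (rule continuous_at_imp_continuous_at_within)
  qed
  then have cont: "continuous_on ({0..1} \<times> UNIV) H"
    using continuous_on_eq_continuous_within by blast
  define T where "T x = H (1, x)" for x
  have iso: "isotopy_map T"
    by (rule isotopy_mapI[OF cont _ bij]) (simp_all add: T_def H_def)
  have T: "T x = rotate_in u w (f x) x" for x by (simp add: T_def H_def)
  have outer: "T x = x" if "R \<le> norm x" for x
  proof -
    have "clamp ((R - norm x) / (R - rho)) = 0"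
    proof -
      have "(R - norm x) / (R - rho) \<le> 0" using that R by (simp add: divide_le_0_iff)
      then show ?thesis by linarith
    qed
    then show ?thesis by (simp add: T f_def)
  qed
  have steep: "T x = x" if "(x \<bullet> u)\<^sup>2 + (x \<bullet> w)\<^sup>2 \<le> s * (norm x)\<^sup>2" for x
  proof (cases "x = 0")
    case True
    then show ?thesis by (simp add: T rotate_in_def)
  next
    case False
    then have "((x \<bullet> u)\<^sup>2 + (x \<bullet> w)\<^sup>2) / (norm x)\<^sup>2 \<le> s"
      using that by (simp add: divide_le_eq)
    then have "(((x \<bullet> u)\<^sup>2 + (x \<bullet> w)\<^sup>2) / (norm x)\<^sup>2 - s) / (1 - s) \<le> 0"
      using s by (simp add: divide_le_0_iff)
    then have "chi x = 0" unfolding chi_def by linarith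
    then show ?thesis by (simp add: T f_def)
  qed
  have planar: "T (r *\<^sub>R polar u w a) = r *\<^sub>R polar u w (a + b * clamp ((R - r) / (R - rho)))"
    if r: "0 \<le> r" for r a
  proof (cases "r = 0")
    case True
    then show ?thesis by (simp add: T rotate_in_def)
  next
    case False
    have "chi (r *\<^sub>R polar u w a) = 1"
      using False s unfolding chi_def
      by (simp add: norm_polar[OF uw] polar_inner[OF uw] power_mult_distrib flip: distrib_left)
    then have "f (r *\<^sub>R polar u w a) = b * clamp ((R - r) / (R - rho))"
      using r by (simp add: f_def norm_polar[OF uw])
    then show ?thesis by (simp add: T rotate_in_polar[OF uw])
  qed
  show thesis by (rule that[OF iso outer steep planar])
qed

text \<open>Moves the origin to \<open>d\<close> and fixes everything outside radius
  \<open>rho\<close>; the cone shaped cutoff makes \<open>norm d / rho\<close> a Lipschitz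
  constant.\<close>

lemma hat_isotopy_map:
  fixes d :: "real^3"
  assumes "0 < rho" "norm d < rho"
  shows "isotopy_map (\<lambda>x. x + max 0 (1 - norm x / rho) *\<^sub>R d)"
proof (rule isotopy_map_Lipschitz_displacement[of "norm d / rho"])
  show "norm d / rho < 1" using assms by simp
  fix x y :: "real^3"
  have "\<bar>max 0 (1 - norm x / rho) - max 0 (1 - norm y / rho)\<bar> \<le> \<bar>norm x / rho - norm y / rho\<bar>"
    by linarith
  also have "\<dots> = \<bar>norm x - norm y\<bar> / rho" using assms(1) by (simp flip: diff_divide_distrib)
  also have "\<dots> \<le> norm (x - y) / rho"
    using assms(1) norm_triangle_ineq3 by (intro divide_right_mono) auto
  finally have "\<bar>max 0 (1 - norm x / rho) - max 0 (1 - norm y / rho)\<bar> * norm d \<le> norm (x - y) / rho * norm d"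
    by (rule mult_right_mono) simp
  then show "norm (max 0 (1 - norm x / rho) *\<^sub>R d - max 0 (1 - norm y / rho) *\<^sub>R d) \<le> norm d / rho * norm (x - y)"
    by (simp add: mult.commute flip: scaleR_diff_left)
qed

section \<open>Radial graphs over great circle arcs\<close>

definition radial_graph ::
  "real^3 \<Rightarrow> real^3 \<Rightarrow> real \<Rightarrow> real \<Rightarrow> (real^3) set \<Rightarrow> real^3 \<Rightarrow> real^3 \<Rightarrow> bool" where
  "radial_graph u w a b S p q \<longleftrightarrow> (\<exists>r. continuous_on {a..b} r \<and> (\<forall>t\<in>{a..b}. 0 < r t) \<and>
     S = (\<lambda>t. r t *\<^sub>R polar u w t) ` {a..b} \<and> r a *\<^sub>R polar u w a = p \<and> r b *\<^sub>R polar u w b = q)"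

text \<open>The common end point \<open>q\<close> forces the two radii to agree at angle
  \<open>b\<close>, so the radius functions glue continuously.\<close>

lemma radial_graph_union:
  assumes "radial_graph u w a b S p q" "radial_graph u w b c T q q'" "a \<le> b" "b \<le> c"
    and uw: "orthonormal_pair u w"
  shows "radial_graph u w a c (S \<union> T) p q'"
proof -
  obtain r1 where r1: "continuous_on {a..b} r1" "\<And>t. t \<in> {a..b} \<Longrightarrow> 0 < r1 t"
     "S = (\<lambda>t. r1 t *\<^sub>R polar u w t) ` {a..b}" "r1 a *\<^sub>R polar u w a = p" "r1 b *\<^sub>R polar u w b = q"
    using assms(1) unfolding radial_graph_def by auto
  obtain r2 where r2: "continuous_on {b..c} r2" "\<And>t. t \<in> {b..c} \<Longrightarrow> 0 < r2 t"
     "T = (\<lambda>t. r2 t *\<^sub>R polar u w t) ` {b..c}" "r2 b *\<^sub>R polar u w b = q" "r2 c *\<^sub>R polar u w c = q'"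
    using assms(2) unfolding radial_graph_def by auto
  have "polar u w b \<noteq> 0" using norm_polar[OF uw, of b] by auto
  then have eq: "r1 b = r2 b" using r1(5) r2(4) by (metis scaleR_cancel_right)
  define r where "r t = (if t \<le> b then r1 t else r2 t)" for t
  have ac: "{a..c} = {a..b} \<union> {b..c}" using assms(3,4) by auto
  have rS: "r t = r1 t" if "t \<in> {a..b}" for t using that by (simp add: r_def)
  have rT: "r t = r2 t" if "t \<in> {b..c}" for t using that eq by (auto simp: r_def)
  have "continuous_on {a..b} r" using r1(1) by (rule continuous_on_eq) (simp add: rS)
  moreover have "continuous_on {b..c} r" using r2(1) by (rule continuous_on_eq) (simp add: rT)
  ultimately have "continuous_on {a..c} r"
    unfolding ac by (intro continuous_on_closed_Un) auto
  moreover have "\<forall>t\<in>{a..c}. 0 < r t" using r1(2) r2(2) by (auto simp: r_def)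
  moreover have "S \<union> T = (\<lambda>t. r t *\<^sub>R polar u w t) ` {a..c}"
    unfolding ac image_Un r1(3) r2(3) using rS rT by (intro arg_cong2[of _ _ _ _ "(\<union>)"] image_cong) auto
  moreover have "r a *\<^sub>R polar u w a = p" "r c *\<^sub>R polar u w c = q'"
    using r1(4) r2(5) rS[of a] rT[of c] assms(3,4) by auto
  ultimately show ?thesis unfolding radial_graph_def by blast
qed

text \<open>\<open>r\<close> is the equation of the line through the two points in polar
  coordinates, and \<open>l\<close> is the position on the segment at angle \<open>t\<close>. The
  denominator \<open>D\<close> is positive because the angle between the ends is less than
  \<open>pi\<close>; that the whole segment is covered follows from the intermediate value theorem
  for \<open>l\<close>.\<close>

lemma radial_graph_segment:
  assumes ab: "a < b" "b < a + pi" and AB: "0 < A" "0 < B"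
  shows "radial_graph u w a b (closed_segment (A *\<^sub>R polar u w a) (B *\<^sub>R polar u w b))
    (A *\<^sub>R polar u w a) (B *\<^sub>R polar u w b)"
proof -
  define D where "D t = A * sin (t - a) + B * sin (b - t)" for t
  define r where "r t = A * B * sin (b - a) / D t" for t
  define l where "l t = A * sin (t - a) / D t" for t
  have sab: "sin (b - a) > 0" using ab by (intro sin_gt_zero) auto
  have D: "D t > 0" if "t \<in> {a..b}" for t
  proof -
    have "sin (t - a) \<ge> 0" "sin (b - t) \<ge> 0" using that ab by (auto intro!: sin_ge_zero)
    moreover have "sin (t - a) > 0 \<or> sin (b - t) > 0"
      using that ab by (cases "t = a") (auto intro!: sin_gt_zero)
    ultimately show ?thesis unfolding D_def using AB
      by (auto intro: add_pos_nonneg add_nonneg_pos)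
  qed
  have contD: "continuous_on {a..b} D" unfolding D_def by (intro continuous_intros)
  have Dne: "\<forall>t\<in>{a..b}. D t \<noteq> 0" using D by force
  have contr: "continuous_on {a..b} r"
    unfolding r_def by (intro continuous_intros contD Dne)
  have contl: "continuous_on {a..b} l"
    unfolding l_def by (intro continuous_intros contD Dne)
  \<comment> \<open>Cramer's rule in the plane: the direction at \<open>t\<close> in terms of the
    directions at \<open>a\<close> and \<open>b\<close>.\<close>
  have pol: "sin (b - a) *\<^sub>R polar u w t = sin (b - t) *\<^sub>R polar u w a + sin (t - a) *\<^sub>R polar u w b" for t
  proof -
    have "sin (b - a) * cos t = sin (b - t) * cos a + sin (t - a) * cos b"
      "sin (b - a) * sin t = sin (b - t) * sin a + sin (t - a) * sin b"
      using sin_cos_squared_add[of t] by (simp_all add: sin_diff algebra_simps)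
    then show ?thesis unfolding polar_def by (simp add: scaleR_add_right algebra_simps flip: scaleR_add_left)
  qed
  have key: "r t *\<^sub>R polar u w t = (1 - l t) *\<^sub>R (A *\<^sub>R polar u w a) + l t *\<^sub>R (B *\<^sub>R polar u w b)"
    if t: "t \<in> {a..b}" for t
  proof -
    have 1: "1 - l t = B * sin (b - t) / D t"
      using D[OF t] by (simp add: l_def D_def field_simps)
    have "r t *\<^sub>R polar u w t = (A * B / D t) *\<^sub>R (sin (b - a) *\<^sub>R polar u w t)" by (simp add: r_def)
    also have "\<dots> = (1 - l t) *\<^sub>R (A *\<^sub>R polar u w a) + l t *\<^sub>R (B *\<^sub>R polar u w b)"
      unfolding pol 1 by (simp add: l_def scaleR_add_right mult_ac)
    finally show ?thesis .
  qed
  have la: "l a = 0" by (simp add: l_def)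
  have lb: "l b = 1" using AB sab by (simp add: l_def D_def)
  have l01: "0 \<le> l t \<and> l t \<le> 1" if t: "t \<in> {a..b}" for t
  proof -
    have "sin (t - a) \<ge> 0" "sin (b - t) \<ge> 0" using that ab by (auto intro!: sin_ge_zero)
    then show ?thesis using D[OF t] AB by (simp add: l_def D_def)
  qed
  have "closed_segment (A *\<^sub>R polar u w a) (B *\<^sub>R polar u w b) = (\<lambda>t. r t *\<^sub>R polar u w t) ` {a..b}"
  proof (intro equalityI subsetI)
    fix x assume "x \<in> closed_segment (A *\<^sub>R polar u w a) (B *\<^sub>R polar u w b)"
    then obtain y where y: "0 \<le> y" "y \<le> 1" "x = (1 - y) *\<^sub>R (A *\<^sub>R polar u w a) + y *\<^sub>R (B *\<^sub>R polar u w b)"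
      by (rule closed_segmentE)
    obtain t where t: "a \<le> t" "t \<le> b" "l t = y"
      using IVT'[of l a y b] y la lb contl ab by auto
    then have "x = r t *\<^sub>R polar u w t" using key[of t] y(3) by simp
    then show "x \<in> (\<lambda>t. r t *\<^sub>R polar u w t) ` {a..b}"
      using t by (intro image_eqI[of _ _ t]) simp_all
  next
    fix x assume "x \<in> (\<lambda>t. r t *\<^sub>R polar u w t) ` {a..b}"
    then obtain t where t: "t \<in> {a..b}" "x = r t *\<^sub>R polar u w t" by blast
    show "x \<in> closed_segment (A *\<^sub>R polar u w a) (B *\<^sub>R polar u w b)"
      unfolding t(2) key[OF t(1)] in_segment using l01[OF t(1)] by blast
  qed
  moreover have "\<forall>t\<in>{a..b}. 0 < r t" using D sab AB by (simp add: r_def)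
  moreover have "r a *\<^sub>R polar u w a = A *\<^sub>R polar u w a" "r b *\<^sub>R polar u w b = B *\<^sub>R polar u w b"
    using key[of a] key[of b] ab la lb by simp_all
  ultimately show ?thesis using contr unfolding radial_graph_def by blast
qed

text \<open>The new frame consists of the old end direction and the unit tangent there, pointing
  backwards.\<close>

lemma radial_graph_reverse:
  assumes "radial_graph u w 0 b S p q"
  shows "radial_graph (polar u w b) (sin b *\<^sub>R u - cos b *\<^sub>R w) 0 b S q p"
proof -
  obtain r where r: "continuous_on {0..b} r" "\<And>t. t \<in> {0..b} \<Longrightarrow> 0 < r t"
     "S = (\<lambda>t. r t *\<^sub>R polar u w t) ` {0..b}" "r 0 *\<^sub>R polar u w 0 = p" "r b *\<^sub>R polar u w b = q"
    using assms unfolding radial_graph_def by auto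
  have pol: "polar (polar u w b) (sin b *\<^sub>R u - cos b *\<^sub>R w) t = polar u w (b - t)" for t
    by (simp add: polar_def cos_diff sin_diff algebra_simps)
  have refl: "(\<lambda>t. b - t) ` {0..b} = {0..b}" by simp
  have "continuous_on {0..b} (\<lambda>t. r (b - t))"
    by (rule continuous_on_compose2[OF r(1)]) (auto intro!: continuous_intros)
  moreover have "S = (\<lambda>t. r (b - t) *\<^sub>R polar u w (b - t)) ` {0..b}"
    unfolding r(3) by (subst refl[symmetric]) (simp only: image_image)
  ultimately show ?thesis
    unfolding radial_graph_def pol using r(2,4,5) by (intro exI[of _ "\<lambda>t. r (b - t)"]) auto
qed

lemma orthonormal_pair_reverse:
  assumes "orthonormal_pair u w"
  shows "orthonormal_pair (polar u w b) (sin b *\<^sub>R u - cos b *\<^sub>R w)"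
  using orthonormal_pair_inner[OF assms]
  by (simp add: orthonormal_pair_def norm_eq_1 polar_def inner_add_left inner_add_right inner_diff_left
      inner_diff_right flip: power2_eq_square)

text \<open>Cramer's rule. It serves to show that a vector orthogonal to three independent vectors
  is 0.\<close>

lemma cross3_cramer:
  "(cross3 a b \<bullet> c) *\<^sub>R x = (x \<bullet> a) *\<^sub>R cross3 b c + (x \<bullet> b) *\<^sub>R cross3 c a + (x \<bullet> c) *\<^sub>R cross3 a b"
  by (simp add: vec_eq_iff forall_3 inner_vec_def sum_3 cross_components) (simp add: algebra_simps)

lemma polar_coordinates:
  fixes u w x n :: "real^3"
  assumes uw: "orthonormal_pair u w" and n: "n \<bullet> u = 0" "n \<bullet> w = 0" "n \<noteq> 0" and x: "x \<noteq> 0" "x \<bullet> n = 0"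
  obtains a where "0 \<le> a" "a < 2 * pi" "x = norm x *\<^sub>R polar u w a"
proof -
  \<comment> \<open>\<open>y\<close> is the part of \<open>x\<close> normal to \<open>u\<close> and
    \<open>w\<close>. It is also orthogonal to \<open>n\<close>, and \<open>u\<close>,
    \<open>w\<close>, \<open>n\<close> are independent, so it vanishes.\<close>
  define y where "y = x - (x \<bullet> u) *\<^sub>R u - (x \<bullet> w) *\<^sub>R w"
  note i = orthonormal_pair_inner[OF uw]
  have "u \<bullet> n = 0" "w \<bullet> n = 0" using n by (simp_all add: inner_commute)
  then have yu: "y \<bullet> u = 0" "y \<bullet> w = 0" "y \<bullet> n = 0"
    using i n x(2) by (simp_all add: y_def inner_diff_left)
  define m where "m = cross3 u w"
  have "(norm m)\<^sup>2 = 1"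
    unfolding m_def norm_cross using uw by (simp add: orthonormal_pair_def)
  then have "m \<noteq> 0" by auto
  have "cross3 n m = 0" unfolding m_def Lagrange using n by simp
  then have "m \<bullet> n \<noteq> 0"
    using norm_and_cross_eq_0[of n m] \<open>m \<noteq> 0\<close> n(3) by (auto simp: inner_commute)
  moreover have "(m \<bullet> n) *\<^sub>R y = 0"
    unfolding m_def cross3_cramer[of u w n y] using yu by simp
  ultimately have "y = 0" by simp
  then have dec: "x = (x \<bullet> u) *\<^sub>R u + (x \<bullet> w) *\<^sub>R w" by (simp add: y_def algebra_simps)
  have "x \<bullet> x = (x \<bullet> u)\<^sup>2 + (x \<bullet> w)\<^sup>2"
    by (subst dec) (simp add: inner_add_right power2_eq_square)
  then have "(norm x)\<^sup>2 = (x \<bullet> u)\<^sup>2 + (x \<bullet> w)\<^sup>2" by (simp add: power2_norm_eq_inner)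
  moreover have "(norm x)\<^sup>2 \<noteq> 0" using x(1) by simp
  ultimately have "((x \<bullet> u) / norm x)\<^sup>2 + ((x \<bullet> w) / norm x)\<^sup>2 = 1"
    unfolding power_divide by (metis add_divide_distrib divide_self)
  then obtain a where a: "0 \<le> a" "a < 2 * pi" "(x \<bullet> u) / norm x = cos a" "(x \<bullet> w) / norm x = sin a"
    by (rule sincos_total_2pi)
  have "x \<bullet> u = norm x * cos a" "x \<bullet> w = norm x * sin a"
    using a(3,4) x(1) by (simp_all add: field_simps)
  then have "x = norm x *\<^sub>R polar u w a" by (subst dec) (simp add: polar_def scaleR_add_right)
  then show thesis using that a(1,2) by blast
qed

section \<open>Spherical diagrams from normal vectors and radial graphs\<close>

lemma cross3_parallel:
  assumes "cross3 x c = 0" "cross3 y c = 0" "c \<noteq> 0"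
  shows "cross3 x y = 0"
proof -
  have *: "(c \<bullet> c) *\<^sub>R z = (c \<bullet> z) *\<^sub>R c" if "cross3 z c = 0" for z
  proof -
    have "cross3 c (cross3 z c) = (c \<bullet> c) *\<^sub>R z - (c \<bullet> z) *\<^sub>R c" by (rule Lagrange)
    then show ?thesis using that by simp
  qed
  have "cross3 ((c \<bullet> c) *\<^sub>R x) ((c \<bullet> c) *\<^sub>R y) = 0"
    unfolding *[OF assms(1)] *[OF assms(2)] by (simp add: cross_mult_left cross_mult_right)
  then show ?thesis using assms(3) by (simp add: cross_mult_left cross_mult_right)
qed

lemma cross3_of_perp:
  assumes "x \<bullet> u = 0" "x \<bullet> w = 0"
  shows "cross3 x (cross3 u w) = 0"
  unfolding Lagrange using assms by simp

lemma polar_zero [simp]: "polar u w 0 = u"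
  by (simp add: polar_def)

lemma sph_arc_eq_polar: "sph_arc u w th t = polar u w (t * th)"
  by (simp add: sph_arc_def polar_def)

lemma sph_curve_eq:
  assumes "i < m" "real m * s - real i \<in> {0..<1}"
  shows "sph_curve m u w th s = polar (u i) (w i) ((real m * s - real i) * th i)"
    and "sph_idx m s = i"
proof -
  have f: "\<lfloor>real m * s\<rfloor> = int i" using assms(2) by (intro floor_unique) auto
  show "sph_curve m u w th s = polar (u i) (w i) ((real m * s - real i) * th i)"
    using assms(1) by (simp add: sph_curve_def Let_def f sph_arc_eq_polar)
  show "sph_idx m s = i" using assms(1) by (simp add: sph_idx_def f)
qed

lemma sph_parameter:
  assumes "0 < m" "s \<in> {0..<1}"
  obtains i where "i < m" "real m * s - real i \<in> {0..<1}"
proof -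
  have "0 \<le> real m * s" "real m * s < real m" using assms by auto
  then have "nat \<lfloor>real m * s\<rfloor> < m" "real m * s - real (nat \<lfloor>real m * s\<rfloor>) \<in> {0..<1}"
    by (auto simp: nat_less_iff floor_less_iff of_nat_nat) linarith+
  then show thesis using that by blast
qed

text \<open>The vectors \<open>N i\<close> are normals of the great circles, of any length and sign.
  They turn the conditions on crossings into determinants: two independent normals give
  transversality, three exclude triple points, and \<open>vertex\<close> keeps corners off the other
  arcs. A single arc is injective because it is shorter than \<open>2 * pi\<close>.\<close>

lemma sph_stick_curveI:
  fixes u w N :: "nat \<Rightarrow> real^3"
  assumes m: "0 < m"
    and uw: "\<And>i. i < m \<Longrightarrow> orthonormal_pair (u i) (w i)"
    and th: "\<And>i. i < m \<Longrightarrow> 0 < th i \<and> th i < 2 * pi"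
    and close: "\<And>i. i < m \<Longrightarrow> polar (u i) (w i) (th i) = u (Suc i mod m)"
    and N: "\<And>i. i < m \<Longrightarrow> N i \<bullet> u i = 0" "\<And>i. i < m \<Longrightarrow> N i \<bullet> w i = 0"
    and vertex: "\<And>i k. i < m \<Longrightarrow> k < m \<Longrightarrow> N i \<bullet> u k = 0 \<Longrightarrow> k = i \<or> k = Suc i mod m"
    and pairs: "\<And>i j. i < m \<Longrightarrow> j < m \<Longrightarrow> i \<noteq> j \<Longrightarrow> cross3 (N i) (N j) \<noteq> 0"
    and triples: "\<And>i j k. i < m \<Longrightarrow> j < m \<Longrightarrow> k < m \<Longrightarrow> i \<noteq> j \<Longrightarrow> i \<noteq> k \<Longrightarrow> j \<noteq> k \<Longrightarrow>
      cross3 (N i) (N j) \<bullet> N k \<noteq> 0"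
  shows "sph_stick_curve m u w th"
proof -
  have perp: "polar (u i) (w i) a \<bullet> N i = 0" if "i < m" for i a
    using N[OF that] by (simp add: polar_def inner_add_right inner_commute[of _ "N i"])
  have same_arc: "t1 = t2"
    if "i < m" "t1 \<in> {0..1}" "t2 \<in> {0..1}" "polar (u i) (w i) (t1 * th i) = polar (u i) (w i) (t2 * th i)" for i t1 t2
  proof -
    have "\<bar>t1 * th i - t2 * th i\<bar> = \<bar>t1 - t2\<bar> * th i"
      using th[OF that(1)] by (simp add: abs_mult flip: left_diff_distrib)
    also have "\<dots> \<le> 1 * th i" using that(2,3) th[OF that(1)] by (intro mult_right_mono) auto
    finally have "\<bar>t1 * th i - t2 * th i\<bar> < 2 * pi" using th[OF that(1)] by simp
    then have "t1 * th i = t2 * th i" using polar_eq_iff[OF uw[OF that(1)]] that(4) by blast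
    then show ?thesis using th[OF that(1)] by simp
  qed
  define C where "C = sph_curve m u w th"
  have indices: "sph_idx m s1 \<noteq> sph_idx m s2"
    if s: "s1 \<in> {0..<1}" "s2 \<in> {0..<1}" "s1 \<noteq> s2" "C s1 = C s2" for s1 s2
  proof
    assume eq: "sph_idx m s1 = sph_idx m s2"
    obtain i where i: "i < m" "real m * s1 - real i \<in> {0..<1}" using sph_parameter[OF m s(1)] .
    obtain j where j: "j < m" "real m * s2 - real j \<in> {0..<1}" using sph_parameter[OF m s(2)] .
    have ij: "i = j" using eq sph_curve_eq(2)[OF i] sph_curve_eq(2)[OF j] by simp
    have "real m * s1 - real i = real m * s2 - real j"
      using same_arc[of i "real m * s1 - real i" "real m * s2 - real j"] i j s(4) ij
      by (simp add: C_def sph_curve_eq(1)[OF i] sph_curve_eq(1)[OF j])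
    then show False using ij s(3) m by simp
  qed
  have interior: "real m * s1 \<notin> \<int>"
    if s: "s1 \<in> {0..<1}" "s2 \<in> {0..<1}" "s1 \<noteq> s2" "C s1 = C s2" for s1 s2
  proof
    assume "real m * s1 \<in> \<int>"
    obtain i where i: "i < m" "real m * s1 - real i \<in> {0..<1}" using sph_parameter[OF m s(1)] .
    obtain j where j: "j < m" "real m * s2 - real j \<in> {0..<1}" using sph_parameter[OF m s(2)] .
    have ij: "i \<noteq> j" using indices[OF s] sph_curve_eq(2)[OF i] sph_curve_eq(2)[OF j] by simp
    \<comment> \<open>An integer in the interval from 0 to 1 without its right end is 0, so
      \<open>s1\<close> is the parameter of the corner \<open>u i\<close>.\<close>
    have "real m * s1 - real i = 0"
    proof -
      have "real m * s1 - real i \<in> \<int>" using \<open>real m * s1 \<in> \<int>\<close> by (intro Ints_diff) auto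
      then obtain z :: int where "real m * s1 - real i = real_of_int z" by (rule Ints_cases)
      then show ?thesis using i(2) by simp
    qed
    then have ui: "C s1 = u i" by (simp add: C_def sph_curve_eq(1)[OF i] polar_def)
    have Cj: "C s2 = polar (u j) (w j) ((real m * s2 - real j) * th j)"
      by (simp add: C_def sph_curve_eq(1)[OF j])
    have "N j \<bullet> u i = 0" using perp[OF j(1)] ui Cj s(4) by (metis inner_commute)
    \<comment> \<open>The corner lies on the circle of arc \<open>j\<close>, so it is an end of this
      arc, and by \<open>i \<noteq> j\<close> its final one. Arc \<open>j\<close> would then reach
      its final end already before parameter 1.\<close>
    then have "i = Suc j mod m" using vertex[OF j(1) i(1)] ij by blast
    then have "polar (u j) (w j) (1 * th j) = polar (u j) (w j) ((real m * s2 - real j) * th j)"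
      using close[OF j(1)] ui Cj s(4) by simp
    then have "1 = real m * s2 - real j" using same_arc[OF j(1)] j(2) by (metis atLeastAtMost_iff atLeastLessThan_iff less_imp_le order_refl zero_le_one)
    then show False using j(2) by simp
  qed
  have idx_less: "sph_idx m s < m" for s using m by (simp add: sph_idx_def)
  have normal: "cross3 (N i) (cross3 (u i) (w i)) = 0" if "i < m" for i
    using cross3_of_perp N[OF that] by blast
  have cross_ne: "cross3 (u i) (w i) \<noteq> cross3 (u j) (w j) \<and> cross3 (u i) (w i) \<noteq> - cross3 (u j) (w j)"
    if "i < m" "j < m" "i \<noteq> j" for i j
  proof -
    have "(norm (cross3 (u j) (w j)))\<^sup>2 = 1"
      unfolding norm_cross using uw[OF that(2)] by (simp add: orthonormal_pair_def)
    then have "cross3 (u j) (w j) \<noteq> 0" by auto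
    then have ne: "cross3 (N i) (cross3 (u j) (w j)) \<noteq> 0"
      using cross3_parallel[of "N i" "cross3 (u j) (w j)" "N j"] normal[OF that(2)] pairs[OF that] by blast
    show ?thesis using normal[OF that(1)] ne by (metis cross_minus_right neg_equal_0_iff_equal)
  qed
  have perpC: "C s \<bullet> N (sph_idx m s) = 0" if sin: "s \<in> {0..<1}" for s
  proof -
    obtain i where i: "i < m" "real m * s - real i \<in> {0..<1}" using sph_parameter[OF m sin] .
    then show ?thesis using perp[OF i(1)] by (simp add: C_def sph_curve_eq[OF i])
  qed
  have C0: "C s \<noteq> 0" if sin: "s \<in> {0..<1}" for s
  proof -
    obtain i where i: "i < m" "real m * s - real i \<in> {0..<1}" using sph_parameter[OF m sin] .
    have "norm (C s) = 1" by (simp add: C_def sph_curve_eq[OF i] norm_polar[OF uw[OF i(1)]])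
    then show ?thesis by auto
  qed
  have triple: False
    if s: "s1 \<in> {0..<1}" "s2 \<in> {0..<1}" "s3 \<in> {0..<1}" "s1 \<noteq> s2" "s1 \<noteq> s3" "s2 \<noteq> s3"
      and e: "C s1 = C s2" "C s2 = C s3" for s1 s2 s3
  proof -
    define i j k where "i = sph_idx m s1" and "j = sph_idx m s2" and "k = sph_idx m s3"
    have ne: "i \<noteq> j" "i \<noteq> k" "j \<noteq> k"
      unfolding i_def j_def k_def using indices s e by metis+
    have lt: "i < m" "j < m" "k < m" using idx_less by (simp_all add: i_def j_def k_def)
    have "C s1 \<bullet> N i = 0" "C s1 \<bullet> N j = 0" "C s1 \<bullet> N k = 0"
      using perpC s e by (metis i_def, metis j_def, metis k_def)
    \<comment> \<open>A triple point would be orthogonal to three independent normals.\<close>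
    then have "(cross3 (N i) (N j) \<bullet> N k) *\<^sub>R C s1 = 0" by (simp add: cross3_cramer)
    then show False using triples[OF lt ne] C0[OF s(1)] by simp
  qed
  have arcs: "norm (u i) = 1 \<and> norm (w i) = 1 \<and> u i \<bullet> w i = 0 \<and> 0 < th i \<and> th i < 2 * pi \<and>
      sph_arc (u i) (w i) (th i) 1 = u (Suc i mod m)" if "i < m" for i
    using uw[OF that] th[OF that] close[OF that] by (simp add: orthonormal_pair_def sph_arc_eq_polar)
  show ?thesis
    unfolding sph_stick_curve_def C_def[symmetric] Let_def
  proof (intro conjI ballI allI impI)
    show "0 < m" by (rule m)
    fix i assume "i < m"
    from arcs[OF this] show "norm (u i) = 1" "norm (w i) = 1" "u i \<bullet> w i = 0" "0 < th i" "th i < 2 * pi"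
      "sph_arc (u i) (w i) (th i) 1 = u (Suc i mod m)" by simp_all
  next
    fix s1 s2 :: real assume s: "s1 \<in> {0..<1}" "s2 \<in> {0..<1}" and e: "s1 \<noteq> s2 \<and> C s1 = C s2"
    show "real m * s1 \<notin> \<int>" using interior[OF s] e by blast
    show "real m * s2 \<notin> \<int>" using interior[OF s(2,1)] e by metis
    have ne: "sph_idx m s1 \<noteq> sph_idx m s2" using indices[OF s] e by blast
    show "cross3 (u (sph_idx m s1)) (w (sph_idx m s1)) \<noteq> cross3 (u (sph_idx m s2)) (w (sph_idx m s2))"
      "cross3 (u (sph_idx m s1)) (w (sph_idx m s1)) \<noteq> - cross3 (u (sph_idx m s2)) (w (sph_idx m s2))"
      using cross_ne[OF idx_less idx_less ne] by simp_all
  next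
    fix s1 s2 s3 :: real assume "s1 \<in> {0..<1}" "s2 \<in> {0..<1}" "s3 \<in> {0..<1}"
      "s1 \<noteq> s2 \<and> s1 \<noteq> s3 \<and> s2 \<noteq> s3"
    then show "\<not> (C s1 = C s2 \<and> C s2 = C s3)" using triple by blast
  qed
qed

text \<open>The lift may be given piecewise, over each arc separately, with prescribed points
  \<open>c i\<close> above the corners. Pieces are allowed to meet only in these points; that the
  lifted curve is simple then follows from corners not being double points of the diagram.\<close>

lemma sph_representsI:
  assumes curve: "sph_stick_curve m u w th"
    and graph: "\<And>i. i < m \<Longrightarrow> radial_graph (u i) (w i) 0 (th i) (A i) (c i) (c (Suc i mod m))"
    and disj: "\<And>i j. i < m \<Longrightarrow> j < m \<Longrightarrow> i \<noteq> j \<Longrightarrow> A i \<inter> A j \<subseteq> c ` {..<m}"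
    and iso: "ambient_isotopic (\<Union>i<m. A i) K"
  shows "sph_represents m K"
proof -
  have m: "0 < m" using curve by (simp add: sph_stick_curve_def)
  have th: "0 < th i" and uw: "orthonormal_pair (u i) (w i)"
    and close: "polar (u i) (w i) (th i) = u (Suc i mod m)" if "i < m" for i
    using curve that by (simp_all add: sph_stick_curve_def orthonormal_pair_def sph_arc_eq_polar)
  have u0: "u i \<noteq> 0" if "i < m" for i
    using uw[OF that] by (auto simp: orthonormal_pair_def)
  define C where "C = sph_curve m u w th"
  let ?q = "\<lambda>i r. i < m \<longrightarrow> continuous_on {0..th i} r \<and> (\<forall>t\<in>{0..th i}. 0 < r t) \<and>
     A i = (\<lambda>t. r t *\<^sub>R polar (u i) (w i) t) ` {0..th i} \<and> r 0 *\<^sub>R polar (u i) (w i) 0 = c i \<and>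
     r (th i) *\<^sub>R polar (u i) (w i) (th i) = c (Suc i mod m)"
  have "\<forall>i. \<exists>r. ?q i r"
    using graph unfolding radial_graph_def by blast
  from choice[OF this] obtain q where q: "\<forall>i. ?q i (q i)" ..
  have q_cont: "continuous_on {0..th i} (q i)" and q_pos: "\<And>t. t \<in> {0..th i} \<Longrightarrow> 0 < q i t"
    and q_img: "A i = (\<lambda>t. q i t *\<^sub>R polar (u i) (w i) t) ` {0..th i}"
    and q_0: "q i 0 *\<^sub>R u i = c i"
    and q_th: "q i (th i) *\<^sub>R u (Suc i mod m) = c (Suc i mod m)" if "i < m" for i
    using q[rule_format, OF that] close[OF that] by (simp_all only: polar_zero)
  have q_match: "q i (th i) = q (Suc i mod m) 0" if "i < m" for i
  proof -
    have l: "Suc i mod m < m" using m by simp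
    have "q i (th i) *\<^sub>R u (Suc i mod m) = q (Suc i mod m) 0 *\<^sub>R u (Suc i mod m)"
      using q_th[OF that] q_0[OF l] by simp
    then show ?thesis using u0[OF l] by simp
  qed
  define r where "r s = (let i = nat \<lfloor>real m * s\<rfloor> mod m in q i ((real m * s - real_of_int \<lfloor>real m * s\<rfloor>) * th i))" for s
  \<comment> \<open>Neighbouring intervals share an end, at which \<open>sph_curve\<close> has
    already passed to the next arc; \<open>q_match\<close> and \<open>close\<close> reconcile the
    two descriptions.\<close>
  define J where "J i = {real i / real m..(real i + 1) / real m}" for i
  have local: "r s = q i ((real m * s - real i) * th i)"
      "C s = polar (u i) (w i) ((real m * s - real i) * th i)"
      "(real m * s - real i) * th i \<in> {0..th i}"
    if i: "i < m" and s: "s \<in> J i" for i s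
  proof -
    have b: "0 \<le> real m * s - real i" "real m * s - real i \<le> 1"
      using s m by (simp_all add: J_def field_simps)
    show "(real m * s - real i) * th i \<in> {0..th i}"
      using b th[OF i] by (simp add: mult_le_cancel_right1)
    have "r s = q i ((real m * s - real i) * th i) \<and> C s = polar (u i) (w i) ((real m * s - real i) * th i)"
    proof (cases "real m * s - real i < 1")
      case True
      then have f: "\<lfloor>real m * s\<rfloor> = int i" using b by (intro floor_unique) auto
      show ?thesis using i by (simp add: r_def Let_def f C_def sph_curve_def sph_arc_eq_polar)
    next
      case False
      then have ms: "real m * s = real (Suc i)" using b by simp
      have f: "\<lfloor>real m * s\<rfloor> = int (Suc i)" unfolding ms by (rule floor_of_nat)
      have n: "nat (int (Suc i)) = Suc i" by simp
      have d: "real m * s - real_of_int (int (Suc i)) = 0" "real m * s - real i = 1"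
        using ms by simp_all
      show ?thesis
        using q_match[OF i] close[OF i] unfolding r_def Let_def f C_def sph_curve_def sph_arc_eq_polar n d
        by simp
    qed
    then show "r s = q i ((real m * s - real i) * th i)"
      "C s = polar (u i) (w i) ((real m * s - real i) * th i)" by simp_all
  qed
  have cover: "{0..1} = (\<Union>i<m. J i)"
  proof (intro equalityI subsetI)
    fix s :: real assume s: "s \<in> {0..1}"
    show "s \<in> (\<Union>i<m. J i)"
    proof (cases "s = 1")
      case True
      then have "s \<in> J (m - 1)" using m by (simp add: J_def of_nat_diff)
      then show ?thesis using m by (intro UN_I[of "m - 1"]) auto
    next
      case False
      then obtain i where "i < m" "real m * s - real i \<in> {0..<1}"
        using sph_parameter[OF m, of s] s by auto
      then have "s \<in> J i" using m by (auto simp: J_def field_simps)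
      then show ?thesis using \<open>i < m\<close> by blast
    qed
  next
    fix s :: real assume "s \<in> (\<Union>i<m. J i)"
    then obtain i where i: "i < m" "s \<in> J i" by blast
    then have "real i + 1 \<le> real m" by linarith
    then have "(real i + 1) / real m \<le> 1" using m by simp
    moreover have "0 \<le> real i / real m" by simp
    ultimately show "s \<in> {0..1}" using i(2) unfolding J_def by (meson atLeastAtMost_iff order_trans)
  qed
  have "continuous_on (J i) r" if i: "i < m" for i
  proof (rule continuous_on_eq)
    show "continuous_on (J i) (\<lambda>s. q i ((real m * s - real i) * th i))"
      by (rule continuous_on_compose2[OF q_cont[OF i]]) (use local(3)[OF i] in \<open>auto intro!: continuous_intros\<close>)
  qed (simp add: local(1)[OF i])
  then have cont: "continuous_on {0..1} r"
    unfolding cover by (intro continuous_on_closed_Union) (auto simp: J_def)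
  have rpos: "0 < r s" if "s \<in> {0..1}" for s
    using that local q_pos unfolding cover by auto
  have r01: "r 0 = r 1" using m by (simp add: r_def Let_def)
  have piece: "(\<lambda>s. r s *\<^sub>R C s) ` J i = A i" if i: "i < m" for i
  proof -
    have "(\<lambda>s. r s *\<^sub>R C s) ` J i = (\<lambda>t. q i t *\<^sub>R polar (u i) (w i) t) ` (\<lambda>s. (real m * s - real i) * th i) ` J i"
      unfolding image_image using local(1,2)[OF i] by (intro image_cong) auto
    also have "(\<lambda>s. (real m * s - real i) * th i) ` J i = {0..th i}"
    proof (intro equalityI subsetI)
      fix t assume t: "t \<in> {0..th i}"
      define s where "s = (t / th i + real i) / real m"
      have "s \<in> J i" using t th[OF i] m by (auto simp: s_def J_def intro!: divide_right_mono)
      moreover have "t = (real m * s - real i) * th i" using th[OF i] m by (simp add: s_def)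
      ultimately show "t \<in> (\<lambda>s. (real m * s - real i) * th i) ` J i" by blast
    qed (use local(3)[OF i] in auto)
    finally show ?thesis by (simp add: q_img[OF i])
  qed
  have image: "(\<lambda>s. r s *\<^sub>R C s) ` {0..1} = (\<Union>i<m. A i)"
    unfolding cover using piece by (simp add: image_UN)
  have normC: "norm (C s) = 1" if "s \<in> {0..1}" for s
    using that local(2) norm_polar[OF uw] unfolding cover by auto
  have sep: "real m * s1 \<notin> \<int>" "real m * s2 \<notin> \<int>" "sph_idx m s1 \<noteq> sph_idx m s2"
    if "s1 \<in> {0..<1}" "s2 \<in> {0..<1}" "s1 \<noteq> s2" "C s1 = C s2" for s1 s2
    using curve that unfolding sph_stick_curve_def C_def Let_def by metis+
  \<comment> \<open>\<open>C\<close> has norm 1, so a lifted point determines its radius and its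
    direction.\<close>
  have direction: "C s1 = C s2" if "s1 \<in> {0..1}" "s2 \<in> {0..1}" "r s1 *\<^sub>R C s1 = r s2 *\<^sub>R C s2" for s1 s2
  proof -
    have "norm (r s1 *\<^sub>R C s1) = norm (r s2 *\<^sub>R C s2)" using that(3) by simp
    then have "r s1 = r s2" using normC that(1,2) rpos[OF that(1)] rpos[OF that(2)] by simp
    then show ?thesis using that(3) rpos[OF that(1)] by simp
  qed
  have "inj_on (\<lambda>s. r s *\<^sub>R C s) {0..<1}"
  proof (rule inj_onI, rule ccontr)
    fix s1 s2 :: real
    assume s: "s1 \<in> {0..<1}" "s2 \<in> {0..<1}" and e: "r s1 *\<^sub>R C s1 = r s2 *\<^sub>R C s2" and ne: "s1 \<noteq> s2"
    have eqC: "C s1 = C s2" using direction[of s1 s2] s e by simp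
    obtain i where i: "i < m" "real m * s1 - real i \<in> {0..<1}" using sph_parameter[OF m s(1)] .
    obtain j where j: "j < m" "real m * s2 - real j \<in> {0..<1}" using sph_parameter[OF m s(2)] .
    have ij: "i \<noteq> j" using sep(3)[OF s ne eqC] sph_curve_eq(2)[OF i] sph_curve_eq(2)[OF j] by simp
    have "s1 \<in> J i" "s2 \<in> J j" using i(2) j(2) m by (auto simp: J_def field_simps)
    then have "r s1 *\<^sub>R C s1 \<in> A i \<inter> A j" using piece[OF i(1)] piece[OF j(1)] e by (metis IntI imageI)
    then obtain k where k: "k < m" "r s1 *\<^sub>R C s1 = c k" using disj[OF i(1) j(1) ij] by blast
    \<comment> \<open>\<open>s3\<close> is the parameter of corner \<open>k\<close>. The coincidence
      takes place above this corner, so \<open>s1\<close> and \<open>s3\<close> give a double point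
      of the diagram with an integer value of \<open>real m * s3\<close>.\<close>
    define s3 where "s3 = real k / real m"
    have s3: "s3 \<in> {0..<1}" "s3 \<in> J k" using k(1) m by (auto simp: s3_def J_def divide_right_mono)
    have ms3: "real m * s3 = real k" using m by (simp add: s3_def)
    have "r s3 *\<^sub>R C s3 = c k"
      using local(1,2)[OF k(1) s3(2)] q_0[OF k(1)] by (simp add: ms3 polar_def)
    then have "C s3 = C s1" using direction[of s3 s1] s s3(1) k(2) by simp
    moreover have "s3 \<noteq> s1" using sep(1)[OF s ne eqC] ms3 by auto
    ultimately have "real m * s3 \<notin> \<int>" using sep(1)[OF s3(1) s(1)] by blast
    then show False by (simp add: ms3)
  qed
  then show ?thesis
    unfolding sph_represents_def
    using curve cont rpos r01 iso image unfolding C_def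
    by (intro exI[of _ u] exI[of _ w] exI[of _ th] exI[of _ r] conjI) simp_all
qed

section \<open>General position\<close>

text \<open>The inequalities such as \<open>Suc a < b\<close> select sticks without a common vertex.
  The second clause says that the great circles of three such sticks have no common point; sticks
  that share a vertex are settled by the first clause.\<close>

definition general_position :: "nat \<Rightarrow> (nat \<Rightarrow> real^3) \<Rightarrow> bool" where
  "general_position m x \<longleftrightarrow>
     (\<forall>a b c. a < b \<and> b < c \<and> c \<le> m \<longrightarrow> cross3 (x a) (x b) \<bullet> x c \<noteq> 0) \<and>
     (\<forall>a b c. Suc a < b \<and> Suc b < c \<and> Suc c \<le> m \<longrightarrow>
        cross3 (cross3 (x a) (x (Suc a))) (cross3 (x b) (x (Suc b))) \<bullet> cross3 (x c) (x (Suc c)) \<noteq> 0)"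

text \<open>Finitely many planes form a null set, and a ball is not one.\<close>

lemma avoid_planes:
  fixes x :: "real^3"
  assumes "finite F" "0 \<notin> F" "0 < e"
  obtains y where "norm (y - x) < e" "\<And>a. a \<in> F \<Longrightarrow> a \<bullet> y \<noteq> 0"
proof -
  have "negligible (\<Union>a\<in>F. {y. a \<bullet> y = 0})"
    using assms(1,2) by (intro negligible_Union) (auto intro!: negligible_hyperplane)
  moreover have "\<not> negligible (ball x e)"
    using assms(3) by (intro open_not_negligible) auto
  ultimately have "\<not> ball x e \<subseteq> (\<Union>a\<in>F. {y. a \<bullet> y = 0})"
    using negligible_subset by blast
  then obtain y where y: "y \<in> ball x e" "y \<notin> (\<Union>a\<in>F. {y. a \<bullet> y = 0})" by blast
  show thesis by (rule that[of y]) (use y in \<open>auto simp: dist_norm norm_minus_commute\<close>)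
qed

lemma perp_exists:
  fixes x :: "real^3"
  assumes "x \<noteq> 0"
  obtains z where "z \<noteq> 0" "z \<bullet> x = 0"
proof -
  obtain k where "cross3 x (axis k 1) \<noteq> 0" using cross_basis_nonzero[OF assms] by blast
  then show thesis using that[of "cross3 x (axis k 1)"] by (simp add: dot_cross_self inner_commute)
qed

text \<open>The vectors are chosen one after the other. Each condition on the new vector
  \<open>z\<close> excludes only a plane through the origin, so it suffices that the normals of
  these planes, collected in \<open>F\<close>, are nonzero.\<close>

lemma general_position_dense:
  fixes x :: "nat \<Rightarrow> real^3"
  assumes e: "0 < e"
  obtains y where "\<And>i. norm (y i - x i) < e" "general_position m y"
proof -
  \<comment> \<open>The induction also carries pairwise independence, which keeps the normals
    \<open>cross3 (y a) (y b)\<close> nonzero even while there are fewer than three vectors.\<close>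
  define good where "good m y \<longleftrightarrow> general_position m y \<and> (\<forall>a\<le>m. y a \<noteq> 0) \<and>
    (\<forall>a b. a < b \<and> b \<le> m \<longrightarrow> cross3 (y a) (y b) \<noteq> 0)" for m and y :: "nat \<Rightarrow> real^3"
  have "\<exists>y. (\<forall>i. norm (y i - x i) < e) \<and> good m y"
  proof (induction m)
    case 0
    obtain z where z: "norm (z - x 0) < e" "\<And>a. a \<in> {axis 1 1} \<Longrightarrow> a \<bullet> z \<noteq> 0"
      using avoid_planes[of "{axis 1 1}" e "x 0"] e by auto
    have "z \<noteq> 0" using z(2)[of "axis 1 1"] by auto
    then have "good 0 (x(0 := z))" by (simp add: good_def general_position_def)
    moreover have "norm ((x(0 := z)) i - x i) < e" for i using z(1) e by simp
    ultimately show ?case by blast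
  next
    case (Suc m)
    then obtain y where y: "\<And>i. norm (y i - x i) < e" "good m y" by blast
    have gp: "\<And>a b c. a < b \<Longrightarrow> b < c \<Longrightarrow> c \<le> m \<Longrightarrow> cross3 (y a) (y b) \<bullet> y c \<noteq> 0"
      and gp6: "\<And>a b c. Suc a < b \<Longrightarrow> Suc b < c \<Longrightarrow> Suc c \<le> m \<Longrightarrow>
        cross3 (cross3 (y a) (y (Suc a))) (cross3 (y b) (y (Suc b))) \<bullet> cross3 (y c) (y (Suc c)) \<noteq> 0"
      and y0: "\<And>a. a \<le> m \<Longrightarrow> y a \<noteq> 0"
      and pair: "\<And>a b. a < b \<Longrightarrow> b \<le> m \<Longrightarrow> cross3 (y a) (y b) \<noteq> 0"
      using y(2) by (simp_all add: good_def general_position_def)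
    have "\<forall>a. \<exists>z. a \<le> m \<longrightarrow> z \<noteq> 0 \<and> z \<bullet> y a = 0"
      using perp_exists y0 by metis
    \<comment> \<open>A vector \<open>z\<close> with \<open>p a \<bullet> z \<noteq> 0\<close> is
      not a multiple of \<open>y a\<close>.\<close>
    from choice[OF this] obtain p where p: "\<forall>a. a \<le> m \<longrightarrow> p a \<noteq> 0 \<and> p a \<bullet> y a = 0" ..
    \<comment> \<open>The condition on three sticks, the last of them from \<open>y m\<close> to
      \<open>z\<close>, is linear in \<open>z\<close> with this coefficient vector.\<close>
    define n where "n a b = cross3 (cross3 (cross3 (y a) (y (Suc a))) (cross3 (y b) (y (Suc b)))) (y m)" for a b
    have n0: "n a b \<noteq> 0" if ab: "Suc a < b" "Suc b < m" for a b
    proof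
      assume 0: "n a b = 0"
      define n1 where "n1 = cross3 (y a) (y (Suc a))"
      define n2 where "n2 = cross3 (y b) (y (Suc b))"
      have "cross3 (cross3 n1 n2) (y m) = (y m \<bullet> n1) *\<^sub>R n2 - (y m \<bullet> n2) *\<^sub>R n1"
        using Lagrange[of "y m" n1 n2] cross_skew[of "cross3 n1 n2" "y m"] by simp
      then have "(y m \<bullet> n1) *\<^sub>R n2 = (y m \<bullet> n2) *\<^sub>R n1"
        using 0 by (simp add: n_def n1_def n2_def)
      \<comment> \<open>Pairing with \<open>y a\<close> kills the right-hand side, while both
        factors on the left are determinants of three distinct old vectors.\<close>
      then have "(y m \<bullet> n1) * (n2 \<bullet> y a) = (y m \<bullet> n2) * (n1 \<bullet> y a)"
        by (metis inner_scaleR_left)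
      moreover have "n1 \<bullet> y a = 0" by (simp add: n1_def dot_cross_self)
      moreover have "y m \<bullet> n1 \<noteq> 0" using gp[of a "Suc a" m] ab by (simp add: n1_def inner_commute)
      moreover have "n2 \<bullet> y a \<noteq> 0"
        using gp[of a b "Suc b"] ab cross_triple[of "y a" "y b" "y (Suc b)"] by (simp add: n2_def)
      ultimately show False by simp
    qed
    define F where "F = p ` {..m} \<union> (\<lambda>(a, b). cross3 (y a) (y b)) ` {(a, b). a < b \<and> b \<le> m}
      \<union> (\<lambda>(a, b). n a b) ` {(a, b). Suc a < b \<and> Suc b < m}"
    have "finite F"
    proof -
      have "finite {(a, b). a < b \<and> b \<le> m}" by (rule finite_subset[of _ "{..m} \<times> {..m}"]) auto
      moreover have "finite {(a, b). Suc a < b \<and> Suc b < m}" by (rule finite_subset[of _ "{..m} \<times> {..m}"]) auto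
      ultimately show ?thesis by (simp add: F_def)
    qed
    moreover have "0 \<notin> F"
    proof
      assume "0 \<in> F"
      then consider "0 \<in> p ` {..m}" | "0 \<in> (\<lambda>(a, b). cross3 (y a) (y b)) ` {(a, b). a < b \<and> b \<le> m}"
        | "0 \<in> (\<lambda>(a, b). n a b) ` {(a, b). Suc a < b \<and> Suc b < m}" unfolding F_def by blast
      then show False
      proof cases
        case 1
        then show False using p by force
      next
        case 2
        then show False using pair by (auto dest!: sym[of 0])
      next
        case 3
        then show False using n0 by (auto dest!: sym[of 0])
      qed
    qed
    ultimately obtain z where z: "norm (z - x (Suc m)) < e" "\<And>a. a \<in> F \<Longrightarrow> a \<bullet> z \<noteq> 0"
      using avoid_planes e by blast
    define y' where "y' = y(Suc m := z)"
    have y'm: "y' a = y a" if "a \<le> m" for a using that by (simp add: y'_def)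
    have y'z: "y' (Suc m) = z" by (simp add: y'_def)
    have z0: "z \<noteq> 0" using z(2)[of "p 0"] by (auto simp: F_def)
    have zpair: "cross3 (y a) z \<noteq> 0" if a: "a \<le> m" for a
    proof
      assume c: "cross3 (y a) z = 0"
      have "cross3 (y a) (cross3 (y a) z) = (y a \<bullet> z) *\<^sub>R y a - (y a \<bullet> y a) *\<^sub>R z" by (rule Lagrange)
      then have "(y a \<bullet> z) *\<^sub>R y a = (y a \<bullet> y a) *\<^sub>R z" using c by simp
      then have "(y a \<bullet> z) * (p a \<bullet> y a) = (y a \<bullet> y a) * (p a \<bullet> z)"
        by (metis inner_scaleR_right)
      then show False using z(2)[of "p a"] p a y0[OF a] by (auto simp: F_def)
    qed
    have "cross3 (y' a) (y' b) \<bullet> y' c \<noteq> 0" if "a < b" "b < c" "c \<le> Suc m" for a b c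
    proof (cases "c = Suc m")
      case True
      have "cross3 (y a) (y b) \<in> F" using that True by (auto simp: F_def)
      then show ?thesis using z(2) that True by (simp add: y'm y'z)
    next
      case False
      then show ?thesis using that gp by (simp add: y'm)
    qed
    moreover have "cross3 (cross3 (y' a) (y' (Suc a))) (cross3 (y' b) (y' (Suc b))) \<bullet> cross3 (y' c) (y' (Suc c)) \<noteq> 0"
      if "Suc a < b" "Suc b < c" "Suc c \<le> Suc m" for a b c
    proof (cases "c = m")
      case True
      have "n a b \<in> F" using that True by (auto simp: F_def)
      then have "n a b \<bullet> z \<noteq> 0" by (rule z(2))
      moreover have "n a b \<bullet> z = cross3 (cross3 (y a) (y (Suc a))) (cross3 (y b) (y (Suc b))) \<bullet> cross3 (y m) z"
        unfolding n_def by (metis cross_triple inner_commute)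
      ultimately show ?thesis using that True by (simp add: y'm y'z)
    next
      case False
      then show ?thesis using that gp6 by (simp add: y'm)
    qed
    moreover have "y' a \<noteq> 0" if "a \<le> Suc m" for a
      using that y0 z0 by (cases "a = Suc m") (auto simp: y'm y'z)
    moreover have "cross3 (y' a) (y' b) \<noteq> 0" if "a < b" "b \<le> Suc m" for a b
      using that pair zpair by (cases "b = Suc m") (auto simp: y'm y'z)
    ultimately have "good (Suc m) y'" by (simp add: good_def general_position_def)
    moreover have "norm (y' i - x i) < e" for i using y(1) z(1) by (simp add: y'_def)
    ultimately show ?case by blast
  qed
  then show thesis using that by (auto simp: good_def)
qed

text \<open>A permutation of the indices changes the determinant at most in sign.\<close>

lemma triple_product_sorted:
  fixes N :: "nat \<Rightarrow> real^3"
  assumes sorted: "\<And>a b c. a < b \<Longrightarrow> b < c \<Longrightarrow> c \<le> m \<Longrightarrow> cross3 (N a) (N b) \<bullet> N c \<noteq> 0"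
    and le: "a \<le> m" "b \<le> m" "c \<le> m" and ne: "a \<noteq> b" "a \<noteq> c" "b \<noteq> c"
  shows "cross3 (N a) (N b) \<bullet> N c \<noteq> 0"
proof -
  define D where "D a b c = cross3 (N a) (N b) \<bullet> N c" for a b c
  have rot: "D a b c = D b c a" for a b c unfolding D_def by (rule cross_triple)
  have swap: "D b a c = - D a b c" for a b c
    unfolding D_def by (subst cross_skew) simp
  have D: "D a b c \<noteq> 0" if "a < b" "b < c" "c \<le> m" for a b c
    unfolding D_def using that by (rule sorted)
  consider "a < b" "b < c" | "b < c" "c < a" | "c < a" "a < b" | "b < a" "a < c" | "a < c" "c < b" | "c < b" "b < a"
    using ne by linarith
  then have "D a b c \<noteq> 0"
  proof cases
    case 1 then show ?thesis using D le by simp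
  next
    case 2 then show ?thesis using D[of b c a] le rot[of a b c] by simp
  next
    case 3 then show ?thesis using D[of c a b] le rot[of c a b] by simp
  next
    case 4 then show ?thesis using D[of b a c] le swap[of b a c] by simp
  next
    case 5 then show ?thesis using D[of a c b] le rot[of a c b] swap[of c b a] rot[of a b c] by simp
  next
    case 6 then show ?thesis using D[of c b a] le swap[of b c a] rot[of a b c] by simp
  qed
  then show ?thesis unfolding D_def .
qed

lemma general_position_triple:
  assumes "general_position m x" "a \<le> m" "b \<le> m" "c \<le> m" "a \<noteq> b" "a \<noteq> c" "b \<noteq> c"
  shows "cross3 (x a) (x b) \<bullet> x c \<noteq> 0"
  by (rule triple_product_sorted[of m x, OF _ assms(2-7)]) (use assms(1) in \<open>simp add: general_position_def\<close>)

lemma general_position_pair: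
  assumes "general_position m x" "2 \<le> m" "a \<le> m" "b \<le> m" "a \<noteq> b"
  shows "cross3 (x a) (x b) \<noteq> 0"
proof -
  \<comment> \<open>There are three indices up to 2, hence one besides \<open>a\<close> and
    \<open>b\<close>; a triple that contains \<open>a\<close> and \<open>b\<close> is
    independent.\<close>
  have "\<not> {..2::nat} \<subseteq> {a, b}"
  proof
    assume "{..2::nat} \<subseteq> {a, b}"
    then have "card {..2::nat} \<le> card {a, b}" by (intro card_mono) auto
    also have "\<dots> \<le> 2" by (simp add: card_insert_if)
    finally show False by simp
  qed
  then obtain c where "c \<le> 2" "c \<noteq> a" "c \<noteq> b" by auto
  then show ?thesis using general_position_triple[OF assms(1,3,4), of c] assms(2,5) by auto
qed

text \<open>The great circles of two consecutive sticks meet in the direction of the common vertex: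
  the cross product of their normals is a multiple of it. In this case the determinant is a product
  of determinants of three points.\<close>

lemma general_position_edges:
  assumes gp: "general_position m x" and m: "2 \<le> m"
    and "i < m" "j < m" "k < m" "i \<noteq> j" "i \<noteq> k" "j \<noteq> k"
  defines "N \<equiv> \<lambda>i. cross3 (x i) (x (Suc i))"
  shows "cross3 (N i) (N j) \<bullet> N k \<noteq> 0"
proof -
  have adj: "cross3 (N i) (N (Suc i)) \<bullet> N k \<noteq> 0" if "Suc i < m" "k < m" "k \<noteq> i" "k \<noteq> Suc i" for i k
  proof -
    have "cross3 (N i) (N (Suc i)) = (x (Suc (Suc i)) \<bullet> N i) *\<^sub>R x (Suc i)"
      unfolding N_def Lagrange[of "cross3 (x i) (x (Suc i))"] by (simp add: dot_cross_self inner_commute)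
    moreover have "x (Suc (Suc i)) \<bullet> N i \<noteq> 0"
      using general_position_triple[OF gp, of i "Suc i" "Suc (Suc i)"] that
      by (simp add: N_def inner_commute)
    moreover have "x (Suc i) \<bullet> N k \<noteq> 0"
      using general_position_triple[OF gp, of k "Suc k" "Suc i"] that
      by (simp add: N_def inner_commute)
    ultimately show ?thesis by simp
  qed
  have sorted: "cross3 (N i) (N j) \<bullet> N k \<noteq> 0" if lt: "i < j" "j < k" "k < m" for i j k
  proof -
    consider "j = Suc i" | "k = Suc j" | "Suc i < j" "Suc j < k" using lt by linarith
    then show ?thesis
    proof cases
      case 1
      then show ?thesis using adj[of i k] lt by auto
    next
      case 2
      then show ?thesis using adj[of j i] lt cross_triple[of "N i" "N j" "N k"] by auto
    next
      case 3
      then show ?thesis using gp lt unfolding general_position_def N_def by auto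
    qed
  qed
  show ?thesis
    by (rule triple_product_sorted[of "m - 1" N]) (use sorted assms(3-8) in auto)
qed

text \<open>The cross product of the normals is a combination of the independent \<open>x j\<close>
  and \<open>x (Suc j)\<close>; both coefficients vanish only if both points lie in the plane of
  stick \<open>i\<close>.\<close>

lemma general_position_edge_pair:
  assumes gp: "general_position m x" and m: "2 \<le> m" and "i < m" "j < m" "i \<noteq> j"
  defines "N \<equiv> \<lambda>i. cross3 (x i) (x (Suc i))"
  shows "cross3 (N i) (N j) \<noteq> 0"
proof -
  have "cross3 (N i) (N j) = (x (Suc j) \<bullet> N i) *\<^sub>R x j - (x j \<bullet> N i) *\<^sub>R x (Suc j)"
    unfolding N_def Lagrange[of "cross3 (x i) (x (Suc i))"] by (simp add: inner_commute)
  moreover have "x j \<bullet> N i \<noteq> 0 \<or> x (Suc j) \<bullet> N i \<noteq> 0"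
  proof (cases "j = Suc i")
    case True
    then show ?thesis using general_position_triple[OF gp, of i "Suc i" "Suc j"] assms(3-5)
      by (simp add: N_def inner_commute)
  next
    case False
    then show ?thesis using general_position_triple[OF gp, of i "Suc i" j] assms(3-5)
      by (simp add: N_def inner_commute)
  qed
  moreover have "cross3 (x j) (x (Suc j)) \<noteq> 0"
    using general_position_pair[OF gp m] assms(4) by simp
  ultimately show ?thesis
  proof -
    assume 1: "cross3 (N i) (N j) = (x (Suc j) \<bullet> N i) *\<^sub>R x j - (x j \<bullet> N i) *\<^sub>R x (Suc j)"
      and 2: "x j \<bullet> N i \<noteq> 0 \<or> x (Suc j) \<bullet> N i \<noteq> 0" and 3: "cross3 (x j) (x (Suc j)) \<noteq> 0"
    have "cross3 (cross3 (N i) (N j)) (x (Suc j)) = (x (Suc j) \<bullet> N i) *\<^sub>R cross3 (x j) (x (Suc j))"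
      "cross3 (x j) (cross3 (N i) (N j)) = - ((x j \<bullet> N i) *\<^sub>R cross3 (x j) (x (Suc j)))"
      unfolding 1 by (simp_all add: Cross3.left_diff_distrib Cross3.right_diff_distrib cross_mult_left cross_mult_right)
    then show ?thesis using 2 3 by auto
  qed
qed

section \<open>Stick knots\<close>

text \<open>Turns an interior point of an edge into a vertex, so that
  \<open>embedded_graph_perturb\<close> can bend the edge there.\<close>

lemma embedded_graph_subdivide:
  fixes p :: "'i \<Rightarrow> real^3"
  assumes emb: "embedded_graph E p" and ab: "(a, b) \<in> E" and k: "k \<notin> fst ` E \<union> snd ` E"
    and y: "y \<in> open_segment (p a) (p b)"
  shows "embedded_graph (insert (a, k) (insert (k, b) (E - {(a, b)}))) (p(k := y))"
proof -
  have fin: "finite E" and ne: "\<And>e. e \<in> E \<Longrightarrow> p (fst e) \<noteq> p (snd e)"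
    and meet: "\<And>e e'. e \<in> E \<Longrightarrow> e' \<in> E \<Longrightarrow> e \<noteq> e' \<Longrightarrow>
      edge_set p e \<inter> edge_set p e' \<subseteq> p ` ({fst e, snd e} \<inter> {fst e', snd e'})"
    using emb by (auto simp: embedded_graph_def)
  define p' where "p' = p(k := y)"
  have kV: "k \<noteq> fst e" "k \<noteq> snd e" if "e \<in> E" for e using k that by force+
  have kab: "a \<noteq> k" "b \<noteq> k" using kV[OF ab] by auto
  have p'E: "p' (fst e) = p (fst e)" "p' (snd e) = p (snd e)" if "e \<in> E" for e
    using kV[OF that] by (simp_all add: p'_def)
  have p'ab: "p' a = p a" "p' b = p b" "p' k = y" using kab by (simp_all add: p'_def)
  have eE: "edge_set p' e = edge_set p e" if "e \<in> E" for e
    using p'E[OF that] by (simp add: edge_set_def)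
  have yab: "y \<noteq> p a" "y \<noteq> p b" and ys: "y \<in> closed_segment (p a) (p b)"
    using y by (auto simp: open_segment_def)
  have int: "closed_segment (p a) y \<inter> closed_segment y (p b) = {y}"
    using Int_closed_segment ys by blast
  have un: "closed_segment (p a) y \<union> closed_segment y (p b) = edge_set p (a, b)"
    unfolding edge_set_def using Un_closed_segment[OF ys] by simp
  have sub: "closed_segment (p a) y \<subseteq> edge_set p (a, b)" "closed_segment y (p b) \<subseteq> edge_set p (a, b)"
    using un by blast+
  have ends: "p b \<notin> closed_segment (p a) y" "p a \<notin> closed_segment y (p b)"
    using int yab by auto
  have half1: "closed_segment (p a) y \<inter> edge_set p e \<subseteq> p' ` ({a, k} \<inter> {fst e, snd e})"
    if e: "e \<in> E" "e \<noteq> (a, b)" for e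
  proof
    fix z assume z: "z \<in> closed_segment (p a) y \<inter> edge_set p e"
    then have "z \<in> p ` ({a, b} \<inter> {fst e, snd e})" using meet[OF ab e(1)] e(2) sub by auto
    then have "z = p a" "a \<in> {fst e, snd e}" using z ends(1) by auto
    then show "z \<in> p' ` ({a, k} \<inter> {fst e, snd e})"
      using p'ab(1) by (intro image_eqI[of _ _ a]) simp_all
  qed
  have half2: "closed_segment y (p b) \<inter> edge_set p e \<subseteq> p' ` ({k, b} \<inter> {fst e, snd e})"
    if e: "e \<in> E" "e \<noteq> (a, b)" for e
  proof
    fix z assume z: "z \<in> closed_segment y (p b) \<inter> edge_set p e"
    then have "z \<in> p ` ({a, b} \<inter> {fst e, snd e})" using meet[OF ab e(1)] e(2) sub by auto
    then have "z = p b" "b \<in> {fst e, snd e}" using z ends(2) by auto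
    then show "z \<in> p' ` ({k, b} \<inter> {fst e, snd e})"
      using p'ab(2) by (intro image_eqI[of _ _ b]) simp_all
  qed
  have old: "edge_set p e \<inter> edge_set p e' \<subseteq> p' ` ({fst e, snd e} \<inter> {fst e', snd e'})"
    if ee: "e \<in> E" "e' \<in> E" "e \<noteq> e'" for e e'
  proof
    fix z assume "z \<in> edge_set p e \<inter> edge_set p e'"
    then have "z \<in> p ` ({fst e, snd e} \<inter> {fst e', snd e'})" using meet[OF ee] by auto
    then obtain i where "i \<in> {fst e, snd e} \<inter> {fst e', snd e'}" "z = p i" by (elim imageE)
    moreover from this have "p' i = p i" using p'E[OF ee(1)] by auto
    ultimately show "z \<in> p' ` ({fst e, snd e} \<inter> {fst e', snd e'})" by (intro image_eqI[of _ _ i]) simp_all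
  qed
  have es: "edge_set p' (a, k) = closed_segment (p a) y" "edge_set p' (k, b) = closed_segment y (p b)"
    using p'ab by (simp_all add: edge_set_def)
  have "edge_set p' e \<inter> edge_set p' e' \<subseteq> p' ` ({fst e, snd e} \<inter> {fst e', snd e'})"
    if e: "e \<in> insert (a, k) (insert (k, b) (E - {(a, b)}))"
      "e' \<in> insert (a, k) (insert (k, b) (E - {(a, b)}))" "e \<noteq> e'" for e e'
  proof -
    consider "e = (a, k)" "e' = (k, b)" | "e = (k, b)" "e' = (a, k)"
      | "e = (a, k)" "e' \<in> E" "e' \<noteq> (a, b)" | "e = (k, b)" "e' \<in> E" "e' \<noteq> (a, b)"
      | "e' = (a, k)" "e \<in> E" "e \<noteq> (a, b)" | "e' = (k, b)" "e \<in> E" "e \<noteq> (a, b)"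
      | "e \<in> E" "e' \<in> E" using e by blast
    then show ?thesis
    proof cases
      case 1
      then show ?thesis unfolding 1 es int using p'ab by auto
    next
      case 2
      then show ?thesis unfolding 2 es using p'ab int by (auto simp: Int_commute)
    next
      case 3
      then show ?thesis using half1[OF 3(2,3)] es eE by simp
    next
      case 4
      then show ?thesis using half2[OF 4(2,3)] es eE by simp
    next
      case 5
      then show ?thesis using half1[OF 5(2,3)] es eE by (simp only: Int_commute fst_conv snd_conv)
    next
      case 6
      then show ?thesis using half2[OF 6(2,3)] es eE by (simp only: Int_commute fst_conv snd_conv)
    next
      case 7
      then show ?thesis using old e(3) eE by simp
    qed
  qed
  moreover have "p' (fst e) \<noteq> p' (snd e)" if ein: "e \<in> insert (a, k) (insert (k, b) (E - {(a, b)}))" for e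
  proof -
    consider "e = (a, k)" | "e = (k, b)" | "e \<in> E" using ein by blast
    then show ?thesis
      by cases (use yab p'ab p'E ne in simp_all)
  qed
  ultimately show ?thesis unfolding embedded_graph_def p'_def[symmetric] using fin by blast
qed

section \<open>Renumbering, mapping and perturbing stick knots\<close>

lemma stick_knot_distinct:
  assumes "stick_knot n v" "i < n" "j < n" "i \<noteq> j"
  shows "v i \<noteq> v j"
proof
  assume eq: "v i = v j"
  consider "j = Suc i mod n" | "i = Suc j mod n" | "j \<noteq> Suc i mod n" "i \<noteq> Suc j mod n" by blast
  then show False
  proof cases
    case 3
    then have "closed_segment (v i) (v (Suc i mod n)) \<inter> closed_segment (v j) (v (Suc j mod n)) = {}"
      using assms unfolding stick_knot_def by blast
    then show False using eq by (metis IntI empty_iff ends_in_segment(1))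
  qed (use assms eq in \<open>auto simp: stick_knot_def\<close>)
qed

lemma stick_knot_shift:
  assumes "stick_knot n v"
  shows "stick_knot n (\<lambda>i. v ((i + k) mod n))" "stick_set n (\<lambda>i. v ((i + k) mod n)) = stick_set n v"
proof -
  have n: "3 \<le> n" using assms by (simp add: stick_knot_def)
  define f where "f i = (i + k) mod n" for i
  have f_lt: "f i < n" for i using n by (simp add: f_def)
  have f_Suc: "f (Suc i mod n) = Suc (f i) mod n" for i by (simp add: f_def mod_simps)
  have f_inj: "i = j" if "i < n" "j < n" "f i = f j" for i j
  proof -
    have le: "i = j" if "i \<le> j" "j < n" "f i = f j" for i j
    proof -
      have "n dvd (j + k) - (i + k)"
        using that by (subst mod_eq_dvd_iff_nat[symmetric]) (simp_all add: f_def)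
      then show ?thesis using that by (cases "j - i = 0") (auto dest: dvd_imp_le)
    qed
    show ?thesis using le[of i j] le[of j i] that by (cases "i \<le> j") auto
  qed
  have f_img: "f ` {..<n} = {..<n}"
    by (rule card_subset_eq) (use f_lt f_inj in \<open>auto simp: card_image inj_on_def\<close>)
  have S_lt: "Suc i mod n < n" for i using n by simp
  have 1: "v (f i) \<noteq> v (f (Suc i mod n))" if "i < n" for i
    using assms f_lt unfolding f_Suc stick_knot_def by blast
  have 2: "closed_segment (v (f i)) (v (f (Suc i mod n))) \<inter>
      closed_segment (v (f (Suc i mod n))) (v (f (Suc (Suc i) mod n))) = {v (f (Suc i mod n))}" for i
  proof -
    have "f (Suc (Suc i) mod n) = Suc (Suc (f i)) mod n"
      by (simp add: f_def mod_simps)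
    then show ?thesis using assms f_lt[of i] unfolding f_Suc stick_knot_def by simp
  qed
  have 3: "closed_segment (v (f i)) (v (f (Suc i mod n))) \<inter> closed_segment (v (f j)) (v (f (Suc j mod n))) = {}"
    if "i < n" "j < n" "i \<noteq> j" "j \<noteq> Suc i mod n" "i \<noteq> Suc j mod n" for i j
  proof -
    have "f i \<noteq> f j" "f j \<noteq> Suc (f i) mod n" "f i \<noteq> Suc (f j) mod n"
      using that f_inj S_lt unfolding f_Suc[symmetric] by metis+
    then show ?thesis using assms f_lt unfolding f_Suc stick_knot_def by simp
  qed
  show "stick_knot n (\<lambda>i. v ((i + k) mod n))"
    unfolding stick_knot_def f_def[symmetric] using n 1 2 3 by blast
  have "stick_set n (\<lambda>i. v (f i)) = (\<Union>i\<in>f ` {..<n}. closed_segment (v i) (v (Suc i mod n)))"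
    by (simp add: stick_set_def f_Suc)
  then show "stick_set n (\<lambda>i. v ((i + k) mod n)) = stick_set n v"
    unfolding f_img by (simp add: stick_set_def f_def)
qed

lemma stick_knot_image:
  assumes sk: "stick_knot n v" and g: "inj g"
    and vert: "\<And>i. i < n \<Longrightarrow> g (v i) = v' i"
    and seg: "\<And>i. i < n \<Longrightarrow> g ` closed_segment (v i) (v (Suc i mod n)) = closed_segment (v' i) (v' (Suc i mod n))"
  shows "stick_knot n v'" "stick_set n v' = g ` stick_set n v"
proof -
  have n: "3 \<le> n" using sk by (simp add: stick_knot_def)
  have S_lt: "Suc i mod n < n" for i using n by simp
  have SS: "Suc (Suc i) mod n = Suc (Suc i mod n) mod n" for i by (simp add: mod_simps)
  have "v' i \<noteq> v' (Suc i mod n)" if "i < n" for i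
    using sk that g vert[OF that] vert[OF S_lt] unfolding stick_knot_def by (metis inj_eq)
  moreover have "closed_segment (v' i) (v' (Suc i mod n)) \<inter>
      closed_segment (v' (Suc i mod n)) (v' (Suc (Suc i) mod n)) = {v' (Suc i mod n)}" if "i < n" for i
  proof -
    have "closed_segment (v i) (v (Suc i mod n)) \<inter>
      closed_segment (v (Suc i mod n)) (v (Suc (Suc i) mod n)) = {v (Suc i mod n)}"
      using sk that by (simp add: stick_knot_def)
    then have "g ` closed_segment (v i) (v (Suc i mod n)) \<inter>
      g ` closed_segment (v (Suc i mod n)) (v (Suc (Suc i) mod n)) = {g (v (Suc i mod n))}"
      by (simp flip: image_Int[OF g])
    then show ?thesis using seg[OF that] seg[OF S_lt, of i] vert[OF S_lt] unfolding SS by simp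
  qed
  moreover have "closed_segment (v' i) (v' (Suc i mod n)) \<inter> closed_segment (v' j) (v' (Suc j mod n)) = {}"
    if "i < n" "j < n" "i \<noteq> j" "j \<noteq> Suc i mod n" "i \<noteq> Suc j mod n" for i j
  proof -
    have "closed_segment (v i) (v (Suc i mod n)) \<inter> closed_segment (v j) (v (Suc j mod n)) = {}"
      using sk that by (simp add: stick_knot_def)
    then show ?thesis
      unfolding seg[OF that(1), symmetric] seg[OF that(2), symmetric] by (simp flip: image_Int[OF g])
  qed
  ultimately show "stick_knot n v'" unfolding stick_knot_def using n by blast
  show "stick_set n v' = g ` stick_set n v"
    unfolding stick_set_def image_UN using seg by (intro SUP_cong) auto
qed

lemma stick_knot_edges_meet:
  assumes sk: "stick_knot n v" and ij: "i < n" "j < n" "i \<noteq> j"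
  shows "closed_segment (v i) (v (Suc i mod n)) \<inter> closed_segment (v j) (v (Suc j mod n))
    \<subseteq> v ` ({i, Suc i mod n} \<inter> {j, Suc j mod n})"
proof -
  have cons: "closed_segment (v i) (v (Suc i mod n)) \<inter>
      closed_segment (v (Suc i mod n)) (v (Suc (Suc i mod n) mod n)) = {v (Suc i mod n)}" if "i < n" for i
    using sk that by (simp add: stick_knot_def mod_simps)
  consider "j = Suc i mod n" | "i = Suc j mod n" | "j \<noteq> Suc i mod n" "i \<noteq> Suc j mod n" by blast
  then show ?thesis
  proof cases
    case 1
    then show ?thesis using cons[OF ij(1)] by auto
  next
    case 2
    then show ?thesis using cons[OF ij(2)] by auto
  next
    case 3
    then have "closed_segment (v i) (v (Suc i mod n)) \<inter> closed_segment (v j) (v (Suc j mod n)) = {}"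
      using sk ij unfolding stick_knot_def by blast
    then show ?thesis by simp
  qed
qed

text \<open>Each stick may be oriented either way through \<open>f\<close>; later both sticks at the
  origin have to start there.\<close>

lemma stick_knot_graph:
  assumes sk: "stick_knot n v"
    and f: "\<And>i. i < n \<Longrightarrow> f i = (i, Suc i mod n) \<or> f i = (Suc i mod n, i)"
  shows "embedded_graph (f ` {..<n}) v"
proof -
  have ends: "{fst (f i), snd (f i)} = {i, Suc i mod n}"
    and edge: "edge_set v (f i) = closed_segment (v i) (v (Suc i mod n))"
    and ne: "v (fst (f i)) \<noteq> v (snd (f i))" if "i < n" for i
  proof -
    have "v i \<noteq> v (Suc i mod n)" using sk that by (simp add: stick_knot_def)
    then show "{fst (f i), snd (f i)} = {i, Suc i mod n}"
      "edge_set v (f i) = closed_segment (v i) (v (Suc i mod n))" "v (fst (f i)) \<noteq> v (snd (f i))"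
      using f[OF that] by (auto simp: edge_set_def closed_segment_commute)
  qed
  have "edge_set v (f i) \<inter> edge_set v (f j) \<subseteq> v ` ({fst (f i), snd (f i)} \<inter> {fst (f j), snd (f j)})"
    if "i < n" "j < n" "f i \<noteq> f j" for i j
  proof -
    have "i \<noteq> j" using that(3) by auto
    then show ?thesis unfolding edge[OF that(1)] edge[OF that(2)] ends[OF that(1)] ends[OF that(2)]
      by (rule stick_knot_edges_meet[OF sk that(1,2)])
  qed
  then show ?thesis unfolding embedded_graph_def using ne by blast
qed

lemma closed_segment_image_affine:
  assumes "\<And>t. t \<in> {0..1} \<Longrightarrow> g ((1 - t) *\<^sub>R a + t *\<^sub>R b) = (1 - t) *\<^sub>R a' + t *\<^sub>R (b' :: real^3)"
  shows "g ` closed_segment a b = closed_segment a' b'"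
  unfolding closed_segment_image_interval image_image using assms by (intro image_cong) auto

text \<open>The ambient isotopy carries sticks affinely onto sticks, so the new polygon is embedded
  because the old one is.\<close>

lemma stick_knot_perturb:
  assumes sk: "stick_knot n v"
  obtains e where "e > 0" "\<And>v'. (\<And>i. i < n \<Longrightarrow> norm (v' i - v i) < e) \<Longrightarrow>
    stick_knot n v' \<and> ambient_isotopic (stick_set n v) (stick_set n v')"
proof -
  have n: "3 \<le> n" using sk by (simp add: stick_knot_def)
  define E where "E = (\<lambda>i. (i, Suc i mod n)) ` {..<n}"
  obtain e where e: "e > 0" "\<And>v'. (\<And>i. i \<in> fst ` E \<union> snd ` E \<Longrightarrow> norm (v' i - v i) < e) \<Longrightarrow>
    \<exists>g. isotopy_map g \<and> (\<forall>i j. \<forall>t\<in>{0..1}. (i, j) \<in> E \<longrightarrow>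
      g (edge_point v i j t) = edge_point v' i j t)"
    using embedded_graph_perturb[OF stick_knot_graph[OF sk, of "\<lambda>i. (i, Suc i mod n)"]] unfolding E_def by blast
  have "stick_knot n v' \<and> ambient_isotopic (stick_set n v) (stick_set n v')"
    if v': "\<And>i. i < n \<Longrightarrow> norm (v' i - v i) < e" for v'
  proof -
    have "i < n" if "i \<in> fst ` E \<union> snd ` E" for i using that n by (auto simp: E_def)
    then have "norm (v' i - v i) < e" if "i \<in> fst ` E \<union> snd ` E" for i using that v' by blast
    from e(2)[of v', OF this] obtain g where iso: "isotopy_map g \<and> (\<forall>i j. \<forall>t\<in>{0..1}. (i, j) \<in> E \<longrightarrow>
      g (edge_point v i j t) = edge_point v' i j t)" ..
    then have g: "isotopy_map g" and gE: "\<And>i j t. t \<in> {0..1} \<Longrightarrow> (i, j) \<in> E \<Longrightarrow>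
      g (edge_point v i j t) = edge_point v' i j t"
      by simp_all
    have gi: "g (edge_point v i (Suc i mod n) t) = edge_point v' i (Suc i mod n) t"
      if "t \<in> {0..1}" "i < n" for i t
      using gE[OF that(1)] that(2) by (simp add: E_def)
    have seg: "g ` closed_segment (v i) (v (Suc i mod n)) = closed_segment (v' i) (v' (Suc i mod n))"
      if "i < n" for i
      by (rule closed_segment_image_affine) (rule gi[OF _ that])
    have vert: "g (v i) = v' i" if "i < n" for i
      using gi[of 0, OF _ that] by simp
    show ?thesis
      using stick_knot_image[OF sk isotopy_map_inj[OF g] vert seg] ambient_isotopic_image[OF g] by simp
  qed
  with e(1) show thesis by (rule that)
qed

lemma stick_knot_normal_form:
  assumes sk: "stick_knot (m + 2) v"
  obtains x h where "stick_knot (m + 2) (case_nat 0 x)"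
    "ambient_isotopic (stick_set (m + 2) v) (stick_set (m + 2) (case_nat 0 x))"
    "general_position m x" "\<And>i. i \<le> m \<Longrightarrow> 0 < h \<bullet> x i"
proof -
  define n where "n = m + 2"
  have n: "0 < n" by (simp add: n_def)
  obtain k where k: "k < n" "\<And>i. i < n \<Longrightarrow> norm (v i) \<le> norm (v k)"
  proof -
    have "Max ((\<lambda>i. norm (v i)) ` {..<n}) \<in> (\<lambda>i. norm (v i)) ` {..<n}"
      by (rule Max_in) (use n in auto)
    then obtain k where "k < n" "norm (v k) = Max ((\<lambda>i. norm (v i)) ` {..<n})" by auto
    then show thesis using that by simp
  qed
  define v1 where "v1 i = v ((i + k) mod n)" for i
  define v2 where "v2 i = v1 i - v k" for i
  define h where "h = - v k"
  have sk1: "stick_knot n v1" "stick_set n v1 = stick_set n v"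
    unfolding v1_def using stick_knot_shift[OF sk] by (simp_all add: n_def)
  have iso: "isotopy_map (\<lambda>x. x + h)" by (rule isotopy_map_translation)
  have "(\<lambda>x. x + h) ` closed_segment a b = closed_segment (a + h) (b + h)" for a b
    by (rule closed_segment_image_affine) (simp add: algebra_simps)
  then have sk2: "stick_knot n v2" "stick_set n v2 = (\<lambda>x. x + h) ` stick_set n v1"
    using stick_knot_image[OF sk1(1) isotopy_map_inj[OF iso], of v2] by (simp_all add: v2_def h_def)
  have v20: "v2 0 = 0" using k by (simp add: v2_def v1_def)
  \<comment> \<open>With \<open>v k\<close> of maximal norm, \<open>h \<bullet> v2 i\<close> is at
    least half the squared distance of \<open>v1 i\<close> from \<open>v k\<close>, since that
    squared distance is at most \<open>2 * (v k \<bullet> v k - v k \<bullet> v1 i)\<close>.\<close>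
  have pos: "0 < h \<bullet> v2 i" if i: "0 < i" "i < n" for i
  proof -
    have "v2 i \<noteq> v2 0" using stick_knot_distinct[OF sk2(1), of i 0] i by simp
    then have "v1 i \<noteq> v k" by (simp add: v20) (simp add: v2_def)
    then have "0 < (v1 i - v k) \<bullet> (v1 i - v k)" by simp
    moreover have "norm (v1 i) \<le> norm (v k)" using k(2) n by (simp add: v1_def)
    then have "v1 i \<bullet> v1 i \<le> v k \<bullet> v k" by (simp add: norm_le)
    ultimately show ?thesis
      by (simp add: h_def v2_def inner_diff_left inner_diff_right inner_commute)
  qed
  obtain e where e: "e > 0" "\<And>v'. (\<And>i. i < n \<Longrightarrow> norm (v' i - v2 i) < e) \<Longrightarrow>
    stick_knot n v' \<and> ambient_isotopic (stick_set n v2) (stick_set n v')"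
    using stick_knot_perturb[OF sk2(1)] by metis
  define D where "D = Min ((\<lambda>i. h \<bullet> v2 i) ` {0<..<n})"
  have D: "0 < D" "\<And>i. 0 < i \<Longrightarrow> i < n \<Longrightarrow> D \<le> h \<bullet> v2 i"
  proof -
    have "D \<in> (\<lambda>i. h \<bullet> v2 i) ` {0<..<n}" unfolding D_def by (rule Min_in) (auto simp: n_def)
    then show "0 < D" using pos by auto
  qed (auto simp: D_def)
  \<comment> \<open>A move by less than this preserves the knot type and changes \<open>h\<close> by
    less than its minimum \<open>D\<close> on the vertices other than 0. Vertex 0 itself stays
    exactly at the origin, as only the vectors \<open>x i\<close> are perturbed.\<close>
  define e' where "e' = min e (D / (norm h + 1))"
  have nh: "0 < norm h + 1" using norm_ge_zero[of h] by linarith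
  have e': "0 < e'" using e(1) D(1) nh by (simp add: e'_def)
  obtain x where x: "\<And>i. norm (x i - v2 (Suc i)) < e'" "general_position m x"
    using general_position_dense[OF e', of "\<lambda>i. v2 (Suc i)" m] by metis
  have "norm (case_nat 0 x i - v2 i) < e" if "i < n" for i
    using x(1)[of "i - 1"] e(1) v20 by (cases i) (auto simp: e'_def)
  then have sk3: "stick_knot n (case_nat 0 x)" "ambient_isotopic (stick_set n v2) (stick_set n (case_nat 0 x))"
    using e(2) by blast+
  have "ambient_isotopic (stick_set n v) (stick_set n v2)"
    using ambient_isotopic_image[OF iso] sk1(2) sk2(2) by metis
  then have "ambient_isotopic (stick_set n v) (stick_set n (case_nat 0 x))"
    using sk3(2) by (rule ambient_isotopic_trans)
  moreover have "0 < h \<bullet> x i" if "i \<le> m" for i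
  proof -
    have "\<bar>h \<bullet> (x i - v2 (Suc i))\<bar> \<le> norm h * norm (x i - v2 (Suc i))" by (rule Cauchy_Schwarz_ineq2)
    also have "\<dots> \<le> norm h * e'" using x(1)[of i] by (intro mult_left_mono) auto
    also have "\<dots> \<le> norm h * (D / (norm h + 1))" by (intro mult_left_mono) (auto simp: e'_def)
    also have "\<dots> < D" using D(1) nh by (simp add: field_simps)
    finally have "\<bar>h \<bullet> x i - h \<bullet> v2 (Suc i)\<bar> < D" by (simp add: inner_diff_right)
    then show ?thesis using D(2)[of "Suc i"] that by (simp add: n_def)
  qed
  ultimately show thesis using that sk3(1) x(2) unfolding n_def by blast
qed

section \<open>The two strands at a vertex\<close>

text \<open>\<open>w\<close> is oriented so that \<open>cross3 Q w\<close> is a positive multiple of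
  \<open>cross3 a b\<close>; this is what fixes the sign of \<open>sin (t - s)\<close>.\<close>

lemma plane_frame:
  fixes a b Q :: "real^3"
  defines "n \<equiv> cross3 a b"
  assumes n0: "n \<noteq> 0" and Q: "norm Q = 1" "Q \<bullet> n = 0"
  obtains w s t where "orthonormal_pair Q w" "w \<bullet> n = 0" "0 \<le> s" "s < 2 * pi" "0 \<le> t" "t < 2 * pi"
    "a = norm a *\<^sub>R polar Q w s" "b = norm b *\<^sub>R polar Q w t" "0 < sin (t - s)"
proof -
  define w where "w = (1 / norm n) *\<^sub>R cross3 n Q"
  have "(norm (cross3 n Q))\<^sup>2 = (norm n)\<^sup>2" unfolding norm_cross using Q by (simp add: inner_commute)
  then have "norm (cross3 n Q) = norm n" by (simp add: power2_eq_iff_nonneg)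
  then have w: "orthonormal_pair Q w" "w \<bullet> n = 0"
    using n0 Q(1) by (simp_all add: orthonormal_pair_def w_def dot_cross_self inner_commute)
  have ab: "a \<noteq> 0" "b \<noteq> 0" "a \<bullet> n = 0" "b \<bullet> n = 0" using n0 by (auto simp: n_def dot_cross_self)
  have "n \<bullet> Q = 0" "n \<bullet> w = 0" using Q w(2) by (simp_all add: inner_commute)
  note pc = polar_coordinates[OF w(1) this n0]
  obtain s where s: "0 \<le> s" "s < 2 * pi" "a = norm a *\<^sub>R polar Q w s" using pc ab by metis
  obtain t where t: "0 \<le> t" "t < 2 * pi" "b = norm b *\<^sub>R polar Q w t" using pc ab by metis
  have Qw: "cross3 Q w = (1 / norm n) *\<^sub>R n"
    unfolding w_def cross_mult_right Lagrange using Q by (simp add: norm_eq_1)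
  have cp: "cross3 (polar Q w s) (polar Q w t) = sin (t - s) *\<^sub>R cross3 Q w"
    unfolding polar_def
    by (simp add: cross_add_left cross_add_right cross_mult_left cross_mult_right cross_skew[of w Q]
        sin_diff algebra_simps)
  have "n = cross3 (norm a *\<^sub>R polar Q w s) (norm b *\<^sub>R polar Q w t)"
    using s(3) t(3) by (simp add: n_def)
  also have "\<dots> = (norm a * norm b * sin (t - s) / norm n) *\<^sub>R n"
    by (simp add: cross_mult_left cross_mult_right cp Qw)
  finally have "1 *\<^sub>R n = (norm a * norm b * sin (t - s) / norm n) *\<^sub>R n" by simp
  then have "norm a * norm b * sin (t - s) / norm n = 1" using n0 by (metis scaleR_cancel_right)
  then have "norm n = (norm a * norm b) * sin (t - s)" using n0 by (simp add: field_simps)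
  then have "0 < (norm a * norm b) * sin (t - s)" using n0 by (metis zero_less_norm_iff)
  moreover have "0 < norm a * norm b" using ab by simp
  ultimately have "0 < sin (t - s)" by (rule zero_less_mult_pos)
  then show thesis using that w s t by blast
qed

text \<open>Angles are measured from \<open>Q\<close>. As \<open>h\<close> is positive on
  \<open>a\<close> and \<open>b\<close> but not on \<open>Q\<close>, the short arc from
  \<open>a\<close> to \<open>b\<close> misses \<open>Q\<close>. Starting at \<open>Q\<close> and
  turning in the direction from \<open>a\<close> to \<open>b\<close>, one meets first
  \<open>a\<close> and then \<open>b\<close> before a full turn: the arc prolonged back to
  \<open>Q\<close> has length \<open>t < 2 * pi\<close>.\<close>

lemma first_edge_frame:
  fixes a b Q h :: "real^3"
  assumes n0: "cross3 a b \<noteq> 0" and Q: "norm Q = 1" "Q \<bullet> cross3 a b = 0"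
    and h: "0 < h \<bullet> a" "0 < h \<bullet> b" "h \<bullet> Q \<le> 0"
  obtains w s t where "orthonormal_pair Q w" "w \<bullet> cross3 a b = 0" "0 < s" "s < t" "t < 2 * pi" "t < s + pi"
    "a = norm a *\<^sub>R polar Q w s" "b = norm b *\<^sub>R polar Q w t"
proof -
  obtain w s t where f: "orthonormal_pair Q w" "w \<bullet> cross3 a b = 0" "0 \<le> s" "s < 2 * pi" "0 \<le> t" "t < 2 * pi"
    "a = norm a *\<^sub>R polar Q w s" "b = norm b *\<^sub>R polar Q w t" "0 < sin (t - s)"
    using plane_frame[OF n0 Q] by blast
  have ab: "0 < norm a" "0 < norm b" using n0 by auto
  have ha: "0 < h \<bullet> polar Q w s"
  proof -
    have "h \<bullet> a = norm a * (h \<bullet> polar Q w s)" by (subst f(7)) simp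
    then show ?thesis using h(1) ab by (simp add: zero_less_mult_iff)
  qed
  have hb: "0 < h \<bullet> polar Q w t"
  proof -
    have "h \<bullet> b = norm b * (h \<bullet> polar Q w t)" by (subst f(8)) simp
    then show ?thesis using h(2) ab by (simp add: zero_less_mult_iff)
  qed
  have s0: "0 < s"
  proof (rule ccontr)
    assume "\<not> 0 < s"
    then have "s = 0" using f(3) by simp
    then show False using ha h(3) by (simp add: polar_def)
  qed
  \<comment> \<open>Otherwise \<open>s - t > pi\<close>, and \<open>Q\<close> would be a combination
    of the directions of \<open>a\<close> and \<open>b\<close> with nonnegative coefficients, on
    which \<open>h\<close> is positive.\<close>
  have st: "s < t"
  proof (rule ccontr)
    assume "\<not> s < t"
    then have le: "t \<le> s" by simp
    have "\<not> s - t \<le> pi"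
    proof
      assume "s - t \<le> pi"
      then have "0 \<le> sin (s - t)" using le by (intro sin_ge_zero) auto
      then show False using f(9) sin_minus[of "s - t"] by simp
    qed
    then have gt: "pi < s - t" by simp
    have ss: "sin s < 0" using gt f(4,5) sin_lt_zero by simp
    have tt: "0 \<le> sin t" using gt f(4,5) by (intro sin_ge_zero) auto
    have "sin (t - s) *\<^sub>R Q = sin t *\<^sub>R polar Q w s - sin s *\<^sub>R polar Q w t"
      by (simp add: polar_def sin_diff algebra_simps)
    then have "sin (t - s) * (h \<bullet> Q) = sin t * (h \<bullet> polar Q w s) - sin s * (h \<bullet> polar Q w t)"
      by (metis inner_diff_right inner_scaleR_right)
    moreover have "0 \<le> sin t * (h \<bullet> polar Q w s)" using tt ha by simp
    moreover have "sin s * (h \<bullet> polar Q w t) < 0" using ss hb by (simp add: mult_neg_pos)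
    ultimately have "0 < sin (t - s) * (h \<bullet> Q)" by linarith
    then show False using f(9) h(3) by (simp add: zero_less_mult_iff)
  qed
  have "t - s < pi"
  proof (rule ccontr)
    assume "\<not> t - s < pi"
    then have "0 \<le> sin (t - s - pi)" using f(3,6) by (intro sin_ge_zero) auto
    then show False using f(9) by (simp add: sin_diff)
  qed
  then show thesis using that f s0 st by auto
qed

text \<open>With \<open>Q\<close> in the direction of \<open>a\<close> the angle \<open>s\<close> is
  0, and the positive sine leaves \<open>t\<close> between 0 and \<open>pi\<close>.\<close>

lemma middle_edge_frame:
  fixes a b :: "real^3"
  assumes n0: "cross3 a b \<noteq> 0"
  obtains w t where "orthonormal_pair ((1 / norm a) *\<^sub>R a) w" "w \<bullet> cross3 a b = 0" "0 < t" "t < pi"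
    "b = norm b *\<^sub>R polar ((1 / norm a) *\<^sub>R a) w t"
proof -
  define Q where "Q = (1 / norm a) *\<^sub>R a"
  have a0: "a \<noteq> 0" using n0 by auto
  have Q: "norm Q = 1" "Q \<bullet> cross3 a b = 0" using a0 by (simp_all add: Q_def dot_cross_self)
  obtain w s t where f: "orthonormal_pair Q w" "w \<bullet> cross3 a b = 0" "0 \<le> s" "s < 2 * pi" "0 \<le> t" "t < 2 * pi"
    "a = norm a *\<^sub>R polar Q w s" "b = norm b *\<^sub>R polar Q w t" "0 < sin (t - s)"
    using plane_frame[OF n0 Q] by blast
  have "norm a *\<^sub>R polar Q w 0 = norm a *\<^sub>R polar Q w s"
    using f(7) a0 by (simp add: Q_def polar_def)
  then have "polar Q w s = polar Q w 0" using a0 by simp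
  then have "s = 0" using polar_eq_iff[OF f(1), of s 0] f(3,4) by simp
  then have "0 < sin t" using f(9) by simp
  then have "0 < t" "t < pi"
    using f(5,6) sin_le_zero[of t] by (force simp: not_less[symmetric], fastforce simp: not_less[symmetric])
  then show thesis using that f(1,2,8) by (simp add: Q_def)
qed

text \<open>Supplies the threshold \<open>s\<close> for \<open>twist_isotopy_map\<close>: two planes
  share the axis \<open>u\<close>, and points of one that keep away from this axis are steep to the
  other, so its twist fixes them. The bound is below 1 if the planes differ and \<open>m\<close> is
  positive.\<close>

lemma polar_tilted:
  assumes "orthonormal_pair u w" "orthonormal_pair u w'" "m \<le> (sin a)\<^sup>2"
  shows "(r *\<^sub>R polar u w a \<bullet> u)\<^sup>2 + (r *\<^sub>R polar u w a \<bullet> w')\<^sup>2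
    \<le> (1 - (1 - (w \<bullet> w')\<^sup>2) * m) * (norm (r *\<^sub>R polar u w a))\<^sup>2"
proof -
  define c where "c = w \<bullet> w'"
  have "\<bar>c\<bar> \<le> norm w * norm w'" unfolding c_def by (rule Cauchy_Schwarz_ineq2)
  then have "\<bar>c\<bar> \<le> 1" using assms(1,2) by (simp add: orthonormal_pair_def)
  then have c: "c\<^sup>2 \<le> 1" by (simp add: abs_square_le_1)
  have i: "polar u w a \<bullet> u = cos a" "polar u w a \<bullet> w' = sin a * c"
    using orthonormal_pair_inner[OF assms(1)] orthonormal_pair_inner[OF assms(2)]
    by (simp_all add: polar_def inner_add_left c_def)
  have "(cos a)\<^sup>2 + (sin a * c)\<^sup>2 = 1 - (1 - c\<^sup>2) * (sin a)\<^sup>2"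
    by (simp add: power_mult_distrib cos_squared_eq algebra_simps)
  also have "\<dots> \<le> 1 - (1 - c\<^sup>2) * m"
    using assms(3) c by (simp add: mult_left_mono)
  finally have "r\<^sup>2 * ((cos a)\<^sup>2 + (sin a * c)\<^sup>2) \<le> r\<^sup>2 * (1 - (1 - c\<^sup>2) * m)"
    by (rule mult_left_mono) simp
  then show ?thesis
    by (simp add: i norm_polar[OF assms(1)] power_mult_distrib distrib_left mult.commute flip: c_def)
qed

text \<open>Both ends have component at least \<open>R\<close> in the direction at \<open>b\<close>:
  the angle \<open>pi / 3\<close> halves the component of the far end at most, and
  \<open>A / 2\<close> is still at least \<open>R\<close>.\<close>

lemma segment_norm_ge:
  assumes uw: "orthonormal_pair u w" and R: "0 < R" "R \<le> A / 2" and ab: "b \<le> a" "a - b \<le> pi / 3"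
    and z: "z \<in> closed_segment (R *\<^sub>R polar u w b) (A *\<^sub>R polar u w a)"
  shows "R \<le> norm z"
proof -
  obtain t where t: "0 \<le> t" "t \<le> 1" "z = (1 - t) *\<^sub>R (R *\<^sub>R polar u w b) + t *\<^sub>R (A *\<^sub>R polar u w a)"
    using z by (rule closed_segmentE)
  have "cos (pi / 3) \<le> cos (a - b)" using ab by (intro cos_monotone_0_pi_le) auto
  then have c: "1 / 2 \<le> cos (a - b)" by (simp add: cos_60)
  have pp: "polar u w a \<bullet> polar u w b = cos (a - b)" for a b
    using orthonormal_pair_inner[OF uw]
    by (simp add: polar_def inner_add_left inner_add_right cos_diff)
  have "R \<le> A * cos (a - b)"
  proof -
    have "A * (1 / 2) \<le> A * cos (a - b)" using R by (intro mult_left_mono c) simp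
    then show ?thesis using R(2) by linarith
  qed
  then have "t * R \<le> t * (A * cos (a - b))" using t(1) by (rule mult_left_mono)
  then have "R \<le> (1 - t) * R + t * (A * cos (a - b))" by (simp add: algebra_simps)
  also have "\<dots> = z \<bullet> polar u w b"
    unfolding t(3) inner_add_left inner_scaleR_left pp by simp
  also have "\<dots> \<le> norm z * norm (polar u w b)" by (rule norm_cauchy_schwarz)
  finally show ?thesis by (simp add: norm_polar[OF uw])
qed

text \<open>\<open>G\<close> turns a radial strand into three radial graphs. Up to radius
  \<open>rho\<close> the strand has angle \<open>k\<close>, and pushing its tip to
  \<open>rho / 2\<close> on the axis makes it a segment over the angles from 0 to \<open>k\<close>.
  From \<open>rho\<close> to \<open>R\<close> it winds from \<open>k\<close> to \<open>b\<close>.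
  The last piece is the straight segment over the angles from \<open>b\<close> to
  \<open>a\<close>.\<close>

lemma strand_lift:
  assumes uw: "orthonormal_pair u w" and rho: "0 < rho" "rho < R" and k: "0 < k" "k < pi" "k < b"
    and ab: "b < a" "a < b + pi" and A: "0 < A"
    and G1: "\<And>r. 0 \<le> r \<Longrightarrow> r \<le> R \<Longrightarrow> G (r *\<^sub>R polar u w b) =
      r *\<^sub>R polar u w (k + (b - k) * clamp ((r - rho) / (R - rho))) + max 0 (1 - r / rho) *\<^sub>R ((rho / 2) *\<^sub>R u)"
    and G2: "\<And>z. z \<in> closed_segment (R *\<^sub>R polar u w b) (A *\<^sub>R polar u w a) \<Longrightarrow> G z = z"
  shows "radial_graph u w 0 a (G ` (closed_segment 0 (R *\<^sub>R polar u w b) \<union>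
    closed_segment (R *\<^sub>R polar u w b) (A *\<^sub>R polar u w a))) ((rho / 2) *\<^sub>R u) (A *\<^sub>R polar u w a)"
proof -
  have R0: "0 < R" using rho by simp
  have seg: "closed_segment 0 (R *\<^sub>R polar u w b) = (\<lambda>r. r *\<^sub>R polar u w b) ` {0..R}"
  proof -
    have "closed_segment 0 (R *\<^sub>R polar u w b) = (\<lambda>r. r *\<^sub>R polar u w b) ` (\<lambda>t. t * R) ` {0..1}"
      by (simp add: closed_segment_image_interval image_image)
    also have "(\<lambda>t. t * R) ` {0..1} = {0..R}"
    proof (intro equalityI subsetI)
      fix r assume "r \<in> {0..R}"
      then have "r / R \<in> {0..1}" "r = r / R * R" using R0 by simp_all
      then show "r \<in> (\<lambda>t. t * R) ` {0..1}" by blast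
    qed (use R0 in \<open>auto intro: mult_left_le_one_le\<close>)
    finally show ?thesis .
  qed
  have inner: "G ` (\<lambda>r. r *\<^sub>R polar u w b) ` {0..rho} = closed_segment ((rho / 2) *\<^sub>R polar u w 0) (rho *\<^sub>R polar u w k)"
  proof -
    have "G (r *\<^sub>R polar u w b) = (1 - r / rho) *\<^sub>R ((rho / 2) *\<^sub>R polar u w 0) + (r / rho) *\<^sub>R (rho *\<^sub>R polar u w k)"
      if r: "r \<in> {0..rho}" for r
    proof -
      have "(r - rho) / (R - rho) \<le> 0" using r rho by (simp add: divide_le_0_iff)
      then have c: "clamp ((r - rho) / (R - rho)) = 0" by linarith
      have d: "max 0 (1 - r / rho) = 1 - r / rho" using r rho by simp
      show ?thesis
        using G1[of r] r rho unfolding c d by (simp add: polar_def)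
    qed
    then have "G ` (\<lambda>r. r *\<^sub>R polar u w b) ` {0..rho} =
      (\<lambda>t. (1 - t) *\<^sub>R ((rho / 2) *\<^sub>R polar u w 0) + t *\<^sub>R (rho *\<^sub>R polar u w k)) ` (\<lambda>r. r / rho) ` {0..rho}"
      unfolding image_image by (intro image_cong) auto
    also have "(\<lambda>r. r / rho) ` {0..rho} = {0..1}"
      using rho(1) by (simp add: image_divide_atLeastAtMost)
    finally show ?thesis by (simp add: closed_segment_image_interval)
  qed
  \<comment> \<open>The radius as a function of the angle, inverse to the linear winding.\<close>
  define q where "q t = rho + (t - k) * (R - rho) / (b - k)" for t
  have outer: "G ` (\<lambda>r. r *\<^sub>R polar u w b) ` {rho..R} = (\<lambda>t. q t *\<^sub>R polar u w t) ` {k..b}"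
  proof -
    have "G (r *\<^sub>R polar u w b) = r *\<^sub>R polar u w (k + (b - k) * ((r - rho) / (R - rho)))"
      if r: "r \<in> {rho..R}" for r
    proof -
      have "0 \<le> (r - rho) / (R - rho)" "(r - rho) / (R - rho) \<le> 1" using r rho by simp_all
      then have c: "clamp ((r - rho) / (R - rho)) = (r - rho) / (R - rho)" by linarith
      have d: "max 0 (1 - r / rho) = 0" using r rho by simp
      show ?thesis
        using G1[of r] r rho unfolding c d by simp
    qed
    moreover have "q (k + (b - k) * ((r - rho) / (R - rho))) = r" for r
      using rho k by (simp add: q_def)
    ultimately have "G ` (\<lambda>r. r *\<^sub>R polar u w b) ` {rho..R} =
      (\<lambda>t. q t *\<^sub>R polar u w t) ` (\<lambda>r. k + (b - k) * ((r - rho) / (R - rho))) ` {rho..R}"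
      unfolding image_image by (intro image_cong) auto
    also have "(\<lambda>r. k + (b - k) * ((r - rho) / (R - rho))) ` {rho..R} = {k..b}"
    proof (intro equalityI subsetI)
      fix t assume t: "t \<in> {k..b}"
      have "q t \<in> {rho..R}"
      proof -
        have "0 \<le> (t - k) / (b - k)" "(t - k) / (b - k) \<le> 1" using t k by simp_all
        then have "0 \<le> (t - k) / (b - k) * (R - rho) \<and> (t - k) / (b - k) * (R - rho) \<le> 1 * (R - rho)"
          using rho by (intro conjI mult_right_mono mult_nonneg_nonneg) auto
        then show ?thesis by (simp add: q_def)
      qed
      moreover have "t = k + (b - k) * ((q t - rho) / (R - rho))" using rho k by (simp add: q_def)
      ultimately show "t \<in> (\<lambda>r. k + (b - k) * ((r - rho) / (R - rho))) ` {rho..R}" by blast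
    next
      fix t assume "t \<in> (\<lambda>r. k + (b - k) * ((r - rho) / (R - rho))) ` {rho..R}"
      then obtain r where r: "r \<in> {rho..R}" "t = k + (b - k) * ((r - rho) / (R - rho))" by blast
      have "0 \<le> (r - rho) / (R - rho)" "(r - rho) / (R - rho) \<le> 1" using r(1) rho by simp_all
      then have "0 \<le> (b - k) * ((r - rho) / (R - rho)) \<and> (b - k) * ((r - rho) / (R - rho)) \<le> (b - k) * 1"
        using k(3) by (intro conjI mult_left_mono mult_nonneg_nonneg) auto
      then show "t \<in> {k..b}" using r(2) by simp
    qed
    finally show ?thesis .
  qed
  have "radial_graph u w 0 k (G ` (\<lambda>r. r *\<^sub>R polar u w b) ` {0..rho})
      ((rho / 2) *\<^sub>R polar u w 0) (rho *\<^sub>R polar u w k)"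
    unfolding inner using rho k by (intro radial_graph_segment) auto
  moreover have "radial_graph u w k b (G ` (\<lambda>r. r *\<^sub>R polar u w b) ` {rho..R})
      (rho *\<^sub>R polar u w k) (R *\<^sub>R polar u w b)"
    unfolding radial_graph_def outer
  proof (intro exI[of _ q] conjI ballI)
    show "continuous_on {k..b} q" unfolding q_def using k by (intro continuous_intros) auto
    show "0 < q t" if "t \<in> {k..b}" for t
    proof -
      have "0 \<le> (t - k) * (R - rho) / (b - k)" using that k rho by simp
      then show ?thesis using rho(1) by (simp add: q_def)
    qed
    show "q k *\<^sub>R polar u w k = rho *\<^sub>R polar u w k" "q b *\<^sub>R polar u w b = R *\<^sub>R polar u w b"
      using k by (simp_all add: q_def)
  qed simp
  ultimately have "radial_graph u w 0 b
      (G ` (\<lambda>r. r *\<^sub>R polar u w b) ` {0..rho} \<union> G ` (\<lambda>r. r *\<^sub>R polar u w b) ` {rho..R})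
      ((rho / 2) *\<^sub>R polar u w 0) (R *\<^sub>R polar u w b)"
    using k uw by (intro radial_graph_union) auto
  moreover have "{0..R} = {0..rho} \<union> {rho..R}" using rho by auto
  ultimately have "radial_graph u w 0 b (G ` closed_segment 0 (R *\<^sub>R polar u w b))
      ((rho / 2) *\<^sub>R polar u w 0) (R *\<^sub>R polar u w b)"
    unfolding seg by (simp add: image_Un)
  moreover have "G ` closed_segment (R *\<^sub>R polar u w b) (A *\<^sub>R polar u w a) = closed_segment (R *\<^sub>R polar u w b) (A *\<^sub>R polar u w a)"
    using G2 by force
  then have "radial_graph u w b a (G ` closed_segment (R *\<^sub>R polar u w b) (A *\<^sub>R polar u w a))
      (R *\<^sub>R polar u w b) (A *\<^sub>R polar u w a)"
    using radial_graph_segment[OF ab R0 A] by simp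
  ultimately show ?thesis
    unfolding image_Un using k ab uw radial_graph_union[of u w 0 b _ "(rho / 2) *\<^sub>R u"] by simp
qed

lemma polar_continuous: "isCont (polar u w) a"
  unfolding polar_def by (intro continuous_intros)

text \<open>Before twisting, each strand is bent at a new vertex so that its inner part leaves the
  origin at an angle \<open>b0\<close> or \<open>b1\<close> slightly below \<open>a0\<close> or
  \<open>a1\<close>. Thus the outer part already sweeps an interval of angles, and the twist only
  has to unwind the inner part from \<open>b0\<close> or \<open>b1\<close> down to
  \<open>k\<close>.\<close>

lemma lift_isotopy:
  fixes p :: "nat \<Rightarrow> real^3"
  assumes emb: "embedded_graph E p" and e0: "(0, i0) \<in> E" and e1: "(0, i1) \<in> E" and i01: "i0 \<noteq> i1"
    and p0: "p 0 = 0" and off: "\<And>e. e \<in> E - {(0, i0), (0, i1)} \<Longrightarrow> 0 \<notin> edge_set p e"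
    and f0: "orthonormal_pair Q w0" and f1: "orthonormal_pair Q w1" and indep: "\<bar>w0 \<bullet> w1\<bar> < 1"
    and a0: "0 < a0" "a0 < 2 * pi" "sin a0 \<noteq> 0" and a1: "0 < a1" "a1 < 2 * pi"
    and A0: "0 < A0" "p i0 = A0 *\<^sub>R polar Q w0 a0" and A1: "0 < A1" "p i1 = A1 *\<^sub>R polar Q w1 a1"
  obtains g d where "isotopy_map g" "g 0 = d"
    "\<And>e z. e \<in> E - {(0, i0), (0, i1)} \<Longrightarrow> z \<in> edge_set p e \<Longrightarrow> g z = z"
    "radial_graph Q w0 0 a0 (g ` edge_set p (0, i0)) d (p i0)"
    "radial_graph Q w1 0 a1 (g ` edge_set p (0, i1)) d (p i1)"
proof -
  define E' where "E' = E - {(0, i0), (0, i1)}"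
  have finE: "finite E" using emb by (simp add: embedded_graph_def)
  define S where "S = (\<Union>e\<in>E'. edge_set p e)"
  have finE': "finite E'" using finE by (simp add: E'_def)
  have "closed S"
    unfolding S_def edge_set_def by (intro closed_UN finE' ballI closed_segment)
  moreover have "0 \<notin> S" unfolding S_def using off[folded E'_def] by (simp only: UN_iff) blast
  ultimately obtain d0 where d0: "0 < d0" "\<And>z. z \<in> S \<Longrightarrow> d0 \<le> dist 0 z"
    using separate_point_closed[of S 0] by auto
  have far: "d0 \<le> norm z" if "e \<in> E'" "z \<in> edge_set p e" for e z
    using d0(2)[of z] that unfolding S_def by (simp only: UN_iff dist_0_norm) blast
  \<comment> \<open>\<open>T1\<close> twists the second strand inside radius \<open>R\<close>, then \<open>T2\<close> twists the first strand inside \<open>R0\<close>.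
    \<open>R0\<close> is small enough that within it the second strand makes an angle in \<open>[k, pi - k]\<close> with \<open>Q\<close>,
    so it stays away from the plane of \<open>T2\<close>.\<close>
  define R where "R = min d0 (min (A0 / 2) (A1 / 2))"
  \<comment> \<open>At radius \<open>R0\<close> the second strand has made at most
    \<open>(R0 - rho) / (R - rho) = 1 / 4\<close> of its winding, so it is at most a right angle
    past \<open>k\<close>; the bound \<open>k \<le> pi / 4\<close> then keeps it below
    \<open>pi - k\<close>.\<close>
  define rho where "rho = R / 5"
  define R0 where "R0 = 2 * rho"
  define k where "k = min (pi / 4) (min (a0 / 2) (a1 / 2))"
  have R: "0 < R" "R \<le> d0" "R \<le> A0 / 2" "R \<le> A1 / 2" using d0(1) A0(1) A1(1) by (auto simp: R_def)
  have rho: "0 < rho" "rho < R0" "R0 < R" "rho < R" "0 < R0" using R by (auto simp: rho_def R0_def)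
  have k: "0 < k" "k \<le> pi / 4" "k \<le> a0 / 2" "k \<le> a1 / 2" "k < pi"
    using a0 a1 pi_gt_zero by (auto simp: k_def)
  \<comment> \<open>Half of the value at \<open>a0\<close>, so that continuity gives
    \<open>m0\<close> as a lower bound on the whole interval from \<open>b0\<close> to
    \<open>a0\<close>.\<close>
  define m0 where "m0 = (sin a0)\<^sup>2 / 2"
  define m1 where "m1 = (sin k)\<^sup>2"
  have m: "0 < m0" "0 < m1"
    using a0(3) sin_gt_zero[of k] k by (simp_all add: m0_def m1_def)
  define s0 where "s0 = 1 - (1 - (w0 \<bullet> w1)\<^sup>2) * m0"
  define s1 where "s1 = 1 - (1 - (w1 \<bullet> w0)\<^sup>2) * m1"
  have ind2: "(w0 \<bullet> w1)\<^sup>2 < 1" using indep by (simp add: abs_square_less_1)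
  then have s01: "s0 < 1" "s1 < 1"
    using m by (simp_all add: s0_def s1_def inner_commute[of w1 w0])
  obtain k0 where k0: "k0 \<notin> fst ` E \<union> snd ` E"
    using ex_new_if_finite[OF infinite_UNIV_nat, of "fst ` E \<union> snd ` E"] finE by auto
  obtain k1 where k1: "k1 \<notin> insert k0 (fst ` E \<union> snd ` E)"
    using ex_new_if_finite[OF infinite_UNIV_nat, of "insert k0 (fst ` E \<union> snd ` E)"] finE by auto
  have kne: "k0 \<noteq> 0" "k0 \<noteq> i0" "k0 \<noteq> i1" "k1 \<noteq> 0" "k1 \<noteq> i0" "k1 \<noteq> i1" "k0 \<noteq> k1"
    using k0 k1 e0 e1 by force+
  define E1 where "E1 = insert (0, k0) (insert (k0, i0) (E - {(0, i0)}))"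
  define y0 where "y0 = R0 *\<^sub>R polar Q w0 a0"
  define y1 where "y1 = R *\<^sub>R polar Q w1 a1"
  have pol0: "polar Q w0 t \<noteq> 0" "polar Q w1 t \<noteq> 0" for t
    using norm_polar[OF f0, of t] norm_polar[OF f1, of t] by auto
  have on_ray: "r *\<^sub>R z \<in> open_segment 0 (A *\<^sub>R z)" if "0 < r" "r < A" "z \<noteq> 0" for r A and z :: "real^3"
  proof -
    have "r *\<^sub>R z = (1 - r / A) *\<^sub>R 0 + (r / A) *\<^sub>R (A *\<^sub>R z)" "0 < r / A" "r / A < 1"
      using that by simp_all
    then show ?thesis unfolding in_segment using that by (intro conjI exI[of _ "r / A"]) auto
  qed
  have y0: "y0 \<in> open_segment (p 0) (p i0)" and y1: "y1 \<in> open_segment (p 0) (p i1)"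
    unfolding y0_def y1_def p0 A0(2) A1(2) using R rho by (intro on_ray pol0; simp)+
  have emb1: "embedded_graph E1 (p(k0 := y0))"
    unfolding E1_def by (rule embedded_graph_subdivide[OF emb e0 k0 y0])
  have e1': "(0, i1) \<in> E1" using e1 i01 by (simp add: E1_def)
  have V1: "fst ` E1 \<union> snd ` E1 \<subseteq> insert k0 (fst ` E \<union> snd ` E)"
    using e0 by (force simp: E1_def)
  have k1': "k1 \<notin> fst ` E1 \<union> snd ` E1" using k1 V1 by blast
  define E2 where "E2 = insert (0, k1) (insert (k1, i1) (E1 - {(0, i1)}))"
  define p2 where "p2 = p(k0 := y0, k1 := y1)"
  have "y1 \<in> open_segment ((p(k0 := y0)) 0) ((p(k0 := y0)) i1)" using y1 kne by simp
  then have emb2: "embedded_graph E2 p2"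
    unfolding E2_def p2_def by (rule embedded_graph_subdivide[OF emb1 e1' k1'])
  obtain e where e: "e > 0" "\<And>p'. (\<And>i. i \<in> fst ` E2 \<union> snd ` E2 \<Longrightarrow> norm (p' i - p2 i) < e) \<Longrightarrow>
    \<exists>g. isotopy_map g \<and> (\<forall>i j. \<forall>t\<in>{0..1}. (i, j) \<in> E2 \<longrightarrow>
      g (edge_point p2 i j t) = edge_point p' i j t)"
    using embedded_graph_perturb[OF emb2] by blast
  have near: "\<exists>d>0. \<forall>t. \<bar>t - a\<bar> < d \<longrightarrow> norm (r *\<^sub>R polar Q w t - r *\<^sub>R polar Q w a) < e" if "0 < r" for w a r
  proof -
    have "isCont (\<lambda>t. r *\<^sub>R polar Q w t) a" by (intro continuous_intros polar_continuous)
    then show ?thesis using e(1) unfolding continuous_at_eps_delta dist_norm by simp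
  qed
  obtain d1 where d1: "0 < d1" "\<And>t. \<bar>t - a0\<bar> < d1 \<Longrightarrow> norm (R0 *\<^sub>R polar Q w0 t - R0 *\<^sub>R polar Q w0 a0) < e"
    using near[OF rho(5), of a0 w0] by blast
  obtain d2 where d2: "0 < d2" "\<And>t. \<bar>t - a1\<bar> < d2 \<Longrightarrow> norm (R *\<^sub>R polar Q w1 t - R *\<^sub>R polar Q w1 a1) < e"
    using near[OF R(1), of a1 w1] by blast
  have "isCont (\<lambda>t. (sin t)\<^sup>2) a0" by (intro continuous_intros)
  then obtain d3 where d3: "0 < d3" "\<And>t. \<bar>t - a0\<bar> < d3 \<Longrightarrow> \<bar>(sin t)\<^sup>2 - (sin a0)\<^sup>2\<bar> < m0"
    unfolding continuous_at_eps_delta dist_real_def using m(1) by blast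
  \<comment> \<open>\<open>d1\<close> keeps the move of the new vertex admissible, \<open>d3\<close>
    the sine bound; \<open>a0 / 4\<close> keeps \<open>b0\<close> above
    \<open>k \<le> a0 / 2\<close>, and \<open>pi / 3\<close> is the angle for
    \<open>segment_norm_ge\<close>.\<close>
  define h0 where "h0 = min (min (d1 / 2) (d3 / 2)) (min (a0 / 4) (pi / 3))"
  define h1 where "h1 = min (d2 / 2) (min (a1 / 4) (pi / 3))"
  have h0: "0 < h0" "h0 < d1" "h0 < d3" "h0 \<le> a0 / 4" "h0 \<le> pi / 3"
    using d1(1) d3(1) a0 pi_gt_zero by (auto simp: h0_def)
  have h1: "0 < h1" "h1 < d2" "h1 \<le> a1 / 4" "h1 \<le> pi / 3"
    using d2(1) a1 pi_gt_zero by (auto simp: h1_def)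
  define b0 where "b0 = a0 - h0"
  define b1 where "b1 = a1 - h1"
  have b0: "k < b0" "b0 < a0" "a0 < b0 + pi" "a0 - b0 \<le> pi / 3"
    using h0 k a0 pi_gt_zero unfolding b0_def by linarith+
  have b1: "k < b1" "b1 < a1" "a1 < b1 + pi" "a1 - b1 \<le> pi / 3"
    using h1 k a1 pi_gt_zero unfolding b1_def by linarith+
  have sin0: "m0 \<le> (sin t)\<^sup>2" if "t \<in> {b0..a0}" for t
  proof -
    have "\<bar>t - a0\<bar> < d3" using that h0(3) by (auto simp: b0_def)
    then have "\<bar>(sin t)\<^sup>2 - (sin a0)\<^sup>2\<bar> < m0" by (rule d3(2))
    then show ?thesis unfolding m0_def by linarith
  qed
  define z0 where "z0 = R0 *\<^sub>R polar Q w0 b0"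
  define z1 where "z1 = R *\<^sub>R polar Q w1 b1"
  define p' where "p' = p(k0 := z0, k1 := z1)"
  have "norm (p' i - p2 i) < e" for i
    using e(1) d1(2)[of b0] d2(2)[of b1] h0 h1
    by (auto simp: p'_def p2_def z0_def z1_def y0_def y1_def b0_def b1_def)
  from e(2)[of p', OF this] obtain g1 where g1': "isotopy_map g1 \<and> (\<forall>i j. \<forall>t\<in>{0..1}. (i, j) \<in> E2 \<longrightarrow>
      g1 (edge_point p2 i j t) = edge_point p' i j t)" ..
  then have g1: "isotopy_map g1" and g1E: "\<And>i j t. t \<in> {0..1} \<Longrightarrow> (i, j) \<in> E2 \<Longrightarrow>
      g1 (edge_point p2 i j t) = edge_point p' i j t" by simp_all
  have g1seg: "g1 ` closed_segment (p2 i) (p2 j) = closed_segment (p' i) (p' j)" if "(i, j) \<in> E2" for i j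
    by (rule closed_segment_image_affine) (rule g1E[OF _ that])
  have E'E2: "e \<in> E2" if "e \<in> E'" for e using that by (auto simp: E'_def E2_def E1_def)
  have E'k: "fst e \<noteq> k0" "snd e \<noteq> k0" "fst e \<noteq> k1" "snd e \<noteq> k1" if "e \<in> E'" for e
    using that k0 k1 unfolding E'_def by force+
  have g1_far: "g1 z = z" if e: "e \<in> E'" and z: "z \<in> edge_set p e" for e z
  proof -
    obtain t where t: "0 \<le> t" "t \<le> 1" "z = (1 - t) *\<^sub>R p (fst e) + t *\<^sub>R p (snd e)"
      using z unfolding edge_set_def by (rule closed_segmentE)
    show ?thesis using g1E[of t "fst e" "snd e"] E'E2[OF e] E'k[OF e] t by (simp add: p2_def p'_def)
  qed
  have E2_edges: "(0, k0) \<in> E2" "(k0, i0) \<in> E2" "(0, k1) \<in> E2" "(k1, i1) \<in> E2"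
    using kne by (auto simp: E2_def E1_def)
  have g1_0: "g1 0 = 0" using g1E[of 0, OF _ E2_edges(1)] kne p0 by (simp add: p2_def p'_def)
  have split: "edge_set p (0, i) = closed_segment 0 y \<union> closed_segment y (p i)"
    if "y \<in> open_segment (p 0) (p i)" for y i
    using Un_closed_segment[of y "p 0" "p i"] that p0 by (simp add: edge_set_def open_segment_def)
  have seg0: "g1 ` edge_set p (0, i0) = closed_segment 0 z0 \<union> closed_segment z0 (p i0)"
    unfolding split[OF y0] using g1seg[OF E2_edges(1)] g1seg[OF E2_edges(2)] kne p0
    by (simp add: image_Un p2_def p'_def)
  have seg1: "g1 ` edge_set p (0, i1) = closed_segment 0 z1 \<union> closed_segment z1 (p i1)"
    unfolding split[OF y1] using g1seg[OF E2_edges(3)] g1seg[OF E2_edges(4)] kne p0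
    by (simp add: image_Un p2_def p'_def)
  obtain T1 where T1: "isotopy_map T1" and T1_far: "\<And>x. R \<le> norm x \<Longrightarrow> T1 x = x"
    and T1_tilt: "\<And>x. (x \<bullet> Q)\<^sup>2 + (x \<bullet> w1)\<^sup>2 \<le> s0 * (norm x)\<^sup>2 \<Longrightarrow> T1 x = x"
    and T1_polar: "\<And>r a. 0 \<le> r \<Longrightarrow> T1 (r *\<^sub>R polar Q w1 a) =
       r *\<^sub>R polar Q w1 (a + - (b1 - k) * clamp ((R - r) / (R - rho)))"
    by (rule twist_isotopy_map[OF f1 s01(1) rho(4), where b = "- (b1 - k)"]) (rule that)
  obtain T2 where T2: "isotopy_map T2" and T2_far: "\<And>x. R0 \<le> norm x \<Longrightarrow> T2 x = x"
    and T2_tilt: "\<And>x. (x \<bullet> Q)\<^sup>2 + (x \<bullet> w0)\<^sup>2 \<le> s1 * (norm x)\<^sup>2 \<Longrightarrow> T2 x = x"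
    and T2_polar: "\<And>r a. 0 \<le> r \<Longrightarrow> T2 (r *\<^sub>R polar Q w0 a) =
       r *\<^sub>R polar Q w0 (a + - (b0 - k) * clamp ((R0 - r) / (R0 - rho)))"
    by (rule twist_isotopy_map[OF f0 s01(2) rho(2), where b = "- (b0 - k)"]) (rule that)
  define d where "d = (rho / 2) *\<^sub>R Q"
  define W where "W x = x + max 0 (1 - norm x / rho) *\<^sub>R d" for x
  have Q1: "norm Q = 1" using f0 by (simp add: orthonormal_pair_def)
  have W: "isotopy_map W"
    unfolding W_def using rho(1) Q1 by (intro hat_isotopy_map) (simp_all add: d_def)
  have W_far: "W x = x" if "rho \<le> norm x" for x
    using that rho(1) by (simp add: W_def)
  define G where "G = W \<circ> (T2 \<circ> T1)"
  have G: "isotopy_map G" unfolding G_def by (intro isotopy_map_comp T1 T2 W)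
  have G_far: "G x = x" if "R \<le> norm x" for x
    using that T1_far T2_far W_far rho by (simp add: G_def)
  \<comment> \<open>The twists fade as the radius grows, whereas \<open>strand_lift\<close>
    describes the winding as growing with it.\<close>
  have flip: "clamp ((S - r) / (S - rho)) = 1 - clamp ((r - rho) / (S - rho))"
    if "rho < S" for S r
  proof -
    have "(S - r) / (S - rho) = 1 - (r - rho) / (S - rho)" using that by (simp add: field_simps)
    then show ?thesis by linarith
  qed
  have reparam: "b + - (b - k) * clamp ((S - r) / (S - rho))
      = k + (b - k) * clamp ((r - rho) / (S - rho))" if "rho < S" for S r b
    unfolding flip[OF that] by (simp add: algebra_simps)
  \<comment> \<open>At these angles the first strand is away from the common axis \<open>Q\<close>,
    hence steep to the plane of \<open>T1\<close>.\<close>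
  have T1_strand0: "T1 (r *\<^sub>R polar Q w0 t) = r *\<^sub>R polar Q w0 t" if "t \<in> {b0..a0}" for r t
    by (rule T1_tilt) (use polar_tilted[OF f0 f1 sin0[OF that]] in \<open>simp add: s0_def\<close>)
  have G_strand0: "G (r *\<^sub>R polar Q w0 b0) =
      r *\<^sub>R polar Q w0 (k + (b0 - k) * clamp ((r - rho) / (R0 - rho))) + max 0 (1 - r / rho) *\<^sub>R ((rho / 2) *\<^sub>R Q)"
    if "0 \<le> r" for r
    using T1_strand0[of b0 r] T2_polar[OF that, of b0] b0 that
    unfolding reparam[OF rho(2)] by (simp add: G_def W_def d_def norm_polar[OF f0])
  have G_seg0: "G z = z" if z: "z \<in> closed_segment (R0 *\<^sub>R polar Q w0 b0) (A0 *\<^sub>R polar Q w0 a0)" for z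
  proof -
    have "R0 \<le> norm z" using segment_norm_ge[OF f0 rho(5) _ _ b0(4) z] rho R b0 by simp
    moreover obtain q where "z \<in> (\<lambda>t. q t *\<^sub>R polar Q w0 t) ` {b0..a0}"
      using radial_graph_segment[OF b0(2,3) rho(5) A0(1), of Q w0] z unfolding radial_graph_def
      by (elim exE conjE) blast
    then have "T1 z = z" using T1_strand0 by (elim imageE) simp
    ultimately show ?thesis using T2_far W_far rho by (simp add: G_def)
  qed
  have T2_strand1: "T2 (r *\<^sub>R polar Q w1 t) = r *\<^sub>R polar Q w1 t" if "t \<in> {k..pi - k}" for r t
  proof (rule T2_tilt)
    have "sin k \<le> sin t"
    proof (cases "t \<le> pi / 2")
      case True
      then show ?thesis using that k by (intro sin_monotone_2pi_le) auto
    next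
      case False
      then have "sin k \<le> sin (pi - t)" using that k by (intro sin_monotone_2pi_le) auto
      then show ?thesis by simp
    qed
    moreover have "0 \<le> sin k" using k by (intro sin_ge_zero) auto
    ultimately have "m1 \<le> (sin t)\<^sup>2" unfolding m1_def by (rule power_mono)
    then show "(r *\<^sub>R polar Q w1 t \<bullet> Q)\<^sup>2 + (r *\<^sub>R polar Q w1 t \<bullet> w0)\<^sup>2 \<le> s1 * (norm (r *\<^sub>R polar Q w1 t))\<^sup>2"
      using polar_tilted[OF f1 f0] by (simp add: s1_def)
  qed
  have G_strand1: "G (r *\<^sub>R polar Q w1 b1) =
      r *\<^sub>R polar Q w1 (k + (b1 - k) * clamp ((r - rho) / (R - rho))) + max 0 (1 - r / rho) *\<^sub>R ((rho / 2) *\<^sub>R Q)"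
    if r: "0 \<le> r" for r
  proof -
    define t where "t = k + (b1 - k) * clamp ((r - rho) / (R - rho))"
    have 1: "T1 (r *\<^sub>R polar Q w1 b1) = r *\<^sub>R polar Q w1 t"
      unfolding t_def T1_polar[OF r] reparam[OF rho(4)] ..
    have 2: "T2 (r *\<^sub>R polar Q w1 t) = r *\<^sub>R polar Q w1 t"
    proof (cases "R0 \<le> r")
      case True
      then show ?thesis using T2_far[of "r *\<^sub>R polar Q w1 t"] r by (simp add: norm_polar[OF f1])
    next
      case False
      have "(r - rho) / (R - rho) \<le> 1 / 4"
        using False rho by (simp add: R0_def rho_def field_simps)
      then have c: "0 \<le> clamp ((r - rho) / (R - rho))" "clamp ((r - rho) / (R - rho)) \<le> 1 / 4"
        by linarith+
      have "(b1 - k) * clamp ((r - rho) / (R - rho)) \<le> (2 * pi) * (1 / 4)"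
        using c b1 a1 k by (intro mult_mono) auto
      moreover have "0 \<le> (b1 - k) * clamp ((r - rho) / (R - rho))" using c(1) b1 by simp
      ultimately have "t \<in> {k..pi - k}" using k unfolding t_def by auto
      then show ?thesis by (rule T2_strand1)
    qed
    show ?thesis
      using 1 2 r by (simp add: G_def W_def d_def norm_polar[OF f1] flip: t_def)
  qed
  have G_seg1: "G z = z" if z: "z \<in> closed_segment (R *\<^sub>R polar Q w1 b1) (A1 *\<^sub>R polar Q w1 a1)" for z
    using segment_norm_ge[OF f1 R(1,4) _ b1(4) z] b1 by (intro G_far) simp
  define g where "g = G \<circ> g1"
  have "isotopy_map g" unfolding g_def by (rule isotopy_map_comp[OF g1 G])
  moreover have "g 0 = d"
    using G_strand1[of 0] rho(1) by (simp add: g_def g1_0 d_def)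
  moreover have "g z = z" if "e \<in> E - {(0, i0), (0, i1)}" "z \<in> edge_set p e" for e z
  proof -
    have e': "e \<in> E'" using that(1) by (simp add: E'_def)
    show ?thesis using g1_far[OF e' that(2)] far[OF e' that(2)] R(2) G_far by (simp add: g_def)
  qed
  moreover have "radial_graph Q w0 0 a0 (g ` edge_set p (0, i0)) d (p i0)"
    using strand_lift[OF f0 rho(1,2) k(1,5) b0(1-3) A0(1) G_strand0 G_seg0]
    by (simp only: g_def image_comp[symmetric] seg0 z0_def A0(2) d_def)
  moreover have "radial_graph Q w1 0 a1 (g ` edge_set p (0, i1)) d (p i1)"
    using strand_lift[OF f1 rho(1,4) k(1,5) b1(1-3) A1(1) G_strand1 G_seg1]
    by (simp only: g_def image_comp[symmetric] seg1 z1_def A1(2) d_def)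
  ultimately show thesis by (rule that)
qed

section \<open>Projection from an extreme vertex\<close>

lemma normalize_eq: "(y :: real^3) = r *\<^sub>R p \<Longrightarrow> r \<noteq> 0 \<Longrightarrow> (1 / r) *\<^sub>R y = p"
  by simp

text \<open>The assumption \<open>2 \<le> m\<close> makes the first arc 0 and the last arc
  \<open>l = m - 1\<close> distinct, so that their great circles differ and meet in a line, which
  leaves two candidates for \<open>Q\<close>.\<close>

lemma general_position_represents:
  fixes x :: "nat \<Rightarrow> real^3"
  assumes m: "2 \<le> m" and sk: "stick_knot (m + 2) (case_nat 0 x)"
    and gp: "general_position m x" and h: "\<And>i. i \<le> m \<Longrightarrow> 0 < h \<bullet> x i"
  shows "sph_represents m (stick_set (m + 2) (case_nat 0 x))"
proof -
  define n where "n = m + 2"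
  define v where "v = case_nat 0 x"
  have v0: "v 0 = 0" and vS: "\<And>i. v (Suc i) = x i" by (simp_all add: v_def)
  have sk: "stick_knot n v" using sk by (simp add: n_def v_def)
  define N where "N i = cross3 (x i) (x (Suc i))" for i
  have x0: "x i \<noteq> 0" if "i \<le> m" for i using h[OF that] by auto
  have N0: "N i \<noteq> 0" if "i < m" for i
    using general_position_pair[OF gp m, of i "Suc i"] that by (simp add: N_def)
  have triple: "N i \<bullet> x k \<noteq> 0" if "i < m" "k \<le> m" "k \<noteq> i" "k \<noteq> Suc i" for i k
    using general_position_triple[OF gp, of i "Suc i" k] that by (auto simp: N_def)
  have NN: "cross3 (N i) (N j) \<noteq> 0" if "i < m" "j < m" "i \<noteq> j" for i j
    using general_position_edge_pair[OF gp m that] by (simp add: N_def)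
  have NNN: "cross3 (N i) (N j) \<bullet> N k \<noteq> 0"
    if "i < m" "j < m" "k < m" "i \<noteq> j" "i \<noteq> k" "j \<noteq> k" for i j k
    using general_position_edges[OF gp m that] by (simp add: N_def)
  define l where "l = m - 1"
  have l: "l < m" "0 < l" "Suc l = m" using m by (auto simp: l_def)
  define P where "P = cross3 (N 0) (N l)"
  have P0: "P \<noteq> 0" unfolding P_def using NN l m by auto
  \<comment> \<open>The sign chooses the intersection point in the closed hemisphere where
    \<open>h\<close> is not positive.\<close>
  define Q where "Q = ((if h \<bullet> P \<le> 0 then 1 else - 1) / norm P) *\<^sub>R P"
  have Q: "norm Q = 1" using P0 by (simp add: Q_def)
  have hQ: "h \<bullet> Q \<le> 0" using P0 by (simp add: Q_def divide_le_0_iff)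
  have QN: "Q \<bullet> N 0 = 0" "Q \<bullet> N l = 0" by (simp_all add: Q_def P_def dot_cross_self)
  have QNi: "Q \<bullet> N i \<noteq> 0" if "i < m" "i \<noteq> 0" "i \<noteq> l" for i
    using NNN[of 0 l i] that l P0 by (simp add: Q_def P_def)
  have m0: "0 < m" using m by simp
  obtain w0 s0 t0 where f0: "orthonormal_pair Q w0" "w0 \<bullet> N 0 = 0" "0 < s0" "s0 < t0" "t0 < 2 * pi" "t0 < s0 + pi"
    "x 0 = norm (x 0) *\<^sub>R polar Q w0 s0" "x 1 = norm (x 1) *\<^sub>R polar Q w0 t0"
    using first_edge_frame[of "x 0" "x 1" Q h] N0[OF m0] Q QN(1) h[of 0] h[of 1] hQ m by (auto simp: N_def)
  \<comment> \<open>The last arc is read backwards, so that both prolonged arcs start at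
    \<open>Q\<close>; its normal only changes sign.\<close>
  have swap: "cross3 (x m) (x l) = - N l" unfolding N_def l(3) by (rule cross_skew)
  obtain w1 s1 t1 where f1: "orthonormal_pair Q w1" "w1 \<bullet> N l = 0" "0 < s1" "s1 < t1" "t1 < 2 * pi" "t1 < s1 + pi"
    "x m = norm (x m) *\<^sub>R polar Q w1 s1" "x l = norm (x l) *\<^sub>R polar Q w1 t1"
    using first_edge_frame[of "x m" "x l" Q h] N0[OF l(1)] Q QN(2) h[of m] h[of l] hQ l by (auto simp: swap)
  \<comment> \<open>Otherwise \<open>x 0\<close> would be on the line through \<open>Q\<close> and
    hence in the plane of stick \<open>l\<close>, which contains only \<open>x l\<close> and
    \<open>x m\<close>.\<close>
  have sin0: "sin s0 \<noteq> 0"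
  proof
    assume "sin s0 = 0"
    then have "x 0 = (norm (x 0) * cos s0) *\<^sub>R Q" by (subst f0(7)) (simp add: polar_def)
    then have "N l \<bullet> x 0 = (norm (x 0) * cos s0) * (N l \<bullet> Q)" by (metis inner_scaleR_right)
    then have "N l \<bullet> x 0 = 0" using QN(2) by (simp add: inner_commute)
    then show False using triple[of l 0] l by simp
  qed
  \<comment> \<open>If the two planes agreed, \<open>x m\<close> would lie in the plane of
    \<open>x 0\<close> and \<open>x 1\<close>.\<close>
  have indep: "\<bar>w0 \<bullet> w1\<bar> < 1"
  proof (rule ccontr)
    assume "\<not> \<bar>w0 \<bullet> w1\<bar> < 1"
    moreover have "\<bar>w0 \<bullet> w1\<bar> \<le> norm w0 * norm w1" by (rule Cauchy_Schwarz_ineq2)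
    ultimately have "\<bar>w0 \<bullet> w1\<bar> = norm w0 * norm w1" using f0(1) f1(1) by (simp add: orthonormal_pair_def)
    then have "norm w0 *\<^sub>R w1 = norm w1 *\<^sub>R w0 \<or> norm w0 *\<^sub>R w1 = - norm w1 *\<^sub>R w0"
      using norm_cauchy_schwarz_abs_eq by blast
    then have "w1 = w0 \<or> w1 = - w0" using f0(1) f1(1) by (simp add: orthonormal_pair_def)
    then have "w1 \<bullet> N 0 = 0" using f0(2) by auto
    then have "polar Q w1 s1 \<bullet> N 0 = 0" using QN(1) by (simp add: polar_def inner_add_left)
    then have "N 0 \<bullet> x m = 0" by (subst f1(7)) (simp add: inner_commute)
    then show False using triple[of 0 m] m by simp
  qed
  \<comment> \<open>The closing stick is turned around, so that both sticks at the origin start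
    there as \<open>lift_isotopy\<close> requires.\<close>
  define f where "f k = (if k = Suc m then (0, Suc m) else (k, Suc k mod n))" for k
  have fk: "f k = (k, Suc k mod n) \<or> f k = (Suc k mod n, k)" if "k < n" for k
    by (simp add: f_def n_def)
  define E where "E = f ` {..<n}"
  have emb: "embedded_graph E v" unfolding E_def by (rule stick_knot_graph[OF sk fk])
  have f_mid: "f (Suc i) = (Suc i, Suc (Suc i))" if "i < m" for i
    using that by (simp add: f_def n_def)
  have f_ends: "f 0 = (0, 1)" "f (Suc m) = (0, Suc m)" using m by (simp_all add: f_def n_def)
  have E: "(0, 1) \<in> E" "(0, Suc m) \<in> E" "\<And>i. i < m \<Longrightarrow> (Suc i, Suc (Suc i)) \<in> E"
  proof -
    have fE: "f k \<in> E" if "k < n" for k using that by (simp add: E_def)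
    show "(0, 1) \<in> E" "(0, Suc m) \<in> E" using fE[of 0] fE[of "Suc m"] f_ends by (simp_all add: n_def)
    show "(Suc i, Suc (Suc i)) \<in> E" if "i < m" for i
      using fE[of "Suc i"] f_mid[OF that] that by (simp add: n_def)
  qed
  have Emid: "\<exists>i<m. e = (Suc i, Suc (Suc i))" if e: "e \<in> E - {(0, 1), (0, Suc m)}" for e
  proof -
    obtain k where k: "k < n" "e = f k" using e by (auto simp: E_def)
    have "f k \<noteq> f 0" "f k \<noteq> f (Suc m)" using k(2) e f_ends by auto
    then have "k \<noteq> 0" "k \<noteq> Suc m" by metis+
    then have "k - 1 < m" "k = Suc (k - 1)" using k(1) by (auto simp: n_def)
    then show ?thesis using f_mid[of "k - 1"] k(2) by metis
  qed
  have off: "0 \<notin> edge_set v e" if e: "e \<in> E - {(0, 1), (0, Suc m)}" for e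
  proof
    assume "0 \<in> edge_set v e"
    obtain i where i: "i < m" "e = (Suc i, Suc (Suc i))" using Emid[OF e] by blast
    have "0 \<in> closed_segment (x i) (x (Suc i))"
      using \<open>0 \<in> edge_set v e\<close> by (simp add: i(2) edge_set_def vS)
    then obtain t where t: "0 \<le> t" "t \<le> 1" "0 = (1 - t) *\<^sub>R x i + t *\<^sub>R x (Suc i)"
      by (rule closed_segmentE)
    have hx: "0 < h \<bullet> x i" "0 < h \<bullet> x (Suc i)" using h i(1) by simp_all
    have "h \<bullet> ((1 - t) *\<^sub>R x i + t *\<^sub>R x (Suc i)) = (1 - t) * (h \<bullet> x i) + t * (h \<bullet> x (Suc i))"
      by (simp add: inner_add_right)
    also have "\<dots> > 0"
    proof (cases "t = 0")
      case False
      then show ?thesis using t hx by (intro add_nonneg_pos) auto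
    qed (use hx in simp)
    finally show False unfolding t(3)[symmetric] by simp
  qed
  have A: "0 < norm (x 0)" "v 1 = norm (x 0) *\<^sub>R polar Q w0 s0"
    "0 < norm (x m)" "v (Suc m) = norm (x m) *\<^sub>R polar Q w1 s1"
    using x0 f0(7) f1(7) vS[of 0] by (simp_all add: vS)
  have bounds: "s0 < 2 * pi" "s1 < 2 * pi" using f0 f1 by simp_all
  have "(1::nat) \<noteq> Suc m" using m by simp
  obtain g d where g: "isotopy_map g" and g0: "g 0 = d"
    and g_fix: "\<And>e z. e \<in> E - {(0, 1), (0, Suc m)} \<Longrightarrow> z \<in> edge_set v e \<Longrightarrow> g z = z"
    and lift0: "radial_graph Q w0 0 s0 (g ` edge_set v (0, 1)) d (v 1)"
    and lift1: "radial_graph Q w1 0 s1 (g ` edge_set v (0, Suc m)) d (v (Suc m))"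
    by (rule lift_isotopy[OF emb E(1,2) \<open>1 \<noteq> Suc m\<close> v0 off f0(1) f1(1) indep f0(3) bounds(1) sin0
        f1(3) bounds(2) A]) (assumption, rule that)
  define S where "S k = closed_segment (v k) (v (Suc k mod n))" for k
  have S_mid: "S (Suc i) = closed_segment (x i) (x (Suc i))" if "i < m" for i
    using that by (simp add: S_def vS n_def)
  have S_0: "S 0 = edge_set v (0, 1)" using m by (simp add: S_def edge_set_def n_def)
  have S_m: "S (Suc m) = edge_set v (0, Suc m)"
    by (simp add: S_def edge_set_def n_def closed_segment_commute)
  have gS: "g z = z" if "i < m" "z \<in> S (Suc i)" for i z
  proof (rule g_fix)
    show "(Suc i, Suc (Suc i)) \<in> E - {(0, 1), (0, Suc m)}" using E(3)[OF that(1)] by simp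
    show "z \<in> edge_set v (Suc i, Suc (Suc i))" using that S_mid by (simp add: edge_set_def vS)
  qed
  have gS_img: "g ` S (Suc i) = S (Suc i)" if "i < m" for i
  proof -
    have "g ` S (Suc i) = (\<lambda>z. z) ` S (Suc i)" by (rule image_cong) (simp_all add: gS[OF that])
    then show ?thesis by simp
  qed
  \<comment> \<open>The sticks carried by arc \<open>i\<close>. Stick \<open>Suc i\<close> joins
    \<open>x i\<close> to \<open>x (Suc i)\<close>; the two sticks at the origin, 0 and
    \<open>Suc m\<close>, are absorbed into arcs 0 and \<open>l\<close>.\<close>
  define K where "K i = insert (Suc i) ((if i = 0 then {0} else {}) \<union> (if i = l then {Suc m} else {}))" for i
  define A where "A i = g ` (\<Union>k\<in>K i. S k)" for i
  \<comment> \<open>The points above the corners. The old origin, now at \<open>d\<close> on the ray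
    through \<open>Q\<close>, replaces \<open>x 0\<close>; the vertices \<open>x 0\<close> and
    \<open>x m\<close> lie inside the prolonged arcs.\<close>
  define c where "c i = (if i = 0 then d else x i)" for i
  have K_n: "(\<Union>i<m. K i) = {..<n}"
  proof (intro equalityI subsetI)
    fix k assume k: "k \<in> {..<n}"
    show "k \<in> (\<Union>i<m. K i)"
    proof (cases k)
      case 0
      then have "k \<in> K 0" by (simp add: K_def)
      then show ?thesis using m0 by blast
    next
      case (Suc i)
      show ?thesis
      proof (cases "i < m")
        case True
        have "k \<in> K i" by (simp add: K_def Suc)
        then show ?thesis using True by blast
      next
        case False
        then have "i = m" using k Suc by (simp add: n_def)
        then have "k \<in> K l" by (simp add: K_def Suc)
        then show ?thesis using l(1) by blast
      qed
    qed
  next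
    fix k assume "k \<in> (\<Union>i<m. K i)"
    then obtain i where "i < m" "k \<in> K i" by blast
    then have "k = 0 \<or> k = Suc i \<or> k = Suc m" by (auto simp: K_def split: if_splits)
    then show "k \<in> {..<n}" using \<open>i < m\<close> by (auto simp: n_def)
  qed
  have K_disj: "K i \<inter> K j = {}" if "i < m" "j < m" "i \<noteq> j" for i j
    using that by (auto simp: K_def split: if_splits)
  have K_1: "i = 0" if "k \<in> K i" "i < m" "k \<in> {0, 1}" for i k
    using that m by (auto simp: K_def split: if_splits)
  have K_m: "i = l" if "k \<in> K i" "i < m" "k \<in> {m, Suc m}" for i k
    using that l by (auto simp: K_def split: if_splits)
  have disj: "A i \<inter> A j \<subseteq> c ` {..<m}" if ij: "i < m" "j < m" "i \<noteq> j" for i j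
  proof
    fix z assume "z \<in> A i \<inter> A j"
    then have "z \<in> g ` ((\<Union>k\<in>K i. S k) \<inter> (\<Union>k\<in>K j. S k))"
      unfolding A_def image_Int[OF isotopy_map_inj[OF g]] .
    then obtain y k k' where y: "z = g y" "k \<in> K i" "k' \<in> K j" "y \<in> S k" "y \<in> S k'" by blast
    have kn: "k < n" "k' < n" using y(2,3) K_n ij by blast+
    have "k \<noteq> k'" using K_disj[OF ij] y(2,3) by auto
    then have "y \<in> v ` ({k, Suc k mod n} \<inter> {k', Suc k' mod n})"
      using stick_knot_edges_meet[OF sk kn] y(4,5) by (auto simp: S_def)
    then obtain r where r: "r \<in> {k, Suc k mod n}" "r \<in> {k', Suc k' mod n}" "y = v r" by blast
    have rn: "r < n" using r(1) kn by (auto simp: n_def)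
    have next_index: "Suc q mod n = (if Suc q = n then 0 else Suc q)" if "q < n" for q
      using that by (simp add: mod_Suc)
    have pred1: "q = 0 \<or> q = 1" if "1 = q \<or> 1 = Suc q mod n" "q < n" for q
      using that(1) unfolding next_index[OF that(2)] by (auto split: if_splits)
    have predm: "q = m \<or> q = Suc m" if "Suc m = q \<or> Suc m = Suc q mod n" "q < n" for q
      using that(1) unfolding next_index[OF that(2)] by (auto split: if_splits)
    \<comment> \<open>Both sticks at \<open>v 1\<close> belong to arc 0 and both sticks at
      \<open>v (Suc m)\<close> to arc \<open>l\<close>, so different arcs cannot meet there; every
      other vertex is above a corner.\<close>
    have "r \<noteq> 1"
    proof
      assume "r = 1"
      then have "k \<in> {0, 1}" "k' \<in> {0, 1}" using r(1,2) pred1[OF _ kn(1)] pred1[OF _ kn(2)] by simp_all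
      then have "i = 0" "j = 0" using K_1[OF y(2) ij(1)] K_1[OF y(3) ij(2)] by simp_all
      then show False using ij(3) by simp
    qed
    have "r \<noteq> Suc m"
    proof
      assume "r = Suc m"
      then have "k \<in> {m, Suc m}" "k' \<in> {m, Suc m}" using r(1,2) predm[OF _ kn(1)] predm[OF _ kn(2)] by simp_all
      then have "i = l" "j = l" using K_m[OF y(2) ij(1)] K_m[OF y(3) ij(2)] by simp_all
      then show False using ij(3) by simp
    qed
    show "z \<in> c ` {..<m}"
    proof (cases r)
      case 0
      then have "z = c 0" using y(1) r(3) v0 g0 by (simp add: c_def)
      then show ?thesis using m0 by blast
    next
      case (Suc q)
      then have q: "0 < q" "q < m" using \<open>r \<noteq> 1\<close> \<open>r \<noteq> Suc m\<close> rn by (auto simp: n_def)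
      have "y = x q" using r(3) Suc vS by simp
      then have "y \<in> S (Suc q)" using S_mid[OF q(2)] by simp
      then have "z = c q" using gS[OF q(2)] y(1) \<open>y = x q\<close> q(1) by (simp add: c_def)
      then show ?thesis using q(2) by blast
    qed
  qed
  define dir where "dir i = (1 / norm (x i)) *\<^sub>R x i" for i
  let ?mid = "\<lambda>i w t. i < m \<longrightarrow> orthonormal_pair (dir i) w \<and> w \<bullet> N i = 0 \<and> 0 < t \<and> t < pi \<and>
      x (Suc i) = norm (x (Suc i)) *\<^sub>R polar (dir i) w t"
  have "\<exists>w t. ?mid i w t" for i
  proof (cases "i < m")
    case True
    obtain w t where "orthonormal_pair (dir i) w" "w \<bullet> N i = 0" "0 < t" "t < pi"
      "x (Suc i) = norm (x (Suc i)) *\<^sub>R polar (dir i) w t"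
      using middle_edge_frame[of "x i" "x (Suc i)"] N0[OF True] unfolding N_def dir_def by blast
    then show ?thesis by blast
  qed blast
  from choice[OF allI, OF this] obtain wm where "\<forall>i. \<exists>t. ?mid i (wm i) t" ..
  from choice[OF this] obtain tm where mid: "\<forall>i. ?mid i (wm i) (tm i)" ..
  define u where "u i = (if i = 0 then Q else dir i)" for i
  \<comment> \<open>The last arc runs from \<open>x l\<close> to \<open>Q\<close>, against its frame
    \<open>Q\<close>, \<open>w1\<close>, so it gets the reversed frame of
    \<open>radial_graph_reverse\<close>.\<close>
  define w where "w i = (if i = 0 then w0 else if i = l then sin t1 *\<^sub>R Q - cos t1 *\<^sub>R w1 else wm i)" for i
  define th where "th i = (if i = 0 then t0 else if i = l then t1 else tm i)" for i
  have ul: "u l = polar Q w1 t1"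
    unfolding u_def dir_def using l x0[of l] by (subst f1(8)) simp
  have u1: "polar Q w0 t0 = u 1"
    unfolding u_def dir_def using m x0[of 1] by (subst (2) f0(8)) simp
  have turn: "polar (polar Q w1 t1) (sin t1 *\<^sub>R Q - cos t1 *\<^sub>R w1) t1 = Q"
    by (simp add: polar_def algebra_simps flip: scaleR_add_left power2_eq_square)
  have curve: "sph_stick_curve m u w th"
  proof (rule sph_stick_curveI[where N = N])
    show "0 < m" by (rule m0)
  next
    fix i assume i: "i < m"
    consider "i = 0" | "i = l" "i \<noteq> 0" | "i \<noteq> 0" "i \<noteq> l" by blast
    then have "orthonormal_pair (u i) (w i) \<and> 0 < th i \<and> th i < 2 * pi \<and> polar (u i) (w i) (th i) = u (Suc i mod m)
      \<and> N i \<bullet> u i = 0 \<and> N i \<bullet> w i = 0"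
    proof cases
      case 1
      then show ?thesis using f0(1-5) u1 QN m by (simp add: u_def[of 0] w_def th_def inner_commute)
    next
      case 2
      have "N l \<bullet> polar Q w1 t1 = 0" "N l \<bullet> (sin t1 *\<^sub>R Q - cos t1 *\<^sub>R w1) = 0"
        using QN(2) f1(2) by (simp_all add: polar_def inner_add_right inner_diff_right inner_commute[of "N l"])
      then show ?thesis
        using 2 f1(1-5) l ul turn orthonormal_pair_reverse[OF f1(1)] by (simp add: w_def th_def) (simp add: u_def dir_def)
    next
      case 3
      have mi: "orthonormal_pair (dir i) (wm i)" "wm i \<bullet> N i = 0" "0 < tm i" "tm i < pi"
        and xS: "x (Suc i) = norm (x (Suc i)) *\<^sub>R polar (dir i) (wm i) (tm i)"
        using mid i by blast+
      have "Suc i < m" using 3 i l by auto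
      moreover have "polar (u i) (w i) (th i) = u (Suc i)"
      proof -
        have "(1 / norm (x (Suc i))) *\<^sub>R x (Suc i) = polar (dir i) (wm i) (tm i)"
          using x0[of "Suc i"] i by (intro normalize_eq[OF xS]) simp
        then show ?thesis using 3 by (simp add: u_def w_def th_def dir_def)
      qed
      ultimately show ?thesis
        using mi 3 pi_gt_zero by (simp add: u_def dir_def w_def th_def N_def dot_cross_self inner_commute)
    qed
    then show "orthonormal_pair (u i) (w i)" "0 < th i \<and> th i < 2 * pi"
      "polar (u i) (w i) (th i) = u (Suc i mod m)" "N i \<bullet> u i = 0" "N i \<bullet> w i = 0" by simp_all
  next
    fix i k assume ik: "i < m" "k < m" and 0: "N i \<bullet> u k = 0"
    show "k = i \<or> k = Suc i mod m"
    proof (cases "k = 0")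
      case True
      then have "Q \<bullet> N i = 0" using 0 by (simp add: u_def inner_commute)
      then have "i = 0 \<or> i = l" using QNi ik by blast
      then show ?thesis using True l by auto
    next
      case False
      then have "N i \<bullet> x k = 0" using 0 x0[of k] ik by (simp add: u_def dir_def)
      then have "k = i \<or> k = Suc i" using triple[of i k] ik by auto
      then show ?thesis using ik by auto
    qed
  qed (use NN NNN in blast)+
  have graph: "radial_graph (u i) (w i) 0 (th i) (A i) (c i) (c (Suc i mod m))" if i: "i < m" for i
  proof -
    consider "i = 0" | "i = l" "i \<noteq> 0" | "i \<noteq> 0" "i \<noteq> l" by blast
    then show ?thesis
    proof cases
      case 1
      have "radial_graph Q w0 s0 t0 (closed_segment (x 0) (x 1)) (x 0) (x 1)"
      proof -
        have "0 < norm (x 0)" "0 < norm (x 1)" using x0[of 0] x0[of 1] m by simp_all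
        from radial_graph_segment[OF f0(4,6) this, of Q w0] show ?thesis
          unfolding f0(7)[symmetric] f0(8)[symmetric] .
      qed
      then have "radial_graph Q w0 0 t0 (g ` edge_set v (0, 1) \<union> closed_segment (x 0) (x 1)) d (x 1)"
        using radial_graph_union[OF lift0 _ _ _ f0(1), of t0] f0(3,4) vS[of 0] by simp
      moreover have "A 0 = g ` edge_set v (0, 1) \<union> closed_segment (x 0) (x 1)"
        using gS_img[OF m0] S_mid[OF m0] l S_0 by (auto simp: A_def K_def image_Un)
      ultimately show ?thesis using 1 m by (simp add: u_def w_def th_def c_def)
    next
      case 2
      have "radial_graph Q w1 s1 t1 (closed_segment (x m) (x l)) (x m) (x l)"
      proof -
        have "0 < norm (x m)" "0 < norm (x l)" using x0[of m] x0[of l] l by simp_all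
        from radial_graph_segment[OF f1(4,6) this, of Q w1] show ?thesis
          unfolding f1(7)[symmetric] f1(8)[symmetric] .
      qed
      then have "radial_graph Q w1 0 t1 (g ` edge_set v (0, Suc m) \<union> closed_segment (x m) (x l)) d (x l)"
        using radial_graph_union[OF lift1 _ _ _ f1(1), of t1] f1(3,4) vS[of m] by simp
      moreover have "A l = g ` edge_set v (0, Suc m) \<union> closed_segment (x m) (x l)"
        using gS_img[OF l(1)] S_mid[OF l(1)] l S_m
        by (auto simp: A_def K_def image_Un closed_segment_commute)
      ultimately have "radial_graph (u l) (sin t1 *\<^sub>R Q - cos t1 *\<^sub>R w1) 0 t1 (A l) (x l) d"
        unfolding ul using radial_graph_reverse by simp
      then show ?thesis using 2 l by (simp add: w_def th_def c_def)
    next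
      case 3
      have mi: "0 < tm i" "tm i < pi" using mid i by blast+
      have xi: "norm (x i) *\<^sub>R polar (dir i) (wm i) 0 = x i" using x0[of i] i by (simp add: dir_def)
      have xS: "norm (x (Suc i)) *\<^sub>R polar (dir i) (wm i) (tm i) = x (Suc i)"
        by (rule sym) (use mid i in blast)
      have "radial_graph (dir i) (wm i) 0 (tm i) (closed_segment (x i) (x (Suc i))) (x i) (x (Suc i))"
        using radial_graph_segment[of 0 "tm i" "norm (x i)" "norm (x (Suc i))" "dir i" "wm i"] mi x0 i
        unfolding xi xS by simp
      moreover have "A i = closed_segment (x i) (x (Suc i))"
        using 3 gS_img[OF i] S_mid[OF i] by (simp add: A_def K_def)
      moreover have "Suc i < m" using 3 i l by auto
      ultimately show ?thesis using 3 by (simp add: u_def w_def th_def c_def)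
    qed
  qed
  have "(\<Union>i<m. A i) = g ` stick_set n v"
  proof -
    have "(\<Union>i<m. A i) = g ` (\<Union>k\<in>(\<Union>i<m. K i). S k)" by (auto simp: A_def)
    then show ?thesis unfolding K_n by (simp add: stick_set_def S_def)
  qed
  then have "ambient_isotopic (\<Union>i<m. A i) (stick_set n v)"
    using ambient_isotopic_sym[OF ambient_isotopic_image[OF g]] by simp
  from sph_representsI[OF curve graph disj this] show ?thesis unfolding n_def v_def .
qed

section \<open>Triangles are unknotted\<close>

definition trigon :: "real^3 \<Rightarrow> real^3 \<Rightarrow> real^3 \<Rightarrow> (real^3) set" where
  "trigon a b c = closed_segment a b \<union> closed_segment b c \<union> closed_segment c a"

lemma stick_knot_3:
  assumes "stick_knot 3 v"
  shows "stick_set 3 v = trigon (v 0) (v 1) (v 2)" "cross3 (v 1 - v 0) (v 2 - v 0) \<noteq> 0"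
proof -
  have "{..<3} = {0, 1, 2::nat}" by auto
  then show "stick_set 3 v = trigon (v 0) (v 1) (v 2)"
    by (auto simp: stick_set_def trigon_def numeral_2_eq_2)
  have ne: "v 0 \<noteq> v 1" "v 1 \<noteq> v 2" "v 2 \<noteq> v 0"
    using assms stick_knot_distinct[OF assms] by auto
  have int: "closed_segment (v i) (v (Suc i mod 3)) \<inter>
      closed_segment (v (Suc i mod 3)) (v (Suc (Suc i) mod 3)) = {v (Suc i mod 3)}" if "i < 3" for i
    using assms that by (simp add: stick_knot_def)
  have m: "Suc 0 mod 3 = 1" "Suc (Suc 0) mod 3 = 2" "Suc 1 mod 3 = 2" "Suc (Suc 1) mod 3 = 0"
    "Suc 2 mod 3 = 0" "Suc (Suc 2) mod 3 = 1" by simp_all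
  have cap: "closed_segment (v 0) (v 1) \<inter> closed_segment (v 1) (v 2) = {v 1}"
    "closed_segment (v 1) (v 2) \<inter> closed_segment (v 2) (v 0) = {v 2}"
    "closed_segment (v 2) (v 0) \<inter> closed_segment (v 0) (v 1) = {v 0}"
    using int[of 0] int[of 1] int[of 2] unfolding m by simp_all
  have "v 0 \<notin> closed_segment (v 1) (v 2)" "v 1 \<notin> closed_segment (v 2) (v 0)" "v 2 \<notin> closed_segment (v 0) (v 1)"
    using cap ne ends_in_segment by blast+
  \<comment> \<open>Of three collinear points one lies between the other two, that is, on the side
    opposite to it.\<close>
  then have "\<not> collinear {v 1, v 0, v 2}"
    by (auto simp: collinear_between_cases between_mem_segment closed_segment_commute)
  then have "\<not> collinear {0, v 1 - v 0, v 2 - v 0}" by (subst (asm) collinear_3) simp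
  then show "cross3 (v 1 - v 0) (v 2 - v 0) \<noteq> 0" by (simp add: cross_eq_0)
qed

text \<open>At time \<open>t\<close> the component along \<open>a\<close> is multiplied by
  \<open>1 + t * (a \<bullet> w)\<close>, which stays positive; dividing by this factor recovers
  \<open>x\<close>.\<close>

lemma shear_isotopy_map:
  fixes a w :: "real^3"
  assumes "- 1 < a \<bullet> w"
  shows "isotopy_map (\<lambda>x. x + (a \<bullet> x) *\<^sub>R w)"
proof (rule isotopy_mapI[of "\<lambda>p. snd p + (fst p * (a \<bullet> snd p)) *\<^sub>R w"])
  show "continuous_on ({0..1} \<times> UNIV) (\<lambda>p. snd p + (fst p * (a \<bullet> snd p)) *\<^sub>R w)"
    by (intro continuous_intros)
  show "bij (\<lambda>x. snd (t, x) + (fst (t, x) * (a \<bullet> snd (t, x))) *\<^sub>R w)" if t: "t \<in> {0..1}" for t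
  proof -
    define r where "r = 1 + t * (a \<bullet> w)"
    have "r > 0"
    proof (cases "0 \<le> a \<bullet> w")
      case True
      then show ?thesis using t by (simp add: r_def add_pos_nonneg)
    next
      case False
      then have "1 * (a \<bullet> w) \<le> t * (a \<bullet> w)" using t by (intro mult_right_mono_neg) auto
      then show ?thesis using assms by (simp add: r_def)
    qed
    then have r: "r \<noteq> 0" by simp
    have "bij (\<lambda>x. x + (t * (a \<bullet> x)) *\<^sub>R w)"
    proof (rule bij_betw_byWitness[of _ "\<lambda>y. y - (t * (a \<bullet> y) / r) *\<^sub>R w"])
      have "(x + (t * (a \<bullet> x)) *\<^sub>R w) - (t * (a \<bullet> (x + (t * (a \<bullet> x)) *\<^sub>R w)) / r) *\<^sub>R w = x" for x
      proof -
        have "t * (a \<bullet> (x + (t * (a \<bullet> x)) *\<^sub>R w)) = (t * (a \<bullet> x)) * r"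
          by (simp add: r_def inner_add_right algebra_simps)
        then have "t * (a \<bullet> (x + (t * (a \<bullet> x)) *\<^sub>R w)) / r = t * (a \<bullet> x)"
          using nonzero_mult_div_cancel_right[OF r] by metis
        then show ?thesis by (simp only: add_diff_cancel)
      qed
      then show "\<forall>x\<in>UNIV. (x + (t * (a \<bullet> x)) *\<^sub>R w) - (t * (a \<bullet> (x + (t * (a \<bullet> x)) *\<^sub>R w)) / r) *\<^sub>R w = x" by blast
      have "(y - (t * (a \<bullet> y) / r) *\<^sub>R w) + (t * (a \<bullet> (y - (t * (a \<bullet> y) / r) *\<^sub>R w))) *\<^sub>R w = y" for y
      proof -
        have "a \<bullet> (y - (t * (a \<bullet> y) / r) *\<^sub>R w) = (a \<bullet> y) * (1 - t * (a \<bullet> w) / r)"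
          by (simp add: inner_diff_right algebra_simps)
        also have "1 - t * (a \<bullet> w) / r = 1 / r" using r by (simp add: field_simps) (simp add: r_def)
        finally show ?thesis by simp
      qed
      then show "\<forall>y\<in>UNIV. (y - (t * (a \<bullet> y) / r) *\<^sub>R w) + (t * (a \<bullet> (y - (t * (a \<bullet> y) / r) *\<^sub>R w))) *\<^sub>R w = y" by blast
    qed auto
    then show ?thesis by simp
  qed
qed simp_all

lemma triangle_move:
  assumes D: "cross3 b c \<bullet> b' \<noteq> 0"
  shows "ambient_isotopic (trigon 0 b c) (trigon 0 b' c)" "ambient_isotopic (trigon 0 c b) (trigon 0 c b')"
proof -
  \<comment> \<open>The linear functional with value 1 at \<open>b\<close> and \<open>b'\<close> and
    0 at \<open>c\<close>. The shear along \<open>b' - b\<close> with this functional fixes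
    \<open>c\<close> and moves \<open>b\<close> to \<open>b'\<close>.\<close>
  define a where "a = (1 / (cross3 b c \<bullet> b')) *\<^sub>R (cross3 c b' + cross3 b c)"
  have "cross3 c b' \<bullet> b = cross3 b c \<bullet> b'" by (metis cross_triple)
  then have a: "a \<bullet> b = 1" "a \<bullet> c = 0" "a \<bullet> b' = 1"
    using D by (simp_all add: a_def inner_add_left dot_cross_self)
  define g where "g x = x + (a \<bullet> x) *\<^sub>R (b' - b)" for x
  have g: "isotopy_map g"
    unfolding g_def using a by (intro shear_isotopy_map) (simp add: inner_diff_right)
  have g_seg: "g ` closed_segment p q = closed_segment (g p) (g q)" for p q
    by (rule closed_segment_image_affine) (simp add: g_def inner_add_right algebra_simps)
  have gv: "g 0 = 0" "g b = b'" "g c = c" using a by (simp_all add: g_def)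
  have "g ` trigon 0 b c = trigon 0 b' c" "g ` trigon 0 c b = trigon 0 c b'"
    by (simp_all add: trigon_def image_Un g_seg gv)
  then show "ambient_isotopic (trigon 0 b c) (trigon 0 b' c)" "ambient_isotopic (trigon 0 c b) (trigon 0 c b')"
    using ambient_isotopic_image[OF g] by metis+
qed

text \<open>A corner can be moved to any point off the plane of the triangle. With \<open>z\<close>
  off both planes, and \<open>y\<close> off the two planes that \<open>z\<close> spans with
  \<open>c\<close> and with \<open>t\<close>, both triangles move to
  \<open>trigon 0 z y\<close>.\<close>

lemma triangles_isotopic:
  assumes bc: "cross3 b c \<noteq> 0" and st: "cross3 s t \<noteq> 0"
  shows "ambient_isotopic (trigon 0 b c) (trigon 0 s t)"
proof -
  have avoid: "\<exists>z. a1 \<bullet> z \<noteq> 0 \<and> a2 \<bullet> z \<noteq> 0" if "a1 \<noteq> 0" "a2 \<noteq> 0" for a1 a2 :: "real^3"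
  proof -
    have F: "finite {a1, a2}" "0 \<notin> {a1, a2}" using that by auto
    obtain z where "norm (z - 0) < 1" "\<And>a. a \<in> {a1, a2} \<Longrightarrow> a \<bullet> z \<noteq> 0"
      by (rule avoid_planes[OF F zero_less_one, of 0]) (rule that)
    then show ?thesis by blast
  qed
  obtain z where z: "cross3 b c \<bullet> z \<noteq> 0" "cross3 s t \<bullet> z \<noteq> 0"
    using avoid[OF bc st] by blast
  have n: "cross3 c z \<noteq> 0" "cross3 t z \<noteq> 0"
    using z cross_triple[of b c z] cross_triple[of s t z] by auto
  obtain y where y: "cross3 c z \<bullet> y \<noteq> 0" "cross3 t z \<bullet> y \<noteq> 0"
    using avoid[OF n] by blast
  have "ambient_isotopic (trigon 0 b c) (trigon 0 z c)" using triangle_move(1) z(1) by blast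
  moreover have "ambient_isotopic (trigon 0 z c) (trigon 0 z y)" using triangle_move(2) y(1) by blast
  moreover have "ambient_isotopic (trigon 0 z t) (trigon 0 z y)" using triangle_move(2) y(2) by blast
  moreover have "ambient_isotopic (trigon 0 s t) (trigon 0 z t)" using triangle_move(1) z(2) by blast
  ultimately show ?thesis using ambient_isotopic_trans ambient_isotopic_sym by metis
qed

text \<open>The part \<open>q x\<close> is rescaled until its norm is \<open>f x\<close>. The factor
  is constant along rays of \<open>q\<close>, because \<open>f\<close> and the norm scale alike;
  each stage is therefore inverted by dividing by its own factor.\<close>

lemma radial_rescaling_isotopy_map:
  fixes q :: "real^3 \<Rightarrow> real^3" and f :: "real^3 \<Rightarrow> real"
  assumes q: "linear q" "\<And>x. q (q x) = q x"
    and f: "continuous_on UNIV f" "\<And>x. q x \<noteq> 0 \<Longrightarrow> 0 < f x" "\<And>x r. 0 < r \<Longrightarrow> f (x + (r - 1) *\<^sub>R q x) = r * f x"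
      "\<And>x. q x = 0 \<Longrightarrow> f x = 0"
  shows "isotopy_map (\<lambda>x. x + (f x / norm (q x) - 1) *\<^sub>R q x)"
proof -
  define k where "k x = f x / norm (q x) - 1" for x
  define H where "H p = snd p + (fst p * k (snd p)) *\<^sub>R q (snd p)" for p
  have q_scale: "q (x + (r - 1) *\<^sub>R q x) = r *\<^sub>R q x" for x r
    by (simp add: linear_add[OF q(1)] linear_cmul[OF q(1)] q(2)) (simp add: algebra_simps)
  have k_inv: "k (x + (r - 1) *\<^sub>R q x) = k x" if "0 < r" for x r
    using that by (simp add: k_def q_scale f(3))
  have r_pos: "0 < 1 + t * k x" if t: "t \<in> {0..1}" and x: "q x \<noteq> 0" for t x
  proof -
    define c where "c = f x / norm (q x)"
    have c: "0 < c" using f(2)[OF x] x by (simp add: c_def)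
    have "1 + t * k x = (1 - t) + t * c" by (simp add: k_def c_def algebra_simps)
    moreover have "0 < (1 - t) + t * c"
    proof (cases "t = 0")
      case False
      then show ?thesis using t c by (intro add_nonneg_pos mult_pos_pos) auto
    qed simp
    ultimately show ?thesis by simp
  qed
  have contq: "continuous_on UNIV q" using q(1) by (rule linear_continuous_on_compose[OF continuous_on_id])
  have cont1: "continuous (at p within {0..1} \<times> UNIV) H" for p
  proof (cases "q (snd p) = 0")
    case True
    \<comment> \<open>The factor need not converge where \<open>q\<close> vanishes, but the
      displacement is bounded by the difference of two continuous functions that both vanish
      there.\<close>
    define B where "B p = \<bar>fst p\<bar> * \<bar>f (snd p) - norm (q (snd p))\<bar>" for p :: "real \<times> (real^3)"
    have le: "norm ((fst p * k (snd p)) *\<^sub>R q (snd p)) \<le> B p" for p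
    proof (cases "q (snd p) = 0")
      case False
      have "\<bar>k (snd p)\<bar> * norm (q (snd p)) = \<bar>k (snd p) * norm (q (snd p))\<bar>" by (simp add: abs_mult)
      also have "k (snd p) * norm (q (snd p)) = f (snd p) - norm (q (snd p))"
        using False by (simp add: k_def field_simps)
      finally show ?thesis by (simp add: B_def abs_mult mult.assoc)
    qed (simp add: B_def)
    have "continuous_on UNIV B"
      unfolding B_def by (intro continuous_intros continuous_on_compose2[OF f(1)] continuous_on_compose2[OF contq]) auto
    then have "isCont B p" using continuous_on_eq_continuous_at[OF open_UNIV] by blast
    then have "continuous (at p within {0..1} \<times> UNIV) B" by (rule continuous_at_imp_continuous_at_within)
    then have "(B \<longlongrightarrow> B p) (at p within {0..1} \<times> UNIV)" by (simp only: continuous_within)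
    moreover have "B p = 0" using True f(4)[OF True] by (simp add: B_def)
    ultimately have B0: "(B \<longlongrightarrow> 0) (at p within {0..1} \<times> UNIV)" by simp
    have "((\<lambda>p. (fst p * k (snd p)) *\<^sub>R q (snd p)) \<longlongrightarrow> 0) (at p within {0..1} \<times> UNIV)"
      by (rule Lim_null_comparison[OF _ B0]) (intro always_eventually allI le)
    then have "((\<lambda>p. snd p + (fst p * k (snd p)) *\<^sub>R q (snd p)) \<longlongrightarrow> snd p + 0) (at p within {0..1} \<times> UNIV)"
      by (intro tendsto_add tendsto_intros)
    then show ?thesis using True unfolding continuous_within H_def by simp
  next
    case False
    define U where "U = {p :: real \<times> (real^3). q (snd p) \<noteq> 0}"
    have "closed {p :: real \<times> (real^3). q (snd p) = 0}"
      by (intro closed_Collect_eq continuous_on_compose2[OF contq] continuous_intros) auto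
    then have "open U" unfolding U_def by (simp add: open_closed Collect_neg_eq[symmetric])
    moreover have "continuous_on U H"
      unfolding H_def k_def U_def
      by (intro continuous_intros continuous_on_compose2[OF f(1)] continuous_on_compose2[OF contq]) auto
    moreover have "p \<in> U" using False by (simp add: U_def)
    ultimately have "continuous (at p) H" using continuous_on_eq_continuous_at by blast
    then show ?thesis by (rule continuous_at_imp_continuous_at_within)
  qed
  show ?thesis
  proof (rule isotopy_mapI[of H])
    show "continuous_on ({0..1} \<times> UNIV) H"
      using cont1 continuous_on_eq_continuous_within by blast
    show "H (0, x) = x" "H (1, x) = x + (f x / norm (q x) - 1) *\<^sub>R q x" for x
      by (simp_all add: H_def k_def)
    show "bij (\<lambda>x. H (t, x))" if t: "t \<in> {0..1}" for t
    proof (rule bij_betw_byWitness[of _ "\<lambda>y. y + (1 / (1 + t * k y) - 1) *\<^sub>R q y"])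
      have Ht: "H (t, x) = x + ((1 + t * k x) - 1) *\<^sub>R q x" for x by (simp add: H_def)
      have "H (t, x) + (1 / (1 + t * k (H (t, x))) - 1) *\<^sub>R q (H (t, x)) = x" for x
      proof (cases "q x = 0")
        case False
        define r where "r = 1 + t * k x"
        have r: "0 < r" using r_pos[OF t False] by (simp add: r_def)
        have k: "k (x + (r - 1) *\<^sub>R q x) = k x" by (rule k_inv[OF r])
        have "(1 / r - 1) * r = 1 - r" using r by (simp add: field_simps)
        then show ?thesis
          unfolding Ht r_def[symmetric] q_scale k using r by (simp add: algebra_simps)
      qed (simp add: H_def)
      then show "\<forall>x\<in>UNIV. H (t, x) + (1 / (1 + t * k (H (t, x))) - 1) *\<^sub>R q (H (t, x)) = x" by blast
      have "H (t, y + (1 / (1 + t * k y) - 1) *\<^sub>R q y) = y" for y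
      proof (cases "q y = 0")
        case False
        define r where "r = 1 / (1 + t * k y)"
        have r: "0 < r" using r_pos[OF t False] by (simp add: r_def)
        have k: "k (y + (r - 1) *\<^sub>R q y) = k y" by (rule k_inv[OF r])
        have "1 + t * k y = 1 / r" by (simp add: r_def)
        moreover have "(1 / r - 1) * r = 1 - r" using r by (simp add: field_simps)
        ultimately show ?thesis
          unfolding Ht r_def[symmetric] q_scale k by (simp add: algebra_simps)
      qed (simp add: H_def)
      then show "\<forall>y\<in>UNIV. H (t, y + (1 / (1 + t * k y) - 1) *\<^sub>R q y) = y" by blast
    qed auto
  qed
qed

section \<open>Rounding a triangle to a circle\<close>

lemma vec3_eq_iff: "(x :: real^3) = y \<longleftrightarrow> x$1 = y$1 \<and> x$2 = y$2 \<and> x$3 = y$3"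
  by (simp add: vec_eq_iff forall_3)

text \<open>\<open>f\<close> is the Minkowski gauge of this triangle, whose centroid is the origin.
  The rescaling gives \<open>q x\<close> the norm \<open>f x\<close>, so it carries the level set of
  \<open>f\<close> at 1 to the unit circle.\<close>

lemma standard_triangle_unknot:
  "ambient_isotopic (trigon (vector [-1, -1, 0]) (vector [2, -1, 0]) (vector [-1, 2, 0])) unknot"
  (is "ambient_isotopic (trigon ?a ?b ?c) unknot")
proof -
  define q :: "real^3 \<Rightarrow> real^3" where "q x = vector [x$1, x$2, 0]" for x
  define f :: "real^3 \<Rightarrow> real" where "f x = max (- (x$1)) (max (- (x$2)) (x$1 + x$2))" for x
  have qc: "q x $ 1 = x $ 1" "q x $ 2 = x $ 2" "q x $ 3 = 0" for x by (simp_all add: q_def)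
  have q: "linear q" "\<And>x. q (q x) = q x"
    by (simp_all add: linear_iff vec3_eq_iff qc)
  have q0: "q x = 0 \<longleftrightarrow> x$1 = 0 \<and> x$2 = 0" for x by (simp add: vec3_eq_iff qc)
  have nq: "(norm (q x))\<^sup>2 = (x$1)\<^sup>2 + (x$2)\<^sup>2" for x
    unfolding power2_norm_eq_inner by (simp add: inner_vec_def sum_3 qc power2_eq_square)
  have f_scale: "f (x + (r - 1) *\<^sub>R q x) = r * f x" if "0 < r" for x r
  proof -
    have *: "max (r * a) (max (r * b) (r * c)) = r * max a (max b c)" for a b c
      using that by (simp add: max_mult_distrib_left)
    have "(x + (r - 1) *\<^sub>R q x) $ 1 = r * x$1" "(x + (r - 1) *\<^sub>R q x) $ 2 = r * x$2"
      by (simp_all add: qc algebra_simps)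
    then show ?thesis
      unfolding f_def *[symmetric] by (simp add: algebra_simps)
  qed
  have f_cont: "continuous_on UNIV f" unfolding f_def by (intro continuous_intros)
  have f_pos: "0 < f x" if "q x \<noteq> 0" for x
    using that unfolding q0 f_def by linarith
  have f_0: "f x = 0" if "q x = 0" for x
    using that unfolding q0 f_def by simp
  define g where "g x = x + (f x / norm (q x) - 1) *\<^sub>R q x" for x
  have g: "isotopy_map g"
    unfolding g_def by (rule radial_rescaling_isotopy_map[OF q f_cont f_pos f_scale f_0])
  have tri: "trigon ?a ?b ?c = {x. x$3 = 0 \<and> f x = 1}"
  proof (intro equalityI subsetI)
    fix x :: "real^3"
    assume "x \<in> trigon ?a ?b ?c"
    then obtain a b :: "real^3" and t where "0 \<le> t" "t \<le> 1" "x = (1 - t) *\<^sub>R a + t *\<^sub>R b"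
      and ab: "a = ?a \<and> b = ?b \<or> a = ?b \<and> b = ?c \<or>
        a = ?c \<and> b = ?a"
      unfolding trigon_def by (elim UnE closed_segmentE) blast+
    then show "x \<in> {x. x$3 = 0 \<and> f x = 1}" by (elim disjE conjE) (simp_all add: f_def)
  next
    fix x :: "real^3" assume "x \<in> {x. x$3 = 0 \<and> f x = 1}"
    then have x: "x$3 = 0" "f x = 1" by simp_all
    then consider "x$2 = -1" "- 1 \<le> x$1" "x$1 \<le> 2" | "x$1 + x$2 = 1" "- 1 \<le> x$1" "x$1 \<le> 2"
      | "x$1 = -1" "-1 \<le> x$2" "x$2 \<le> 2"
      unfolding f_def by linarith
    then show "x \<in> trigon ?a ?b ?c"
    proof cases
      case 1
      have "x = (1 - (x$1 + 1) / 3) *\<^sub>R ?a + ((x$1 + 1) / 3) *\<^sub>R ?b"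
        using 1 x(1) by (simp add: vec3_eq_iff field_simps)
      moreover have "0 \<le> (x$1 + 1) / 3" "(x$1 + 1) / 3 \<le> 1" using 1 by simp_all
      ultimately have "x \<in> closed_segment ?a ?b" unfolding in_segment by blast
      then show ?thesis by (simp add: trigon_def)
    next
      case 2
      have "x = (1 - (2 - x$1) / 3) *\<^sub>R ?b + ((2 - x$1) / 3) *\<^sub>R ?c"
        using 2 x(1) by (simp add: vec3_eq_iff field_simps)
      moreover have "0 \<le> (2 - x$1) / 3" "(2 - x$1) / 3 \<le> 1" using 2 by simp_all
      ultimately have "x \<in> closed_segment ?b ?c" unfolding in_segment by blast
      then show ?thesis by (simp add: trigon_def)
    next
      case 3
      have "x = (1 - (2 - x$2) / 3) *\<^sub>R ?c + ((2 - x$2) / 3) *\<^sub>R ?a"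
        using 3 x(1) by (simp add: vec3_eq_iff field_simps)
      moreover have "0 \<le> (2 - x$2) / 3" "(2 - x$2) / 3 \<le> 1" using 3 by simp_all
      ultimately have "x \<in> closed_segment ?c ?a" unfolding in_segment by blast
      then show ?thesis by (simp add: trigon_def)
    qed
  qed
  have unk: "unknot = {x. x$3 = 0 \<and> norm (q x) = 1}"
    unfolding unknot_def nq[symmetric] by (simp add: power2_eq_1_iff) (metis norm_ge_zero neg_0_le_iff_le not_one_le_zero)
  have g3: "g x $ 3 = x $ 3" for x by (simp add: g_def qc)
  have "g ` {x. x$3 = 0 \<and> f x = 1} = {x. x$3 = 0 \<and> norm (q x) = 1}"
  proof (intro equalityI subsetI)
    fix y assume "y \<in> g ` {x. x$3 = 0 \<and> f x = 1}"
    then obtain x where x: "y = g x" "x$3 = 0" "f x = 1" by blast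
    have qx: "q x \<noteq> 0" using f_0[of x] x(3) by auto
    have "q (g x) = (f x / norm (q x)) *\<^sub>R q x"
      by (simp add: g_def linear_add[OF q(1)] linear_cmul[OF q(1)] q(2)) (simp add: algebra_simps)
    then have "norm (q y) = 1" using x qx by simp
    then show "y \<in> {x. x$3 = 0 \<and> norm (q x) = 1}" using x g3 by simp
  next
    fix y assume "y \<in> {x. x$3 = 0 \<and> norm (q x) = 1}"
    then have y: "y$3 = 0" "norm (q y) = 1" by simp_all
    then have fy: "0 < f y" by (intro f_pos) auto
    define x where "x = y + (1 / f y - 1) *\<^sub>R q y"
    have yq: "y = q y" using y(1) by (simp add: vec3_eq_iff qc)
    have xq: "x = (1 / f y) *\<^sub>R y" unfolding x_def using yq by (simp add: algebra_simps)
    have fx: "f x = 1" unfolding x_def using f_scale[of "1 / f y" y] fy by simp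
    have qx: "q x = (1 / f y) *\<^sub>R y" unfolding xq using linear_cmul[OF q(1)] yq by simp
    have "norm (q x) = 1 / f y" unfolding qx using y(2) yq fy by simp
    moreover have "1 / f y + (f y - 1) * (1 / f y) = 1" using fy by (simp add: field_simps)
    ultimately have "g x = y" unfolding g_def fx qx by (simp add: xq flip: scaleR_add_left)
    moreover have "x$3 = 0" using y(1) by (simp add: xq)
    ultimately show "y \<in> g ` {x. x$3 = 0 \<and> f x = 1}" using fx by blast
  qed
  then show ?thesis
    unfolding tri unk using ambient_isotopic_image[OF g, of "{x. x$3 = 0 \<and> f x = 1}"] by (simp only:)
qed

lemma stick_knot_3_unknot:
  assumes "stick_knot 3 v"
  shows "ambient_isotopic (stick_set 3 v) unknot"
proof -
  have shift: "ambient_isotopic (trigon a b c) (trigon (a + e) (b + e) (c + e))" for a b c e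
  proof -
    have "(\<lambda>x. x + e) ` closed_segment p q = closed_segment (p + e) (q + e)" for p q
      by (rule closed_segment_image_affine) (simp add: algebra_simps)
    then have "(\<lambda>x. x + e) ` trigon a b c = trigon (a + e) (b + e) (c + e)"
      by (simp add: trigon_def image_Un)
    then show ?thesis
      using ambient_isotopic_image[OF isotopy_map_translation[of e], of "trigon a b c"] by (simp only:)
  qed
  \<comment> \<open>The sides of the standard triangle at its corner
    \<open>vector [-1, -1, 0]\<close>.\<close>
  define s t :: "real^3" where "s = vector [3, 0, 0]" and "t = vector [0, 3, 0]"
  have "cross3 s t $ 3 \<noteq> 0" by (simp add: s_def t_def cross_components)
  then have st: "cross3 s t \<noteq> 0" by auto
  have 1: "ambient_isotopic (stick_set 3 v) (trigon 0 (v 1 - v 0) (v 2 - v 0))"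
    using shift[of "v 0" "v 1" "v 2" "- v 0"] stick_knot_3(1)[OF assms] by simp
  have 2: "ambient_isotopic (trigon 0 (v 1 - v 0) (v 2 - v 0)) (trigon 0 s t)"
    by (rule triangles_isotopic[OF stick_knot_3(2)[OF assms] st])
  have "s + vector [-1, -1, 0] = vector [2, -1, 0]" "t + vector [-1, -1, 0] = vector [-1, 2, 0]"
    by (simp_all add: s_def t_def vec3_eq_iff)
  then have 3: "ambient_isotopic (trigon 0 s t)
      (trigon (vector [-1, -1, 0]) (vector [2, -1, 0]) (vector [-1, 2, 0]))"
    using shift[of 0 s t "vector [-1, -1, 0]"] by simp
  show ?thesis
    by (rule ambient_isotopic_trans[OF 1 ambient_isotopic_trans[OF 2 ambient_isotopic_trans[OF 3 standard_triangle_unknot]]])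
qed

lemma sph_represents_isotopic:
  assumes "sph_represents m K1" "ambient_isotopic K1 K2"
  shows "sph_represents m K2"
  using assms(1) ambient_isotopic_trans[OF _ assms(2)] unfolding sph_represents_def
  by (elim exE conjE) (intro exI conjI; assumption | blast)

theorem theorem3p3:
  fixes n :: nat and v :: "nat \<Rightarrow> real^3"
  assumes "stick_knot n v"
    and "\<not> ambient_isotopic (stick_set n v) unknot"
  shows "(\<exists>m. sph_represents m (stick_set n v)) \<and>
         sps (stick_set n v) \<le> stick_index (stick_set n v) - 2"
proof -
  define K where "K = stick_set n v"
  have "isotopy_map id" using isotopy_map_translation[of 0] by (simp add: id_def)
  then have "ambient_isotopic K K" using ambient_isotopic_image[of id K] by simp
  then have "\<exists>k v. stick_knot k v \<and> ambient_isotopic (stick_set k v) K"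
    using assms(1) K_def by blast
  then have "\<exists>v. stick_knot (stick_index K) v \<and> ambient_isotopic (stick_set (stick_index K) v) K"
    unfolding stick_index_def by (rule LeastI_ex)
  then obtain v' where v': "stick_knot (stick_index K) v'" "ambient_isotopic (stick_set (stick_index K) v') K"
    by blast
  have "stick_index K \<noteq> 3"
  proof
    assume "stick_index K = 3"
    then have "ambient_isotopic (stick_set (stick_index K) v') unknot"
      using v'(1) stick_knot_3_unknot by simp
    then have "ambient_isotopic K unknot"
      using v'(2) ambient_isotopic_sym ambient_isotopic_trans by blast
    then show False using assms(2) K_def by simp
  qed
  moreover have "3 \<le> stick_index K" using v'(1) by (simp add: stick_knot_def)
  ultimately have "4 \<le> stick_index K" by simp
  \<comment> \<open>By the bound just shown, this natural number subtraction is not truncated and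
    leaves at least 2.\<close>
  define m where "m = stick_index K - 2"
  have m: "stick_index K = m + 2" "2 \<le> m" using \<open>4 \<le> stick_index K\<close> by (simp_all add: m_def)
  have sk: "stick_knot (m + 2) v'" using v'(1) m(1) by simp
  obtain x h where x: "stick_knot (m + 2) (case_nat 0 x)"
    "ambient_isotopic (stick_set (m + 2) v') (stick_set (m + 2) (case_nat 0 x))"
    "general_position m x" and h: "\<And>i. i \<le> m \<Longrightarrow> 0 < h \<bullet> x i"
    by (rule stick_knot_normal_form[OF sk]) (rule that)
  have "ambient_isotopic (stick_set (m + 2) v') K" using v'(2) m(1) by simp
  then have "ambient_isotopic (stick_set (m + 2) (case_nat 0 x)) K"
    by (rule ambient_isotopic_trans[OF ambient_isotopic_sym[OF x(2)]])
  with general_position_represents[OF m(2) x(1,3) h] have "sph_represents m K"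
    by (rule sph_represents_isotopic)
  moreover from this have "sps K \<le> m" unfolding sps_def by (rule Least_le)
  ultimately show ?thesis unfolding K_def[symmetric] m(1) by auto
qed

end
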